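(* Let $\mathbb{K}$ be $\mathbb{R}$ or $\mathbb{C}$, and let $(\mathbb{K}^n,+,f)$ and $(\mathbb{K}^n,+,g)$ be locally $\mathbb{K}$-Nash groups, where $f,g:\mathbb{C}^n\dashrightarrow\mathbb{C}^n$ are $\mathbb{K}$-meromorphic maps admitting an algebraic addition theorem (and satisfying condition $( * )$). If $(\mathbb{K}^n,+,f)$ and $(\mathbb{K}^n,+,g)$ are isomorphic as locally $\mathbb{K}$-Nash groups, then $\operatorname{rank}\Lambda_f=\operatorname{rank}\Lambda_g$, where $\Lambda_f$ and $\Lambda_g$ denote the groups of periods of $f$ and $g$.
   Context: Semialgebraic subsets of $\mathbb{C}^n$ are those semialgebraic as subsets of $\mathbb{R}^{2n}$. For $U\subseteq\mathbb{K}^n$ open, $f:U\to\mathbb{K}^m$ is a $\mathbb{K}$-Nash map if $U$ is semialgebraic, $f$ is $\mathbb{K}$-analytic, and for each $i$ there is $P_i\in\mathbb{K}[X_1,\dots,X_n,Y]$ of positive degree in $Y$ with $P_i(u,f_i(u))=0$ for all $u\in U$. A $\mathbb{K}$-Nash diffeomorphism is a $\mathbb{K}$-Nash map that is an analytic diffeomorphism. Charts $(U,\phi),(V,\psi)$ of a $\mathbb{K}$-analytic manifold are $\mathbb{K}$-Nash compatible if $\phi(U),\psi(V)$ are semialgebraic and either $U\cap V=\emptyset$ or $\psi\phi^{-1}:\phi(U\cap V)\to\psi(U\cap V)$ is a $\mathbb{K}$-Nash diffeomorphism. A $\mathbb{K}$-Nash atlas is an analytic atlas with pairwise $\mathbb{K}$-Nash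 compatible charts; a locally $\mathbb{K}$-Nash manifold is a $\mathbb{K}$-analytic manifold with a $\mathbb{K}$-Nash atlas. A (continuous) map $f:M_1\to M_2$ between locally $\mathbb{K}$-Nash manifolds with atlases $\{(U_i,\phi_i)\}$, $\{(V_j,\psi_j)\}$ is locally $\mathbb{K}$-Nash if for every $a\in M_1$ and every $j$ with $f(a)\in V_j$ there are $i$ and an open $U\subseteq U_i$ with $a\in U$, $f(U)\subseteq V_j$ and $\psi_jf\phi_i^{-1}:\phi_i(U)\to\psi_j(V_j)$ a $\mathbb{K}$-Nash map. A locally $\mathbb{K}$-Nash group is a locally $\mathbb{K}$-Nash manifold with a group structure whose multiplication and inversion are locally $\mathbb{K}$-Nash; an isomorphism of such groups is a group isomorphism that is an analytic diffeomorphism and a locally $\mathbb{K}$-Nash map. Let $\mathcal{M}_{\mathbb{K},n}$ be the quotient field of the ring of power series in $n$ variables over $\mathbb{K}$ convergent near the origin. $\phi\in\mathcal{M}_{\mathbb{K},n}^n$ admits an algebraic addition theorem (AAT) if $\phi_1,\dots,\phi_n$ are algebraically independent over $\mathbb{K}$ and each $\phi_i(u+v)$ is algebraic over $\mathbb{K}(\phi_1(u),\dots,\phi_n(u),\phi_1(v),\dots,\phi_n(v))$, where $u,v$ are $n$-tuples of variables. A map $f:\mathbb{C}^n\dashrightarrow\mathbb{C}^m$ is $\mathbb{C}$-meromorphic if it is meromorphic (defined off a proper analytic subset), and $\mathbb{R}$-meromorphic if moreover $\overline{f(\overline{u})}=f(u)$ wherever defined; such an $f$ (for $m=n$) is identified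 with its germ in $\mathcal{M}_{\mathbb{K},n}^n$. Condition $( * )$ for $f:\mathbb{C}^n\dashrightarrow\mathbb{C}^n$: there are $a\in\mathbb{K}^n$ and an open neighbourhood $U\subseteq\mathbb{K}^n$ of $0$ such that $\varphi:U\to\mathbb{K}^n$, $\varphi(u)=f(u+a)$, is an analytic diffeomorphism onto its image. If $f$ is $\mathbb{K}$-meromorphic, admits an AAT and satisfies $( * )$, then for some open neighbourhood $V\subseteq U$ of $0$ the atlas $\{(g+V,\ x\mapsto\varphi(x-g))\}_{g\in\mathbb{K}^n}$ is a $\mathbb{K}$-Nash atlas making $(\mathbb{K}^n,+)$ a locally $\mathbb{K}$-Nash group, denoted $(\mathbb{K}^n,+,f)$; up to isomorphism (given by the identity map) it does not depend on $a,U,V$. Writing that $(\mathbb{K}^n,+,f)$ is a locally $\mathbb{K}$-Nash group always presupposes these properties of $f$. The group of periods of a meromorphic map $f:\mathbb{C}^n\dashrightarrow\mathbb{C}^m$ is $\Lambda_f=\{a\in\mathbb{C}^n \mid f(u)=f(u+a)\}$ (equality of meromorphic maps in $u$). It is a subgroup of $\mathbb{C}^n$, and under condition $( * )$ it is discrete. The rank of a discrete subgroup of $\mathbb{C}^n$ is its rank as a free $\mathbb{Z}$-module. *)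

theory Defs
  imports
    "HOL-Analysis.Analysis"
    "HOL-Algebra.Group"
    "HOL-Library.Poly_Mapping"
    "HOL-Computational_Algebra.Fraction_Field"
begin

section \<open>Multi-indices, polynomials and power series\<close>

text \<open>
  The base field is a set \<open>K\<close> of complex numbers, either \<open>\<real>\<close> or \<open>UNIV\<close>, and \<open>K\<^sup>n\<close> is the
  set \<open>vecs K\<close> of vectors in \<open>complex ^ 'n\<close> whose entries lie in \<open>K\<close>. Topological notions
  on \<open>K\<^sup>n\<close> refer to the subspace topology.
\<close>

definition vecs :: "complex set \<Rightarrow> (complex ^ 'n) set" where
  "vecs K = {z. \<forall>i. z $ i \<in> K}"

abbreviation open_in_vecs :: "complex set \<Rightarrow> (complex ^ 'n) set \<Rightarrow> bool" where
  "open_in_vecs K U \<equiv> openin (top_of_set (vecs K)) U"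

definition mono_eval :: "('v::finite \<Rightarrow> 'a::comm_monoid_mult) \<Rightarrow> ('v \<Rightarrow>\<^sub>0 nat) \<Rightarrow> 'a" where
  "mono_eval x \<alpha> = (\<Prod>i\<in>UNIV. x i ^ Poly_Mapping.lookup \<alpha> i)"

text \<open>
  A polynomial in the variables \<open>'v\<close> is a finitely supported family of coefficients;
  \<open>\<iota>\<close> is the embedding of the coefficients into the ring in which it is evaluated.
\<close>

definition mpoly_eval ::
  "('b \<Rightarrow> 'a) \<Rightarrow> (('v::finite \<Rightarrow>\<^sub>0 nat) \<Rightarrow>\<^sub>0 'b::zero) \<Rightarrow> ('v \<Rightarrow> 'a) \<Rightarrow> 'a::comm_semiring_1" where
  "mpoly_eval \<iota> P x = (\<Sum>\<alpha>\<in>Poly_Mapping.keys P. \<iota> (Poly_Mapping.lookup P \<alpha>) * mono_eval x \<alpha>)"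

definition coeffs_in :: "'b set \<Rightarrow> ('m \<Rightarrow>\<^sub>0 'b::zero) \<Rightarrow> bool" where
  "coeffs_in K P \<longleftrightarrow> range (Poly_Mapping.lookup P) \<subseteq> K"

definition convergent_series :: "(('n::finite \<Rightarrow>\<^sub>0 nat) \<Rightarrow> complex) \<Rightarrow> bool" where
  "convergent_series c \<longleftrightarrow>
     (\<exists>r>0. \<forall>z::complex ^ 'n. norm z < r \<longrightarrow> (\<lambda>\<alpha>. c \<alpha> * mono_eval (($) z) \<alpha>) summable_on UNIV)"

definition analytic_at ::
  "complex set \<Rightarrow> (complex ^ 'n \<Rightarrow> complex) \<Rightarrow> complex ^ 'n \<Rightarrow> bool" where
  "analytic_at K f p \<longleftrightarrow>
     (\<exists>c r. r > 0 \<and> (\<forall>\<alpha>. c \<alpha> \<in> K) \<and>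
        (\<forall>h\<in>vecs K. norm h < r \<longrightarrow>
           ((\<lambda>\<alpha>. c \<alpha> * mono_eval (($) h) \<alpha>) has_sum f (p + h)) UNIV))"

definition analytic_map ::
  "complex set \<Rightarrow> (complex ^ 'n) set \<Rightarrow> (complex ^ 'n \<Rightarrow> complex ^ 'm) \<Rightarrow> bool" where
  "analytic_map K U f \<longleftrightarrow> f ` U \<subseteq> vecs K \<and> (\<forall>p\<in>U. \<forall>i. analytic_at K (\<lambda>z. f z $ i) p)"

definition analytic_diffeo ::
  "complex set \<Rightarrow> (complex ^ 'n) set \<Rightarrow> (complex ^ 'n) set \<Rightarrow> (complex ^ 'n \<Rightarrow> complex ^ 'n) \<Rightarrow> bool" where
  "analytic_diffeo K S T f \<longleftrightarrow>
     open_in_vecs K S \<and> open_in_vecs K T \<and> bij_betw f S T \<and>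
     analytic_map K S f \<and> analytic_map K T (inv_into S f)"


section \<open>Semialgebraic sets and Nash maps\<close>

inductive semialgebraic :: "(real ^ 'm) set \<Rightarrow> bool" where
  pos: "semialgebraic {x. 0 < mpoly_eval (\<lambda>c. c) P (($) x)}"
| Un: "semialgebraic S \<Longrightarrow> semialgebraic T \<Longrightarrow> semialgebraic (S \<union> T)"
| Int: "semialgebraic S \<Longrightarrow> semialgebraic T \<Longrightarrow> semialgebraic (S \<inter> T)"
| Compl: "semialgebraic S \<Longrightarrow> semialgebraic (- S)"

text \<open>
  Subsets of \<open>\<real>\<^sup>n\<close> are read in \<open>real ^ 'n\<close>; subsets of \<open>\<complex>\<^sup>n\<close> are read in \<open>\<real>\<^sup>2\<^sup>n\<close>, with
  the real parts indexed by \<open>Inl\<close> and the imaginary parts by \<open>Inr\<close>.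
\<close>

definition semialg :: "complex set \<Rightarrow> (complex ^ 'n) set \<Rightarrow> bool" where
  "semialg K S \<longleftrightarrow>
     (if K = \<real>
      then S \<subseteq> vecs \<real> \<and> semialgebraic {x :: real ^ 'n. (\<chi> i. complex_of_real (x $ i)) \<in> S}
      else semialgebraic {x :: real ^ ('n + 'n). (\<chi> i. Complex (x $ Inl i) (x $ Inr i)) \<in> S})"

text \<open>In the polynomials below, \<open>None\<close> indexes \<open>Y\<close> and \<open>Some j\<close> indexes \<open>X\<^sub>j\<close>.\<close>

definition nash_map ::
  "complex set \<Rightarrow> (complex ^ 'n) set \<Rightarrow> (complex ^ 'n \<Rightarrow> complex ^ 'm) \<Rightarrow> bool" where
  "nash_map K U f \<longleftrightarrow>
     open_in_vecs K U \<and> semialg K U \<and> analytic_map K U f \<and>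
     (\<forall>i. \<exists>P :: ('n option \<Rightarrow>\<^sub>0 nat) \<Rightarrow>\<^sub>0 complex.
        coeffs_in K P \<and> (\<exists>\<alpha>\<in>Poly_Mapping.keys P. Poly_Mapping.lookup \<alpha> None > 0) \<and>
        (\<forall>u\<in>U. mpoly_eval (\<lambda>c. c) P (case_option (f u $ i) (($) u)) = 0))"

definition nash_diffeo ::
  "complex set \<Rightarrow> (complex ^ 'n) set \<Rightarrow> (complex ^ 'n) set \<Rightarrow> (complex ^ 'n \<Rightarrow> complex ^ 'n) \<Rightarrow> bool" where
  "nash_diffeo K S T f \<longleftrightarrow> nash_map K S f \<and> analytic_diffeo K S T f"


section \<open>Locally Nash manifolds\<close>

type_synonym ('a, 'n) chart = "'a set \<times> ('a \<Rightarrow> complex ^ 'n)"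

definition is_chart :: "complex set \<Rightarrow> 'a topology \<Rightarrow> ('a, 'n::finite) chart \<Rightarrow> bool" where
  "is_chart K X = (\<lambda>(U, \<phi>). openin X U \<and> open_in_vecs K (\<phi> ` U) \<and>
     homeomorphic_map (subtopology X U) (top_of_set (\<phi> ` U)) \<phi>)"

definition transition ::
  "('a, 'n::finite) chart \<Rightarrow> ('a, 'n::finite) chart \<Rightarrow> complex ^ 'n \<Rightarrow> complex ^ 'n" where
  "transition = (\<lambda>(U, \<phi>) (V, \<psi>) z. \<psi> (inv_into U \<phi> z))"

definition analytic_compatible ::
  "complex set \<Rightarrow> ('a, 'n::finite) chart \<Rightarrow> ('a, 'n::finite) chart \<Rightarrow> bool" where
  "analytic_compatible K = (\<lambda>(U, \<phi>) (V, \<psi>).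
     analytic_diffeo K (\<phi> ` (U \<inter> V)) (\<psi> ` (U \<inter> V)) (transition (U, \<phi>) (V, \<psi>)))"

definition nash_compatible ::
  "complex set \<Rightarrow> ('a, 'n::finite) chart \<Rightarrow> ('a, 'n::finite) chart \<Rightarrow> bool" where
  "nash_compatible K = (\<lambda>(U, \<phi>) (V, \<psi>).
     semialg K (\<phi> ` U) \<and> semialg K (\<psi> ` V) \<and>
     (U \<inter> V = {} \<or>
      nash_diffeo K (\<phi> ` (U \<inter> V)) (\<psi> ` (U \<inter> V)) (transition (U, \<phi>) (V, \<psi>))))"

definition analytic_atlas :: "complex set \<Rightarrow> 'a topology \<Rightarrow> ('a, 'n::finite) chart set \<Rightarrow> bool" where
  "analytic_atlas K X A \<longleftrightarrow>
     (\<forall>c\<in>A. is_chart K X c) \<and> (\<Union>c\<in>A. fst c) = topspace X \<and>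
     (\<forall>c\<in>A. \<forall>d\<in>A. analytic_compatible K c d)"

definition nash_atlas :: "complex set \<Rightarrow> 'a topology \<Rightarrow> ('a, 'n::finite) chart set \<Rightarrow> bool" where
  "nash_atlas K X A \<longleftrightarrow>
     analytic_atlas K X A \<and> (\<forall>c\<in>A. \<forall>d\<in>A. nash_compatible K c d)"

definition locally_nash_manifold ::
  "complex set \<Rightarrow> 'a topology \<Rightarrow> ('a, 'n::finite) chart set \<Rightarrow> bool" where
  "locally_nash_manifold K X A \<longleftrightarrow>
     Hausdorff_space X \<and> second_countable X \<and> nash_atlas K X A"

definition locally_nash_map ::
  "complex set \<Rightarrow> 'a topology \<Rightarrow> ('a, 'n::finite) chart set \<Rightarrow> 'b topology \<Rightarrow> ('b, 'm::finite) chart set \<Rightarrow>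
     ('a \<Rightarrow> 'b) \<Rightarrow> bool" where
  "locally_nash_map K X A Y B h \<longleftrightarrow>
     continuous_map X Y h \<and>
     (\<forall>a\<in>topspace X. \<forall>(V, \<psi>)\<in>B. h a \<in> V \<longrightarrow>
        (\<exists>(U', \<phi>)\<in>A. \<exists>U. openin X U \<and> U \<subseteq> U' \<and> a \<in> U \<and> h ` U \<subseteq> V \<and>
           nash_map K (\<phi> ` U) (\<lambda>z. \<psi> (h (inv_into U' \<phi> z)))))"

definition analytic_manifold_map ::
  "complex set \<Rightarrow> 'a topology \<Rightarrow> ('a, 'n::finite) chart set \<Rightarrow> 'b topology \<Rightarrow> ('b, 'm::finite) chart set \<Rightarrow>
     ('a \<Rightarrow> 'b) \<Rightarrow> bool" where
  "analytic_manifold_map K X A Y B h \<longleftrightarrow>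
     continuous_map X Y h \<and>
     (\<forall>(U, \<phi>)\<in>A. \<forall>(V, \<psi>)\<in>B. \<forall>a\<in>U. h a \<in> V \<longrightarrow>
        (\<forall>i. analytic_at K (\<lambda>z. \<psi> (h (inv_into U \<phi> z)) $ i) (\<phi> a)))"

definition analytic_manifold_diffeo ::
  "complex set \<Rightarrow> 'a topology \<Rightarrow> ('a, 'n::finite) chart set \<Rightarrow> 'b topology \<Rightarrow> ('b, 'm::finite) chart set \<Rightarrow>
     ('a \<Rightarrow> 'b) \<Rightarrow> bool" where
  "analytic_manifold_diffeo K X A Y B h \<longleftrightarrow>
     bij_betw h (topspace X) (topspace Y) \<and>
     analytic_manifold_map K X A Y B h \<and>
     analytic_manifold_map K Y B X A (inv_into (topspace X) h)"

text \<open>Product charts take values in \<open>K\<^sup>n \<times> K\<^sup>m = K\<^sup>n\<^sup>+\<^sup>m\<close>.\<close>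

definition join :: "complex ^ 'n \<Rightarrow> complex ^ 'm \<Rightarrow> complex ^ ('n + 'm)" where
  "join u v = (\<chi> s. case_sum (($) u) (($) v) s)"

definition prod_atlas ::
  "('a, 'n::finite) chart set \<Rightarrow> ('b, 'm::finite) chart set \<Rightarrow> ('a \<times> 'b, 'n + 'm) chart set" where
  "prod_atlas A B = {(U \<times> V, \<lambda>(x, y). join (\<phi> x) (\<psi> y)) | U \<phi> V \<psi>. (U, \<phi>) \<in> A \<and> (V, \<psi>) \<in> B}"


section \<open>Locally Nash groups\<close>

record ('a, 'n) manifold_group = "'a monoid" +
  topol :: "'a topology"
  atlas :: "('a, 'n::finite) chart set"

definition locally_nash_group :: "complex set \<Rightarrow> ('a, 'n::finite) manifold_group \<Rightarrow> bool" where
  "locally_nash_group K G \<longleftrightarrow>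
     Group.group G \<and> carrier G = topspace (topol G) \<and>
     locally_nash_manifold K (topol G) (atlas G) \<and>
     locally_nash_map K (prod_topology (topol G) (topol G)) (prod_atlas (atlas G) (atlas G))
       (topol G) (atlas G) (\<lambda>(x, y). x \<otimes>\<^bsub>G\<^esub> y) \<and>
     locally_nash_map K (topol G) (atlas G) (topol G) (atlas G) (m_inv G)"

definition nash_isomorphic ::
  "complex set \<Rightarrow> ('a, 'n::finite) manifold_group \<Rightarrow> ('b, 'm::finite) manifold_group \<Rightarrow> bool" where
  "nash_isomorphic K G H \<longleftrightarrow>
     (\<exists>h. h \<in> iso G H \<and>
        analytic_manifold_diffeo K (topol G) (atlas G) (topol H) (atlas H) h \<and>
        locally_nash_map K (topol G) (atlas G) (topol H) (atlas H) h)"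


section \<open>Meromorphic maps\<close>

text \<open>
  A meromorphic map is represented by a total function that is defined (in the sense of
  meromorphic maps) exactly at the points of \<open>regular f\<close>; its values elsewhere are junk.
\<close>

definition regular :: "(complex ^ 'n \<Rightarrow> complex ^ 'm) \<Rightarrow> (complex ^ 'n) set" where
  "regular f = {p. \<forall>i. analytic_at UNIV (\<lambda>z. f z $ i) p}"

definition analytic_subset :: "(complex ^ 'n) set \<Rightarrow> bool" where
  "analytic_subset A \<longleftrightarrow>
     (\<forall>p. \<exists>W F. open W \<and> p \<in> W \<and> finite F \<and> (\<forall>h\<in>F. \<forall>z\<in>W. analytic_at UNIV h z) \<and>
        A \<inter> W = {z\<in>W. \<forall>h\<in>F. h z = 0})"

definition meromorphic_map :: "(complex ^ 'n \<Rightarrow> complex ^ 'm) \<Rightarrow> bool" where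
  "meromorphic_map f \<longleftrightarrow>
     analytic_subset (- regular f) \<and> - regular f \<noteq> UNIV \<and>
     (\<forall>p i. \<exists>W G H. open W \<and> connected W \<and> p \<in> W \<and>
        (\<forall>z\<in>W. analytic_at UNIV G z \<and> analytic_at UNIV H z) \<and> (\<exists>z\<in>W. H z \<noteq> 0) \<and>
        (\<forall>z\<in>W \<inter> regular f. H z * f z $ i = G z))"

definition cnj_vec :: "complex ^ 'n \<Rightarrow> complex ^ 'n" where
  "cnj_vec z = (\<chi> i. cnj (z $ i))"

definition K_meromorphic :: "complex set \<Rightarrow> (complex ^ 'n \<Rightarrow> complex ^ 'm) \<Rightarrow> bool" where
  "K_meromorphic K f \<longleftrightarrow>
     meromorphic_map f \<and>
     (K = \<real> \<longrightarrow> (\<forall>u. u \<in> regular f \<and> cnj_vec u \<in> regular f \<longrightarrow> cnj_vec (f (cnj_vec u)) = f u))"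

definition periods :: "(complex ^ 'n \<Rightarrow> complex ^ 'm) \<Rightarrow> (complex ^ 'n) set" where
  "periods f = {a. \<forall>u. u \<in> regular f \<and> u + a \<in> regular f \<longrightarrow> f u = f (u + a)}"

text \<open>Meaningful for subgroups with a finite \<open>\<int>\<close>-basis, in particular for discrete ones.\<close>

definition zrank :: "(complex ^ 'n) set \<Rightarrow> nat" where
  "zrank \<Lambda> = (THE r. \<exists>B. finite B \<and> card B = r \<and>
     module.independent (\<lambda>(k::int) x. of_int k *\<^sub>R x) B \<and>
     module.span (\<lambda>(k::int) x. of_int k *\<^sub>R x) B = \<Lambda>)"


section \<open>The ring of convergent power series and its quotient field\<close>

lemma mono_eval_add: "mono_eval x (\<alpha> + \<beta>) = mono_eval x \<alpha> * mono_eval x \<beta>"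
  by (simp add: mono_eval_def lookup_add power_add prod.distrib)

lemma finite_exponents_le:
  "finite {\<beta> :: 'n::finite \<Rightarrow>\<^sub>0 nat. \<forall>i. Poly_Mapping.lookup \<beta> i \<le> Poly_Mapping.lookup \<alpha> i}" (is "finite ?S")
proof -
  have "Poly_Mapping.lookup ` ?S \<subseteq> PiE UNIV (\<lambda>i. {..Poly_Mapping.lookup \<alpha> i})"
    by auto
  moreover have "finite (PiE UNIV (\<lambda>i::'n. {..Poly_Mapping.lookup \<alpha> i}))"
    by (rule finite_PiE) auto
  ultimately have "finite (Poly_Mapping.lookup ` ?S)"
    by (rule finite_subset)
  then show ?thesis
    by (rule finite_imageD) (auto simp: inj_on_def lookup_inject)
qed

definition splits :: "('n \<Rightarrow>\<^sub>0 nat) \<Rightarrow> (('n \<Rightarrow>\<^sub>0 nat) \<times> ('n \<Rightarrow>\<^sub>0 nat)) set" where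
  "splits \<alpha> = {(\<beta>, \<gamma>). \<beta> + \<gamma> = \<alpha>}"

lemma finite_splits [simp]: "finite (splits (\<alpha> :: 'n::finite \<Rightarrow>\<^sub>0 nat))"
proof (rule finite_subset)
  show "splits \<alpha> \<subseteq> {\<beta>. \<forall>i. Poly_Mapping.lookup \<beta> i \<le> Poly_Mapping.lookup \<alpha> i} \<times> {\<beta>. \<forall>i. Poly_Mapping.lookup \<beta> i \<le> Poly_Mapping.lookup \<alpha> i}"
    by (auto simp: splits_def lookup_add)
  show "finite ({\<beta>. \<forall>i. Poly_Mapping.lookup \<beta> i \<le> Poly_Mapping.lookup \<alpha> i} \<times> {\<beta>. \<forall>i. Poly_Mapping.lookup \<beta> i \<le> Poly_Mapping.lookup \<alpha> i})"
    using finite_exponents_le by blast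
qed

definition conv ::
  "(('n::finite \<Rightarrow>\<^sub>0 nat) \<Rightarrow> complex) \<Rightarrow> (('n \<Rightarrow>\<^sub>0 nat) \<Rightarrow> complex) \<Rightarrow> ('n \<Rightarrow>\<^sub>0 nat) \<Rightarrow> complex" where
  "conv a b \<alpha> = (\<Sum>(\<beta>, \<gamma>)\<in>splits \<alpha>. a \<beta> * b \<gamma>)"

lemma convergent_series_finite:
  assumes "finite {\<alpha>. c \<alpha> \<noteq> 0}"
  shows "convergent_series c"
  unfolding convergent_series_def
proof (intro exI[of _ 1] conjI allI impI)
  fix z :: "complex ^ 'a"
  have "(\<lambda>\<alpha>. c \<alpha> * mono_eval (($) z) \<alpha>) summable_on {\<alpha>. c \<alpha> \<noteq> 0}"
    using assms by simp
  also have "?this \<longleftrightarrow> (\<lambda>\<alpha>. c \<alpha> * mono_eval (($) z) \<alpha>) summable_on UNIV"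
    by (rule summable_on_cong_neutral) auto
  finally show \<dots> .
qed simp

lemma convergent_series_add:
  assumes "convergent_series a" "convergent_series b"
  shows "convergent_series (\<lambda>\<alpha>. a \<alpha> + b \<alpha>)"
proof -
  obtain r s where "r > 0" "s > 0" and
    *: "\<And>z. norm z < r \<Longrightarrow> (\<lambda>\<alpha>. a \<alpha> * mono_eval (($) z) \<alpha>) summable_on UNIV"
       "\<And>z. norm z < s \<Longrightarrow> (\<lambda>\<alpha>. b \<alpha> * mono_eval (($) z) \<alpha>) summable_on UNIV"
    using assms by (auto simp: convergent_series_def)
  then show ?thesis
    unfolding convergent_series_def
    by (intro exI[of _ "min r s"]) (auto simp: distrib_right intro!: summable_on_add)
qed

lemma convergent_series_uminus:
  assumes "convergent_series a"
  shows "convergent_series (\<lambda>\<alpha>. - a \<alpha>)"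
  using assms by (simp add: convergent_series_def summable_on_uminus)

lemma summable_conv:
  assumes a: "(\<lambda>\<alpha>. a \<alpha> * mono_eval (($) z) \<alpha>) summable_on UNIV"
    and b: "(\<lambda>\<alpha>. b \<alpha> * mono_eval (($) z) \<alpha>) summable_on UNIV"
  shows "(\<lambda>\<alpha>. conv a b \<alpha> * mono_eval (($) z) \<alpha>) summable_on UNIV"
proof -
  define h where
    "h = (\<lambda>(\<beta>, \<gamma>). (a \<beta> * mono_eval (($) z) \<beta>) * (b \<gamma> * mono_eval (($) z) \<gamma>))"
  have "(\<lambda>\<beta>. norm (a \<beta> * mono_eval (($) z) \<beta>)) summable_on UNIV"
    "(\<lambda>\<gamma>. norm (b \<gamma> * mono_eval (($) z) \<gamma>)) summable_on UNIV"
    using a b by (simp_all add: summable_on_iff_abs_summable_on_complex)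
  then have "(\<lambda>x. norm (h x)) summable_on UNIV \<times> UNIV"
    unfolding Infinite_Sum.abs_summable_on_Sigma_iff h_def prod.case norm_mult infsum_cmult_right'
    by (auto simp: abs_mult infsum_nonneg intro!: summable_on_cmult_right summable_on_cmult_left)
  then have h: "h summable_on UNIV"
    by (simp add: Infinite_Sum.abs_summable_summable)
  have bij: "bij_betw (\<lambda>(\<alpha>, x). x) (Sigma UNIV splits) (UNIV :: (('a \<Rightarrow>\<^sub>0 nat) \<times> ('a \<Rightarrow>\<^sub>0 nat)) set)"
    by (rule bij_betwI[where g = "\<lambda>(\<beta>, \<gamma>). (\<beta> + \<gamma>, (\<beta>, \<gamma>))"]) (auto simp: splits_def)
  have "(\<lambda>(\<alpha>, x). h x) summable_on Sigma UNIV splits"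
    using summable_on_reindex_bij_betw[OF bij, of h] h by (simp add: case_prod_unfold)
  then have "(\<lambda>\<alpha>. infsum h (splits \<alpha>)) summable_on UNIV"
    by (rule summable_on_Sigma_banach)
  also have "(\<lambda>\<alpha>. infsum h (splits \<alpha>)) = (\<lambda>\<alpha>. conv a b \<alpha> * mono_eval (($) z) \<alpha>)"
  proof
    fix \<alpha>
    have "infsum h (splits \<alpha>) = sum h (splits \<alpha>)"
      by simp
    also have "\<dots> = conv a b \<alpha> * mono_eval (($) z) \<alpha>"
      unfolding conv_def sum_distrib_right
      by (rule sum.cong) (auto simp: h_def splits_def mono_eval_add)
    finally show "infsum h (splits \<alpha>) = conv a b \<alpha> * mono_eval (($) z) \<alpha>" .
  qed
  finally show ?thesis .
qed

lemma convergent_series_conv: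
  assumes "convergent_series a" "convergent_series b"
  shows "convergent_series (conv a b)"
proof -
  obtain r s where "r > 0" "s > 0" and
    *: "\<And>z. norm z < r \<Longrightarrow> (\<lambda>\<alpha>. a \<alpha> * mono_eval (($) z) \<alpha>) summable_on UNIV"
       "\<And>z. norm z < s \<Longrightarrow> (\<lambda>\<alpha>. b \<alpha> * mono_eval (($) z) \<alpha>) summable_on UNIV"
    using assms by (auto simp: convergent_series_def)
  then show ?thesis
    unfolding convergent_series_def
    by (intro exI[of _ "min r s"]) (auto intro!: summable_conv)
qed

lemma conv_commute: "conv a b = conv b a"
proof
  fix \<alpha>
  show "conv a b \<alpha> = conv b a \<alpha>"
    unfolding conv_def
    by (rule sum.reindex_bij_witness[where i = "\<lambda>(x, y). (y, x)" and j = "\<lambda>(x, y). (y, x)"])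
       (auto simp: splits_def add.commute mult.commute)
qed

lemma conv_assoc: "conv (conv a b) c = conv a (conv b c)"
proof
  fix \<alpha>
  have "conv (conv a b) c \<alpha> =
      (\<Sum>(x, y)\<in>Sigma (splits \<alpha>) (\<lambda>x. splits (fst x)). a (fst y) * b (snd y) * c (snd x))"
    by (simp add: conv_def case_prod_unfold sum_distrib_right sum.Sigma)
  also have "\<dots> =
      (\<Sum>(x, y)\<in>Sigma (splits \<alpha>) (\<lambda>x. splits (snd x)). a (fst x) * (b (fst y) * c (snd y)))"
    by (rule sum.reindex_bij_witness[where
          i = "\<lambda>((p, q), (r, s)). ((p + r, s), (p, r))" and
          j = "\<lambda>((p, q), (r, s)). ((r, s + q), (s, q))"])
       (auto simp: splits_def add.assoc)
  also have "\<dots> = conv a (conv b c) \<alpha>"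
    by (simp add: conv_def case_prod_unfold sum_distrib_left sum.Sigma)
  finally show "conv (conv a b) c \<alpha> = conv a (conv b c) \<alpha>" .
qed

lemma conv_const:
  fixes a :: "('a::finite \<Rightarrow>\<^sub>0 nat) \<Rightarrow> complex"
  shows "conv (\<lambda>\<alpha>. if \<alpha> = 0 then k else 0) a \<alpha> = k * a \<alpha>"
proof -
  have "conv (\<lambda>\<alpha>. if \<alpha> = 0 then k else 0) a \<alpha> =
      (\<Sum>(\<beta>, \<gamma>)\<in>{(0 :: 'a \<Rightarrow>\<^sub>0 nat, \<alpha>)}. (if \<beta> = 0 then k else 0) * a \<gamma>)"
    unfolding conv_def
    by (rule sum.mono_neutral_cong_right) (simp_all, auto simp: splits_def split: if_splits)
  then show ?thesis
    by simp
qed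

text \<open>An auxiliary injective additive encoding of multi-indices in a linearly ordered monoid.\<close>

definition exp_key :: "('n::finite \<Rightarrow>\<^sub>0 nat) \<Rightarrow> (nat \<Rightarrow>\<^sub>0 nat)" where
  "exp_key \<alpha> = (\<Sum>i\<in>UNIV. Poly_Mapping.single (to_nat i) (Poly_Mapping.lookup \<alpha> i))"

lemma exp_key_add: "exp_key (\<alpha> + \<beta>) = exp_key \<alpha> + exp_key \<beta>"
  by (simp add: exp_key_def lookup_add single_add sum.distrib)

lemma lookup_exp_key: "Poly_Mapping.lookup (exp_key \<alpha>) (to_nat i) = Poly_Mapping.lookup \<alpha> i"
proof -
  have "Poly_Mapping.lookup (exp_key \<alpha>) (to_nat i) = (\<Sum>j\<in>UNIV. if j = i then Poly_Mapping.lookup \<alpha> j else 0)"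
    unfolding exp_key_def lookup_sum
    by (rule sum.cong) (auto simp: lookup_single when_def)
  then show ?thesis
    by simp
qed

lemma exp_key_inject: "exp_key \<alpha> = exp_key \<beta> \<longleftrightarrow> \<alpha> = \<beta>"
  by (metis lookup_exp_key poly_mapping_eqI)

lemma leading_exponent:
  fixes c :: "('n::finite \<Rightarrow>\<^sub>0 nat) \<Rightarrow> complex"
  assumes "c \<noteq> (\<lambda>_. 0)"
  obtains \<alpha> where "c \<alpha> \<noteq> 0"
    "\<And>\<beta>. c \<beta> \<noteq> 0 \<Longrightarrow> (\<Sum>i\<in>UNIV. Poly_Mapping.lookup \<alpha> i) \<le> (\<Sum>i\<in>UNIV. Poly_Mapping.lookup \<beta> i)"
    "\<And>\<beta>. c \<beta> \<noteq> 0 \<Longrightarrow> (\<Sum>i\<in>UNIV. Poly_Mapping.lookup \<beta> i) = (\<Sum>i\<in>UNIV. Poly_Mapping.lookup \<alpha> i) \<Longrightarrow> exp_key \<alpha> \<le> exp_key \<beta>"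
proof -
  define deg where "deg = (\<lambda>\<alpha> :: 'n \<Rightarrow>\<^sub>0 nat. \<Sum>i\<in>UNIV. Poly_Mapping.lookup \<alpha> i)"
  obtain \<alpha>0 where \<alpha>0: "c \<alpha>0 \<noteq> 0" "\<And>\<beta>. c \<beta> \<noteq> 0 \<Longrightarrow> deg \<alpha>0 \<le> deg \<beta>"
    using assms arg_min_natI[of "\<lambda>\<beta>. c \<beta> \<noteq> 0" _ deg] arg_min_nat_le[of "\<lambda>\<beta>. c \<beta> \<noteq> 0" _ deg]
    by (metis ext)
  define S where "S = {\<beta>. c \<beta> \<noteq> 0 \<and> deg \<beta> = deg \<alpha>0}"
  have "S \<subseteq> {\<beta>. \<forall>i. Poly_Mapping.lookup \<beta> i \<le> Poly_Mapping.lookup (Abs_poly_mapping (\<lambda>_::'n. deg \<alpha>0)) i}"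
    unfolding S_def deg_def
    by (auto simp: lookup_Abs_poly_mapping)
       (metis (mono_tags, lifting) UNIV_I finite member_le_sum zero_le)
  then have fin: "finite S"
    by (rule finite_subset) (rule finite_exponents_le)
  have "exp_key ` S \<noteq> {}"
    using \<alpha>0 by (auto simp: S_def)
  then obtain \<alpha> where "\<alpha> \<in> S" "exp_key \<alpha> = Min (exp_key ` S)"
    using Min_in[of "exp_key ` S"] fin by fastforce
  then have "\<alpha> \<in> S" "\<And>\<beta>. \<beta> \<in> S \<Longrightarrow> exp_key \<alpha> \<le> exp_key \<beta>"
    using fin by simp_all
  then show ?thesis
    using \<alpha>0 that[of \<alpha>] unfolding S_def deg_def by auto
qed

lemma conv_nonzero:
  assumes "a \<noteq> (\<lambda>_. 0)" "b \<noteq> (\<lambda>_. 0)"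
  shows "conv a b \<noteq> (\<lambda>_. 0)"
proof -
  obtain \<alpha> where \<alpha>: "a \<alpha> \<noteq> 0"
    "\<And>\<beta>. a \<beta> \<noteq> 0 \<Longrightarrow> (\<Sum>i\<in>UNIV. Poly_Mapping.lookup \<alpha> i) \<le> (\<Sum>i\<in>UNIV. Poly_Mapping.lookup \<beta> i)"
    "\<And>\<beta>. a \<beta> \<noteq> 0 \<Longrightarrow> (\<Sum>i\<in>UNIV. Poly_Mapping.lookup \<beta> i) = (\<Sum>i\<in>UNIV. Poly_Mapping.lookup \<alpha> i) \<Longrightarrow> exp_key \<alpha> \<le> exp_key \<beta>"
    using leading_exponent[OF assms(1)] by blast
  obtain \<beta> where \<beta>: "b \<beta> \<noteq> 0"
    "\<And>\<gamma>. b \<gamma> \<noteq> 0 \<Longrightarrow> (\<Sum>i\<in>UNIV. Poly_Mapping.lookup \<beta> i) \<le> (\<Sum>i\<in>UNIV. Poly_Mapping.lookup \<gamma> i)"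
    "\<And>\<gamma>. b \<gamma> \<noteq> 0 \<Longrightarrow> (\<Sum>i\<in>UNIV. Poly_Mapping.lookup \<gamma> i) = (\<Sum>i\<in>UNIV. Poly_Mapping.lookup \<beta> i) \<Longrightarrow> exp_key \<beta> \<le> exp_key \<gamma>"
    using leading_exponent[OF assms(2)] by blast
  have uniq: "\<gamma> = \<alpha> \<and> \<delta> = \<beta>" if "\<gamma> + \<delta> = \<alpha> + \<beta>" "a \<gamma> \<noteq> 0" "b \<delta> \<noteq> 0" for \<gamma> \<delta>
  proof -
    have "(\<Sum>i\<in>UNIV. Poly_Mapping.lookup (\<gamma> + \<delta>) i) = (\<Sum>i\<in>UNIV. Poly_Mapping.lookup (\<alpha> + \<beta>) i)"
      using that by simp
    then have "(\<Sum>i\<in>UNIV. Poly_Mapping.lookup \<gamma> i) + (\<Sum>i\<in>UNIV. Poly_Mapping.lookup \<delta> i) =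
        (\<Sum>i\<in>UNIV. Poly_Mapping.lookup \<alpha> i) + (\<Sum>i\<in>UNIV. Poly_Mapping.lookup \<beta> i)"
      by (simp add: lookup_add sum.distrib)
    with \<alpha>(2)[OF that(2)] \<beta>(2)[OF that(3)]
    have "(\<Sum>i\<in>UNIV. Poly_Mapping.lookup \<gamma> i) = (\<Sum>i\<in>UNIV. Poly_Mapping.lookup \<alpha> i)"
      "(\<Sum>i\<in>UNIV. Poly_Mapping.lookup \<delta> i) = (\<Sum>i\<in>UNIV. Poly_Mapping.lookup \<beta> i)"
      by linarith+
    then have le: "exp_key \<alpha> \<le> exp_key \<gamma>" "exp_key \<beta> \<le> exp_key \<delta>"
      using \<alpha>(3) \<beta>(3) that by auto
    have "exp_key \<gamma> + exp_key \<delta> = exp_key \<alpha> + exp_key \<beta>"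
      using that(1) by (metis exp_key_add)
    with le have "exp_key \<alpha> = exp_key \<gamma>"
      by (metis add_le_cancel_right add_left_mono antisym order_trans)
    then have "\<gamma> = \<alpha>"
      by (simp add: exp_key_inject)
    with that show ?thesis
      by simp
  qed
  have "conv a b (\<alpha> + \<beta>) = (\<Sum>(\<gamma>, \<delta>)\<in>{(\<alpha>, \<beta>)}. a \<gamma> * b \<delta>)"
    unfolding conv_def
    by (rule sum.mono_neutral_right) (simp, auto simp: splits_def dest: uniq)
  then show ?thesis
    using \<alpha>(1) \<beta>(1) by (auto simp: fun_eq_iff intro!: exI[of _ "\<alpha> + \<beta>"])
qed

typedef 'n cps = "{c :: ('n::finite \<Rightarrow>\<^sub>0 nat) \<Rightarrow> complex. convergent_series c}"
  morphisms cps_coeff Abs_cps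
  by (rule exI[of _ "\<lambda>_. 0"]) (simp add: convergent_series_finite)

setup_lifting type_definition_cps

instantiation cps :: (finite) idom
begin

lift_definition zero_cps :: "'a cps" is "\<lambda>_. 0"
  by (simp add: convergent_series_finite)

lift_definition one_cps :: "'a cps" is "\<lambda>\<alpha>. if \<alpha> = 0 then 1 else 0"
  by (simp add: convergent_series_finite)

lift_definition plus_cps :: "'a cps \<Rightarrow> 'a cps \<Rightarrow> 'a cps" is "\<lambda>a b \<alpha>. a \<alpha> + b \<alpha>"
  by (rule convergent_series_add)

lift_definition uminus_cps :: "'a cps \<Rightarrow> 'a cps" is "\<lambda>a \<alpha>. - a \<alpha>"
  by (rule convergent_series_uminus)

definition minus_cps :: "'a cps \<Rightarrow> 'a cps \<Rightarrow> 'a cps" where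
  "minus_cps a b = a + - b"

lift_definition times_cps :: "'a cps \<Rightarrow> 'a cps \<Rightarrow> 'a cps" is conv
  by (rule convergent_series_conv)

instance
proof
  fix a b c :: "'a cps"
  show "a * b * c = a * (b * c)"
    by transfer (rule conv_assoc)
  show "a * b = b * a"
    by transfer (rule conv_commute)
  show "1 * a = a"
    by transfer (simp add: conv_const fun_eq_iff)
  show "(a + b) * c = a * c + b * c"
    by transfer
       (simp add: conv_def fun_eq_iff distrib_right sum.distrib case_prod_unfold)
  show "0 * a = 0" "a * 0 = 0"
    by (transfer, simp add: conv_def fun_eq_iff)+
  show "a * (b + c) = a * b + a * c"
    by transfer
       (simp add: conv_def fun_eq_iff distrib_left sum.distrib case_prod_unfold)
  show "a + b + c = a + (b + c)" "a + b = b + a" "0 + a = a" "- a + a = 0"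
    by (transfer, simp add: fun_eq_iff algebra_simps)+
  show "a - b = a + - b"
    by (rule minus_cps_def)
  show "(0 :: 'a cps) \<noteq> 1"
    by transfer (auto simp: fun_eq_iff)
  show "a \<noteq> 0 \<Longrightarrow> b \<noteq> 0 \<Longrightarrow> a * b \<noteq> 0"
    by transfer (rule conv_nonzero)
qed

end

lift_definition cps_const :: "complex \<Rightarrow> 'n::finite cps" is "\<lambda>k \<alpha>. if \<alpha> = 0 then k else 0"
  by (simp add: convergent_series_finite)

definition cps_eval :: "'n::finite cps \<Rightarrow> complex ^ 'n \<Rightarrow> complex" where
  "cps_eval a z = (\<Sum>\<^sub>\<infinity>\<alpha>. cps_coeff a \<alpha> * mono_eval (($) z) \<alpha>)"

text \<open>
  The quotient field over \<open>\<complex>\<close> is \<open>'n cps fract\<close>. The quotient field over \<open>K\<close> is the subfield of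
  quotients of series with coefficients in \<open>K\<close>.
\<close>

definition mero_field :: "complex set \<Rightarrow> 'n::finite cps fract set" where
  "mero_field K = {Fract a b | a b. b \<noteq> 0 \<and> range (cps_coeff a) \<subseteq> K \<and> range (cps_coeff b) \<subseteq> K}"

definition mero_const :: "complex \<Rightarrow> 'n::finite cps fract" where
  "mero_const k = Fract (cps_const k) 1"

definition germ :: "(complex ^ 'n \<Rightarrow> complex ^ 'm) \<Rightarrow> 'm \<Rightarrow> 'n::finite cps fract" where
  "germ f i = (THE \<Phi>. \<exists>a b. b \<noteq> 0 \<and> \<Phi> = Fract a b \<and>
     (\<forall>\<^sub>F z in nhds 0. z \<in> regular f \<longrightarrow> cps_eval b z * f z $ i = cps_eval a z))"

text \<open>
  \<open>mero_subst L \<Phi>\<close> is \<open>\<Phi> \<circ> L\<close>. It is used only for surjective linear maps \<open>L\<close>, for which the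
  denominator does not become zero.
\<close>

definition mero_subst ::
  "(complex ^ 'm \<Rightarrow> complex ^ 'n) \<Rightarrow> 'n::finite cps fract \<Rightarrow> 'm::finite cps fract" where
  "mero_subst L \<Phi> = (THE \<Psi>. \<exists>a b a' b'. b \<noteq> 0 \<and> \<Phi> = Fract a b \<and> b' \<noteq> 0 \<and> \<Psi> = Fract a' b' \<and>
     (\<forall>\<^sub>F w in nhds 0. cps_eval a' w = cps_eval a (L w) \<and> cps_eval b' w = cps_eval b (L w)))"

definition fst_vec :: "complex ^ ('n + 'n) \<Rightarrow> complex ^ 'n" where
  "fst_vec w = (\<chi> i. w $ Inl i)"

definition snd_vec :: "complex ^ ('n + 'n) \<Rightarrow> complex ^ 'n" where
  "snd_vec w = (\<chi> i. w $ Inr i)"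

definition is_subfield :: "'a::field set \<Rightarrow> bool" where
  "is_subfield F \<longleftrightarrow> 0 \<in> F \<and> 1 \<in> F \<and>
     (\<forall>x\<in>F. \<forall>y\<in>F. x + y \<in> F \<and> x * y \<in> F) \<and> (\<forall>x\<in>F. - x \<in> F \<and> inverse x \<in> F)"

definition algebraic_over :: "'a::field set \<Rightarrow> 'a \<Rightarrow> bool" where
  "algebraic_over F x \<longleftrightarrow> (\<exists>p. p \<noteq> 0 \<and> (\<forall>i. coeff p i \<in> F) \<and> poly p x = 0)"

definition algebraically_independent ::
  "complex set \<Rightarrow> ('v::finite \<Rightarrow> 'n::finite cps fract) \<Rightarrow> bool" where
  "algebraically_independent K \<Phi> \<longleftrightarrow>
     (\<forall>P :: ('v \<Rightarrow>\<^sub>0 nat) \<Rightarrow>\<^sub>0 complex.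
        coeffs_in K P \<and> P \<noteq> 0 \<longrightarrow> mpoly_eval mero_const P \<Phi> \<noteq> 0)"

definition admits_AAT :: "complex set \<Rightarrow> ('n::finite \<Rightarrow> 'n cps fract) \<Rightarrow> bool" where
  "admits_AAT K \<Phi> \<longleftrightarrow>
     (\<forall>i. \<Phi> i \<in> mero_field K) \<and>
     algebraically_independent K \<Phi> \<and>
     (\<forall>i. algebraic_over
        (is_subfield hull (mero_const ` K \<union> range (\<lambda>j. mero_subst fst_vec (\<Phi> j))
                                       \<union> range (\<lambda>j. mero_subst snd_vec (\<Phi> j))))
        (mero_subst (\<lambda>w. fst_vec w + snd_vec w) (\<Phi> i)))"


section \<open>The groups \<open>(K\<^sup>n, +, f)\<close>\<close>

definition condition_star_at ::
  "complex set \<Rightarrow> (complex ^ 'n \<Rightarrow> complex ^ 'n) \<Rightarrow> complex ^ 'n \<Rightarrow> (complex ^ 'n) set \<Rightarrow> bool" where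
  "condition_star_at K f a U \<longleftrightarrow>
     a \<in> vecs K \<and> open_in_vecs K U \<and> 0 \<in> U \<and> (+) a ` U \<subseteq> regular f \<and>
     (\<exists>T. analytic_diffeo K U T (\<lambda>u. f (u + a)))"

definition condition_star :: "complex set \<Rightarrow> (complex ^ 'n \<Rightarrow> complex ^ 'n) \<Rightarrow> bool" where
  "condition_star K f \<longleftrightarrow> (\<exists>a U. condition_star_at K f a U)"

definition translation_group ::
  "complex set \<Rightarrow> (complex ^ 'n \<Rightarrow> complex ^ 'n) \<Rightarrow> complex ^ 'n \<Rightarrow> (complex ^ 'n) set \<Rightarrow>
     (complex ^ 'n, 'n::finite) manifold_group" where
  "translation_group K f a V =
     \<lparr>carrier = vecs K, monoid.mult = (+), one = 0, topol = top_of_set (vecs K),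
      atlas = {((+) g ` V, \<lambda>x. f (x - g + a)) | g. g \<in> vecs K}\<rparr>"

text \<open>
  \<open>G\<close> is \<open>(K\<^sup>n, +, f)\<close> for one of the admissible choices of \<open>a\<close>, \<open>U\<close> and \<open>V\<close>; the group is
  independent of these choices up to isomorphism only.
\<close>

definition is_translation_group ::
  "complex set \<Rightarrow> (complex ^ 'n \<Rightarrow> complex ^ 'n) \<Rightarrow> (complex ^ 'n, 'n::finite) manifold_group \<Rightarrow> bool" where
  "is_translation_group K f G \<longleftrightarrow>
     (\<exists>a U V. condition_star_at K f a U \<and> V \<subseteq> U \<and> open_in_vecs K V \<and> 0 \<in> V \<and>
        G = translation_group K f a V \<and> locally_nash_group K G)"

end

theory Submission
  imports Defs "HOL-Complex_Analysis.Conformal_Mappings"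
begin

text \<open>
  An isomorphism of the two groups is a \<open>K\<close>-linear map \<open>h\<close>, and being locally Nash at \<open>0\<close> it makes the
  components of \<open>y = g \<circ> h\<close> (up to translations) algebraic over \<open>\<complex>(z)\<close> with \<open>z = f\<close>. If \<open>\<lambda>\<close> is a
  period of \<open>z\<close>, then the translates \<open>y\<^sub>i(x + j\<lambda>)\<close>, \<open>j = 0, 1, \<dots>\<close>, are all roots of the same polynomial over
  the field of meromorphic functions, so two of them coincide; hence \<open>N\<lambda>\<close> is a period of \<open>y\<close> for an \<open>N\<close>
  that does not depend on \<open>\<lambda>\<close>. Conversely, counting dimensions shows that the components of \<open>z\<close> are
  algebraic over \<open>\<complex>(y)\<close>, so the period groups of \<open>z\<close> and \<open>y\<close> are commensurable. The map \<open>h\<close> carries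
  the latter to the period group of \<open>g\<close>, and commensurable groups have bases of the same size.
\<close>

section \<open>Complex differentiability in several variables\<close>

text \<open>The relations between \<open>f\<close> and \<open>g\<close> come from charts, so they
  hold only on a set open in \<open>vecs K\<close>, while periods concern all of C^n. The obstacle
  is to pass from one to the other: the identity theorem has to work across points where the
  functions are undefined and, for \<open>K = \<real>\<close>, from a totally real slice. Power
  series serve only to obtain a complex derivative; differentiability is stable under sums, products
  and affine substitutions without rearranging series, and vanishing is then a question in one
  variable along complex lines. No field of meromorphic functions is formed. A statement about
  finitely many elements of it is tested at a single point of a finite intersection of open dense
  sets, where all functions involved are defined and the required inequalities hold. That one
  \<open>N\<close> serves all periods is essential: it turns commensurability into injective linear
  maps between the two period groups, in both directions. The value is a factorial because the
  indices of two coinciding translates differ by some number from 1 to the degree of the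
  relation.\<close>

definition complex_homogeneous :: "(complex ^ 'n \<Rightarrow> complex) \<Rightarrow> bool" where
  "complex_homogeneous A \<longleftrightarrow> (\<forall>c v. A (c *s v) = c * A v)"

definition holomorphic_at :: "(complex ^ 'n \<Rightarrow> complex) \<Rightarrow> complex ^ 'n \<Rightarrow> bool" where
  "holomorphic_at f p \<longleftrightarrow> (\<exists>A. (f has_derivative A) (at p) \<and> complex_homogeneous A)"

section \<open>First-order expansion of convergent power series\<close>

lemma norm_mono_eval_le:
  fixes h :: "complex ^ 'n"
  assumes "norm h \<le> s"
  shows "norm (mono_eval (($) h) \<alpha>) \<le> s ^ (\<Sum>i\<in>UNIV. Poly_Mapping.lookup \<alpha> i)"
proof -
  have "norm (mono_eval (($) h) \<alpha>) = (\<Prod>i\<in>UNIV. norm (h $ i) ^ Poly_Mapping.lookup \<alpha> i)"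
    by (simp add: mono_eval_def prod_norm[symmetric] norm_power)
  also have "\<dots> \<le> (\<Prod>i\<in>UNIV. s ^ Poly_Mapping.lookup \<alpha> i)"
    using assms by (intro prod_mono conjI power_mono) (auto intro: order_trans[OF Finite_Cartesian_Product.norm_nth_le])
  also have "\<dots> = s ^ (\<Sum>i\<in>UNIV. Poly_Mapping.lookup \<alpha> i)"
    by (simp add: power_sum)
  finally show ?thesis .
qed

lemma norm_const_vec_le: "norm ((\<chi> i. c) :: complex ^ 'n) \<le> real CARD('n) * norm c"
proof -
  have "norm ((\<chi> i. c) :: complex ^ 'n) \<le> (\<Sum>i\<in>(UNIV::'n set). norm ((\<chi> i::'n. c) $ i))"
    unfolding norm_vec_def by (rule L2_set_le_sum) simp
  then show ?thesis
    by simp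
qed

lemma norm_has_sum_le:
  fixes f :: "'a \<Rightarrow> complex"
  assumes "(f has_sum a) S" "(g has_sum b) S" "\<And>x. x \<in> S \<Longrightarrow> norm (f x) \<le> g x"
  shows "norm a \<le> b"
proof -
  have "(\<lambda>x. norm (f x)) summable_on S"
    using has_sum_imp_summable[OF assms(1)] by (simp add: summable_on_iff_abs_summable_on_complex)
  then have sum: "((\<lambda>x. norm (f x)) has_sum (\<Sum>\<^sub>\<infinity>x\<in>S. norm (f x))) S"
    by (rule has_sum_infsum)
  then have "norm a \<le> (\<Sum>\<^sub>\<infinity>x\<in>S. norm (f x))"
    using assms(1) by (rule norm_has_sum_bound)
  also have "\<dots> \<le> b"
    using sum assms(2,3) by (rule has_sum_mono)
  finally show ?thesis .
qed

lemma multi_index_degree_ge_2: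
  fixes \<alpha> :: "'n::finite \<Rightarrow>\<^sub>0 nat"
  assumes "\<alpha> \<noteq> 0" "\<And>i. \<alpha> \<noteq> Poly_Mapping.single i 1"
  shows "2 \<le> (\<Sum>i\<in>UNIV. Poly_Mapping.lookup \<alpha> i)"
proof (rule ccontr)
  obtain i where i: "Poly_Mapping.lookup \<alpha> i \<noteq> 0"
    using assms(1) by (metis lookup_zero poly_mapping_eqI)
  assume "\<not> ?thesis"
  moreover have "(\<Sum>j\<in>UNIV. Poly_Mapping.lookup \<alpha> j) =
      Poly_Mapping.lookup \<alpha> i + (\<Sum>j\<in>UNIV - {i}. Poly_Mapping.lookup \<alpha> j)"
    by (rule sum.remove) auto
  ultimately have "Poly_Mapping.lookup \<alpha> i = 1" "(\<Sum>j\<in>UNIV - {i}. Poly_Mapping.lookup \<alpha> j) = 0"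
    using i by linarith+
  then have "\<alpha> = Poly_Mapping.single i 1"
    by (intro poly_mapping_eqI) (auto simp: lookup_single when_def)
  with assms(2) show False
    by blast
qed

lemma mono_eval_zero [simp]: "mono_eval x 0 = 1"
  by (simp add: mono_eval_def)

lemma mono_eval_single [simp]: "mono_eval x (Poly_Mapping.single i 1) = x i"
proof -
  have "mono_eval x (Poly_Mapping.single i 1) = (\<Prod>j\<in>UNIV. if j = i then x i else 1)"
    unfolding mono_eval_def by (rule prod.cong) (auto simp: lookup_single when_def)
  then show ?thesis
    by simp
qed

text \<open>The terms of degree 1 form the derivative, and an absolutely convergent majorant bounds
  the terms of degree at least 2 by a multiple of \<open>(norm h)\<^sup>2\<close>. The candidate
  \<open>A\<close> is given by coefficients, so it is complex homogeneous on all of C^n even when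
  the derivative is taken within the real points only.\<close>

lemma analytic_at_has_derivative_within:
  fixes f :: "complex ^ 'n \<Rightarrow> complex"
  assumes "analytic_at K f p" and K: "K = \<real> \<or> K = UNIV" and p: "p \<in> vecs K"
  shows "\<exists>A. (f has_derivative A) (at p within vecs K) \<and> complex_homogeneous A"
proof -
  obtain c r where r: "r > 0"
    and sums: "\<And>h. h \<in> vecs K \<Longrightarrow> norm h < r \<Longrightarrow>
      ((\<lambda>\<alpha>. c \<alpha> * mono_eval (($) h) \<alpha>) has_sum f (p + h)) UNIV"
    using assms(1) unfolding analytic_at_def by blast
  define deg where "deg = (\<lambda>\<alpha> :: 'n \<Rightarrow>\<^sub>0 nat. \<Sum>i\<in>UNIV. Poly_Mapping.lookup \<alpha> i)"
  \<comment> \<open>The vector with all entries \<rho> has norm at most \<open>r / 2\<close>, so the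
    series converges absolutely there; this makes the majorant \<open>M\<close> summable.\<close>
  define \<rho> where "\<rho> = r / (2 * real CARD('n))"
  have \<rho>: "\<rho> > 0" "\<rho> < r"
  proof -
    have "1 \<le> real CARD('n)"
      by (simp add: Suc_leI)
    then have "1 < 2 * real CARD('n)"
      by linarith
    then show "\<rho> > 0" "\<rho> < r"
      using r divide_strict_left_mono[of 1 "2 * real CARD('n)" r] by (auto simp: \<rho>_def)
  qed
  define M where "M = (\<lambda>\<alpha>. norm (c \<alpha>) * \<rho> ^ deg \<alpha>)"
  have M: "M summable_on UNIV"
  proof -
    define z where "z = (\<chi> i::'n. complex_of_real \<rho>)"
    have "norm z \<le> real CARD('n) * \<rho>"
      using norm_const_vec_le[of "complex_of_real \<rho>", where 'n = 'n] \<rho> by (simp add: z_def)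
    also have "\<dots> < r"
      using r by (simp add: \<rho>_def)
    finally have "norm z < r" .
    moreover have "z \<in> vecs K"
      using K by (auto simp: vecs_def z_def)
    ultimately have "(\<lambda>\<alpha>. norm (c \<alpha> * mono_eval (($) z) \<alpha>)) summable_on UNIV"
      using sums has_sum_imp_summable by (subst summable_on_iff_abs_summable_on_complex[symmetric]) blast
    also have "(\<lambda>\<alpha>. norm (c \<alpha> * mono_eval (($) z) \<alpha>)) = M"
      using \<rho> by (auto simp: M_def deg_def z_def mono_eval_def norm_mult norm_power
          prod_norm[symmetric] power_sum fun_eq_iff)
    finally show ?thesis .
  qed
  define C where "C = infsum M UNIV / \<rho>\<^sup>2"
  define A where "A = (\<lambda>h::complex ^ 'n. \<Sum>i\<in>UNIV. c (Poly_Mapping.single i 1) * h $ i)"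
  \<comment> \<open>The multi-indices of degree at most 1. Off \<open>D\<close> every term is
    bounded by the majorant times \<open>(norm h / \<rho>)\<^sup>2\<close>.\<close>
  define D where "D = insert 0 (range (\<lambda>i::'n. Poly_Mapping.single i (1::nat)))"
  have f0: "f p = c 0"
  proof -
    have "((\<lambda>\<alpha>. c \<alpha> * mono_eval (($) (0 :: complex ^ 'n)) \<alpha>) has_sum f (p + 0)) UNIV"
      using K r by (intro sums) (auto simp: vecs_def)
    moreover have "mono_eval (($) (0 :: complex ^ 'n)) \<alpha> = 0" if "\<alpha> \<noteq> 0" for \<alpha>
      using that unfolding mono_eval_def
      by (auto simp: prod_zero_iff) (metis lookup_zero neq0_conv poly_mapping_eqI)
    then have "((\<lambda>\<alpha>. c \<alpha> * mono_eval (($) (0 :: complex ^ 'n)) \<alpha>) has_sum c 0) UNIV"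
      using has_sum_finite_neutralI[of "{0}" UNIV "\<lambda>\<alpha>. c \<alpha> * mono_eval (($) (0 :: complex ^ 'n)) \<alpha>"] by simp
    ultimately show ?thesis
      by (metis add.right_neutral has_sum_unique)
  qed
  have bound: "norm (f (p + h) - f p - A h) \<le> C * (norm h)\<^sup>2"
    if h: "h \<in> vecs K" "norm h \<le> \<rho>" for h
  proof -
    have sumD: "(\<Sum>\<alpha>\<in>D. c \<alpha> * mono_eval (($) h) \<alpha>) = f p + A h"
    proof -
      have "(0::'n \<Rightarrow>\<^sub>0 nat) \<notin> range (\<lambda>i::'n. Poly_Mapping.single i (1::nat))"
        by (metis (no_types, lifting) image_iff lookup_single_eq lookup_zero zero_neq_one)
      moreover have "inj (\<lambda>i::'n. Poly_Mapping.single i (1::nat))"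
        by (rule injI) (metis lookup_single_eq lookup_single_not_eq zero_neq_one)
      ultimately show ?thesis
        by (simp add: D_def sum.reindex f0 A_def flip: One_nat_def)
    qed
    have "((\<lambda>\<alpha>. c \<alpha> * mono_eval (($) h) \<alpha>) has_sum f (p + h)) UNIV"
      using h \<rho> by (intro sums) auto
    then have "((\<lambda>\<alpha>. c \<alpha> * mono_eval (($) h) \<alpha>) has_sum (f (p + h) - (f p + A h))) (UNIV - D)"
      using has_sum_Diff[OF _ has_sum_finite[of D "\<lambda>\<alpha>. c \<alpha> * mono_eval (($) h) \<alpha>"]] sumD
      by (simp add: D_def)
    moreover have "((\<lambda>\<alpha>. M \<alpha> * (norm h / \<rho>)\<^sup>2) has_sum infsum M (UNIV - D) * (norm h / \<rho>)\<^sup>2) (UNIV - D)"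
      by (intro has_sum_cmult_left has_sum_infsum summable_on_subset_banach[OF M]) auto
    moreover have "norm (c \<alpha> * mono_eval (($) h) \<alpha>) \<le> M \<alpha> * (norm h / \<rho>)\<^sup>2" if "\<alpha> \<in> UNIV - D" for \<alpha>
    proof -
      have "2 \<le> deg \<alpha>"
        using that unfolding deg_def D_def by (intro multi_index_degree_ge_2) auto
      then have e: "x ^ deg \<alpha> = x\<^sup>2 * x ^ (deg \<alpha> - 2)" for x :: real
        by (metis le_add_diff_inverse power_add)
      have "norm (mono_eval (($) h) \<alpha>) \<le> (norm h)\<^sup>2 * norm h ^ (deg \<alpha> - 2)"
        using norm_mono_eval_le[of h "norm h" \<alpha>] e[of "norm h"] by (simp add: deg_def)
      also have "\<dots> \<le> (norm h)\<^sup>2 * \<rho> ^ (deg \<alpha> - 2)"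
        using h by (intro mult_left_mono power_mono) auto
      also have "\<dots> = \<rho> ^ deg \<alpha> * (norm h / \<rho>)\<^sup>2"
        using \<rho> e[of \<rho>] by (simp add: field_simps)
      finally show ?thesis
        by (simp add: M_def norm_mult mult.assoc mult_left_mono)
    qed
    ultimately have "norm (f (p + h) - (f p + A h)) \<le> infsum M (UNIV - D) * (norm h / \<rho>)\<^sup>2"
      by (rule norm_has_sum_le)
    also have "infsum M (UNIV - D) \<le> infsum M UNIV"
      using \<rho> by (intro infsum_mono_neutral M summable_on_subset_banach[OF M]) (auto simp: M_def)
    then have "infsum M (UNIV - D) * (norm h / \<rho>)\<^sup>2 \<le> C * (norm h)\<^sup>2"
      by (auto simp: C_def power_divide intro!: mult_right_mono divide_right_mono)
    finally show ?thesis
      by (simp add: algebra_simps)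
  qed
  have blA: "bounded_linear A"
    unfolding A_def by (intro bounded_linear_sum bounded_linear_const_mult bounded_linear_vec_nth)
  have "(f has_derivative A) (at p within vecs K)"
  proof (rule has_derivativeI_sandwich[OF \<rho>(1) blA])
    fix y assume y: "y \<in> vecs K" "y \<noteq> p" "dist y p < \<rho>"
    have "y - p \<in> vecs K"
      using K p y by (auto simp: vecs_def)
    then have "norm (f (p + (y - p)) - f p - A (y - p)) \<le> C * (norm (y - p))\<^sup>2"
      using y by (intro bound) (auto simp: dist_norm)
    then show "norm (f y - f p - A (y - p)) / norm (y - p) \<le> C * norm (y - p)"
      using y by (simp add: divide_simps power2_eq_square mult.assoc)
  next
    show "((\<lambda>y. C * norm (y - p)) \<longlongrightarrow> 0) (at p within vecs K)"
      by (intro tendsto_eq_intros refl) auto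
  qed
  moreover have "complex_homogeneous A"
    by (auto simp: complex_homogeneous_def A_def sum_distrib_left intro!: sum.cong)
  ultimately show ?thesis
    by blast
qed

lemma vecs_UNIV [simp]: "vecs UNIV = UNIV"
  by (simp add: vecs_def)

lemma analytic_at_imp_holomorphic_at: "analytic_at UNIV f p \<Longrightarrow> holomorphic_at f p"
  using analytic_at_has_derivative_within[of UNIV f p] by (simp add: holomorphic_at_def)

lemma holomorphic_at_imp_continuous: "holomorphic_at f p \<Longrightarrow> isCont f p"
  unfolding holomorphic_at_def using has_derivative_continuous by blast

lemma holomorphic_at_const: "holomorphic_at (\<lambda>_. c) p"
  unfolding holomorphic_at_def
  by (intro exI[of _ "\<lambda>_. 0"]) (auto simp: complex_homogeneous_def)

lemma holomorphic_at_add: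
  assumes "holomorphic_at f p" "holomorphic_at g p"
  shows "holomorphic_at (\<lambda>x. f x + g x) p"
proof -
  obtain A B where "(f has_derivative A) (at p)" "complex_homogeneous A"
    "(g has_derivative B) (at p)" "complex_homogeneous B"
    using assms unfolding holomorphic_at_def by blast
  then show ?thesis
    unfolding holomorphic_at_def
    by (intro exI[of _ "\<lambda>h. A h + B h"] conjI has_derivative_add)
       (auto simp: complex_homogeneous_def algebra_simps)
qed

lemma holomorphic_at_mult:
  assumes "holomorphic_at f p" "holomorphic_at g p"
  shows "holomorphic_at (\<lambda>x. f x * g x) p"
proof -
  obtain A B where "(f has_derivative A) (at p)" "complex_homogeneous A"
    "(g has_derivative B) (at p)" "complex_homogeneous B"
    using assms unfolding holomorphic_at_def by blast
  then show ?thesis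
    unfolding holomorphic_at_def
    by (intro exI[of _ "\<lambda>h. f p * B h + A h * g p"] conjI has_derivative_mult)
       (auto simp: complex_homogeneous_def algebra_simps)
qed

lemma holomorphic_at_compose_affine:
  fixes L :: "complex ^ 'n \<Rightarrow> complex ^ 'm"
  assumes f: "holomorphic_at f (L p + b)" and L: "bounded_linear L" "\<And>c v. L (c *s v) = c *s L v"
  shows "holomorphic_at (\<lambda>x. f (L x + b)) p"
proof -
  obtain A where A: "(f has_derivative A) (at (L p + b))" "complex_homogeneous A"
    using f unfolding holomorphic_at_def by blast
  have "((\<lambda>x. L x + b) has_derivative L) (at p)"
    using bounded_linear_imp_has_derivative[OF L(1)] by (auto intro!: derivative_eq_intros)
  then have "((\<lambda>x. f (L x + b)) has_derivative (\<lambda>h. A (L h))) (at p)"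
    using A(1) by (rule has_derivative_compose[where g = f])
  moreover have "complex_homogeneous (\<lambda>h. A (L h))"
    using A(2) by (simp add: complex_homogeneous_def L(2))
  ultimately show ?thesis
    unfolding holomorphic_at_def by blast
qed

section \<open>Restriction to complex lines and identity theorems\<close>

lemma bounded_linear_complex_scale: "bounded_linear (\<lambda>c. c *s (v :: complex ^ 'n))"
proof -
  have "linear (\<lambda>c. c *s v)"
    by (rule linearI) (auto simp: vec_eq_iff algebra_simps)
  then show ?thesis
    by (simp add: linear_conv_bounded_linear)
qed

text \<open>Complex homogeneity turns the real derivative along the line into multiplication by the
  number \<open>A v\<close>, that is, into a complex derivative in one variable.\<close>

lemma holomorphic_at_line:
  fixes f :: "complex ^ 'n \<Rightarrow> complex"
  assumes "holomorphic_at f (p + t *s v)"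
  shows "(\<lambda>s. f (p + s *s v)) field_differentiable at t"
proof -
  obtain A where A: "(f has_derivative A) (at (p + t *s v))" "complex_homogeneous A"
    using assms unfolding holomorphic_at_def by blast
  have "((\<lambda>s. p + s *s v) has_derivative (\<lambda>s. s *s v)) (at t)"
    using bounded_linear_imp_has_derivative[OF bounded_linear_complex_scale]
    by (auto intro!: derivative_eq_intros)
  then have "((\<lambda>s. f (p + s *s v)) has_derivative (\<lambda>s. A (s *s v))) (at t)"
    using A(1) by (rule has_derivative_compose[where g = f])
  moreover have "(\<lambda>s. A (s *s v)) = (*) (A v)"
    using A(2) by (auto simp: complex_homogeneous_def)
  ultimately show ?thesis
    unfolding field_differentiable_def has_field_derivative_def by metis
qed

lemma continuous_on_line: "continuous_on S (\<lambda>s. p + s *s (v :: complex ^ 'n))"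
  by (intro continuous_intros linear_continuous_on bounded_linear_complex_scale)

lemma line_preimage:
  fixes p v :: "complex ^ 'n"
  assumes "open W" "convex W"
  shows "open {s. p + s *s v \<in> W}" "convex {s. p + s *s v \<in> W}"
proof -
  show "open {s. p + s *s v \<in> W}"
    using open_vimage[OF assms(1) continuous_on_line] by (simp add: vimage_def)
  show "convex {s. p + s *s v \<in> W}"
  proof (rule convexI)
    fix s t :: complex and x y :: real
    assume "s \<in> {s. p + s *s v \<in> W}" "t \<in> {s. p + s *s v \<in> W}" and xy: "0 \<le> x" "0 \<le> y" "x + y = 1"
    then have "x *\<^sub>R (p + s *s v) + y *\<^sub>R (p + t *s v) \<in> W"
      using assms(2) by (auto intro: convexD)
    also have "x *\<^sub>R (p + s *s v) + y *\<^sub>R (p + t *s v) = (x + y) *\<^sub>R p + (x *\<^sub>R s + y *\<^sub>R t) *s v"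
      by (auto simp: vec_eq_iff algebra_simps)
    finally show "x *\<^sub>R s + y *\<^sub>R t \<in> {s. p + s *s v \<in> W}"
      using xy by simp
  qed
qed

lemma holomorphic_on_line:
  fixes p v :: "complex ^ 'n"
  assumes "open W" "convex W" "\<And>z. z \<in> W \<Longrightarrow> holomorphic_at f z"
  shows "(\<lambda>s. f (p + s *s v)) holomorphic_on {s. p + s *s v \<in> W}"
  using holomorphic_at_line assms unfolding holomorphic_on_open[OF line_preimage(1)[OF assms(1,2)]]
  by (fastforce simp: field_differentiable_def)

text \<open>The complex line through \<open>q\<close> and a point of \<open>V\<close> meets the
  convex set \<open>W\<close> in a convex, hence connected, set of parameters; there the identity
  theorem in one variable applies.\<close>

lemma holomorphic_zero_on_convex:
  fixes W :: "(complex ^ 'n) set"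
  assumes W: "open W" "convex W" "\<And>z. z \<in> W \<Longrightarrow> holomorphic_at f z"
    and V: "open V" "V \<noteq> {}" "V \<subseteq> W" "\<And>z. z \<in> V \<Longrightarrow> f z = 0" and q: "q \<in> W"
  shows "f q = 0"
proof -
  obtain x where x: "x \<in> V"
    using V(2) by blast
  define v where "v = q - x"
  define S where "S = {s. x + s *s v \<in> W}"
  define T where "T = {s. x + s *s v \<in> V}"
  have "open T"
    using open_vimage[OF V(1) continuous_on_line] unfolding T_def vimage_def .
  moreover have "(\<lambda>s. f (x + s *s v)) holomorphic_on S" "open S" "connected S"
    using holomorphic_on_line[OF W] line_preimage[OF W(1,2)] unfolding S_def by (auto intro: convex_connected)
  moreover have "0 \<in> T" "1 \<in> S" "T \<subseteq> S"
    using x q V by (auto simp: S_def T_def v_def)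
  moreover have "f (x + s *s v) = 0" if "s \<in> T" for s
    using that V(4) by (simp add: T_def)
  ultimately have "f (x + 1 *s v) = 0"
    using analytic_continuation_open[of T S "\<lambda>s. f (x + s *s v)" "\<lambda>_. 0" 1] by auto
  then show ?thesis
    by (simp add: v_def)
qed

text \<open>Write \<open>z = u + \<i> *s v\<close> with real \<open>u\<close> and \<open>v\<close>.
  Along \<open>s \<mapsto> u + s *s v\<close> the function vanishes at the real parameters, which
  accumulate at 0, so it vanishes at \<open>s = \<i>\<close> as well.\<close>

lemma holomorphic_zero_on_real_ball:
  fixes x :: "complex ^ 'n"
  assumes x: "x \<in> vecs \<real>" and hol: "\<And>z. z \<in> ball x r \<Longrightarrow> holomorphic_at f z"
    and zero: "\<And>z. z \<in> ball x r \<Longrightarrow> z \<in> vecs \<real> \<Longrightarrow> f z = 0" and z: "z \<in> ball x r"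
  shows "f z = 0"
proof -
  define u v where "u = (\<chi> i. complex_of_real (Re (z $ i)))" and "v = (\<chi> i. complex_of_real (Im (z $ i)))"
  have uv: "u \<in> vecs \<real>" "v \<in> vecs \<real>" "z = u + \<i> *s v"
    by (auto simp: u_def v_def vecs_def vec_eq_iff complex_eq_iff)
  define S where "S = {s. u + s *s v \<in> ball x r}"
  have S: "(\<lambda>s. f (u + s *s v)) holomorphic_on S" "open S" "connected S"
    using holomorphic_on_line[of "ball x r" f u v, OF _ _ hol] line_preimage[of "ball x r" u v]
    unfolding S_def by (auto intro: convex_connected)
  \<comment> \<open>Since \<open>x\<close> is real, taking real parts does not increase the distance
    to \<open>x\<close>; hence \<open>u\<close> stays in the ball and 0 is an admissible
    parameter.\<close>
  have "norm ((u - x) $ i) \<le> norm ((z - x) $ i)" for i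
  proof -
    have "(u - x) $ i = complex_of_real (Re ((z - x) $ i))"
      using x by (auto simp: u_def vecs_def complex_eq_iff complex_is_Real_iff)
    then show ?thesis
      by (metis abs_Re_le_cmod norm_of_real)
  qed
  then have "norm (u - x) \<le> norm (z - x)"
    unfolding norm_vec_def by (intro L2_set_mono) auto
  then have 0: "0 \<in> S"
    using z by (simp add: S_def dist_norm norm_minus_commute)
  have 1: "\<i> \<in> S"
    using z uv by (simp add: S_def)
  have "0 islimpt (S \<inter> \<real>)"
  proof (rule islimptI)
    fix T assume "(0::complex) \<in> T" "open T"
    with 0 S(2) obtain e where e: "e > 0" "ball 0 e \<subseteq> T \<inter> S"
      by (meson IntI open_Int openE)
    have "complex_of_real (e / 2) \<in> ball 0 e"
      using e by simp
    then show "\<exists>y\<in>S \<inter> \<real>. y \<in> T \<and> y \<noteq> 0"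
      using e by (intro bexI[of _ "complex_of_real (e / 2)"]) auto
  qed
  moreover have "f (u + s *s v) = 0" if "s \<in> S \<inter> \<real>" for s
    using that uv by (intro zero) (auto simp: S_def vecs_def)
  ultimately have "f (u + \<i> *s v) = 0"
    using analytic_continuation[OF S _ 0, of "S \<inter> \<real>" \<i>] 1 by auto
  then show ?thesis
    using uv by simp
qed

section \<open>Globally meromorphic functions\<close>

text \<open>Unlike arbitrary dense sets, these are closed under finite intersections, so finitely
  many generic conditions can be met at one point.\<close>

definition open_dense :: "'a::topological_space set \<Rightarrow> bool" where
  "open_dense \<Omega> \<longleftrightarrow> open \<Omega> \<and> (\<forall>V. open V \<and> V \<noteq> {} \<longrightarrow> V \<inter> \<Omega> \<noteq> {})"

text \<open>
  A quotient \<open>G / H\<close> of holomorphic functions; the denominator does not vanish identically on any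
  nonempty open set, which is the form that survives shrinking \<open>W\<close>.
\<close>

definition quotient_on ::
  "(complex ^ 'n) set \<Rightarrow> (complex ^ 'n \<Rightarrow> complex) \<Rightarrow> (complex ^ 'n) set \<Rightarrow>
     (complex ^ 'n \<Rightarrow> complex) \<Rightarrow> (complex ^ 'n \<Rightarrow> complex) \<Rightarrow> bool" where
  "quotient_on \<Omega> \<phi> W G H \<longleftrightarrow>
     open W \<and> (\<forall>z\<in>W. holomorphic_at G z) \<and> (\<forall>z\<in>W. holomorphic_at H z) \<and>
     (\<forall>V. open V \<and> V \<noteq> {} \<and> V \<subseteq> W \<longrightarrow> (\<exists>z\<in>V. H z \<noteq> 0)) \<and>
     (\<forall>z\<in>W \<inter> \<Omega>. H z * \<phi> z = G z)"

definition local_quotient ::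
  "(complex ^ 'n) set \<Rightarrow> (complex ^ 'n \<Rightarrow> complex) \<Rightarrow> complex ^ 'n \<Rightarrow> bool" where
  "local_quotient \<Omega> \<phi> p \<longleftrightarrow> (\<exists>W G H. quotient_on \<Omega> \<phi> W G H \<and> p \<in> W)"

text \<open>The values of \<open>\<phi>\<close> off \<open>\<Omega>\<close> are arbitrary. With the
  domain as a parameter it can be shrunk, so that sums and products are formed over a common
  domain.\<close>

definition meromorphic_fun :: "(complex ^ 'n) set \<Rightarrow> (complex ^ 'n \<Rightarrow> complex) \<Rightarrow> bool" where
  "meromorphic_fun \<Omega> \<phi> \<longleftrightarrow>
     open_dense \<Omega> \<and> (\<forall>z\<in>\<Omega>. holomorphic_at \<phi> z) \<and> (\<forall>p. local_quotient \<Omega> \<phi> p)"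

lemma open_dense_Int: "open_dense A \<Longrightarrow> open_dense B \<Longrightarrow> open_dense (A \<inter> B)"
  unfolding open_dense_def by (simp add: Int_assoc[symmetric] open_Int)

lemma open_dense_UNIV [simp]: "open_dense UNIV"
  by (auto simp: open_dense_def)

lemma open_dense_INT:
  assumes "finite I" "\<And>i. i \<in> I \<Longrightarrow> open_dense (A i)"
  shows "open_dense (\<Inter>i\<in>I. A i)"
  using assms by (induction I rule: finite_induct) (simp_all add: open_dense_Int)

lemma open_dense_vimage:
  assumes "homeomorphism UNIV UNIV T S" "open_dense \<Omega>"
  shows "open_dense {x. T x \<in> \<Omega>}"
  unfolding open_dense_def
proof (intro conjI allI impI)
  have T: "continuous_on UNIV T" "continuous_on UNIV S" "\<And>x. S (T x) = x" "\<And>x. T (S x) = x"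
    using assms(1) by (auto simp: homeomorphism_def)
  show "open {x. T x \<in> \<Omega>}"
    using open_vimage[OF _ T(1), of \<Omega>] assms(2) by (simp add: open_dense_def vimage_def)
  fix V :: "'a set" assume V: "open V \<and> V \<noteq> {}"
  then have "open {y. S y \<in> V}"
    using open_vimage[OF _ T(2), of V] by (simp add: vimage_def)
  moreover have "{y. S y \<in> V} \<noteq> {}"
    using V T by (metis (mono_tags) all_not_in_conv mem_Collect_eq)
  ultimately have "{y. S y \<in> V} \<inter> \<Omega> \<noteq> {}"
    using assms(2) unfolding open_dense_def by blast
  then show "V \<inter> {x. T x \<in> \<Omega>} \<noteq> {}"
    using T by auto
qed

lemma open_nonzero_set:
  fixes f :: "complex ^ 'n \<Rightarrow> complex"
  assumes "open W" "\<And>z. z \<in> W \<Longrightarrow> isCont f z"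
  shows "open {z \<in> W. f z \<noteq> 0}"
proof -
  have "continuous_on W f"
    using assms(2) by (auto intro: continuous_at_imp_continuous_on)
  then have "open (f -` (- {0}) \<inter> W)"
    using continuous_on_open_vimage[OF assms(1), of f] by (simp add: open_Compl)
  then show ?thesis
    by (simp add: vimage_def Int_def conj_commute)
qed

text \<open>The set where two continuous functions differ is open, so it is empty once every
  nonempty open set contains a point of agreement.\<close>

lemma open_dense_eqI:
  fixes f g :: "complex ^ 'n \<Rightarrow> complex"
  assumes "open W" "\<And>z. z \<in> W \<Longrightarrow> isCont f z" "\<And>z. z \<in> W \<Longrightarrow> isCont g z"
    and dense: "\<And>V. open V \<Longrightarrow> V \<noteq> {} \<Longrightarrow> V \<subseteq> W \<Longrightarrow> \<exists>z\<in>V. f z = g z" and "p \<in> W"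
  shows "f p = g p"
proof (rule ccontr)
  assume "f p \<noteq> g p"
  define V where "V = {z \<in> W. f z - g z \<noteq> 0}"
  have "open V"
    unfolding V_def using assms(1-3) by (intro open_nonzero_set continuous_intros)
  moreover have "V \<noteq> {}" "V \<subseteq> W"
    using \<open>f p \<noteq> g p\<close> assms(5) by (auto simp: V_def)
  ultimately show False
    using dense[of V] by (auto simp: V_def)
qed

lemma meromorphic_fun_continuous: "meromorphic_fun \<Omega> \<phi> \<Longrightarrow> z \<in> \<Omega> \<Longrightarrow> isCont \<phi> z"
  by (simp add: meromorphic_fun_def holomorphic_at_imp_continuous)

section \<open>Calculus of local quotients\<close>

lemma quotient_onD:
  assumes "quotient_on \<Omega> \<phi> W G H"
  shows "open W"
    and "z \<in> W \<Longrightarrow> holomorphic_at G z" "z \<in> W \<Longrightarrow> holomorphic_at H z"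
    and "open V \<Longrightarrow> V \<noteq> {} \<Longrightarrow> V \<subseteq> W \<Longrightarrow> \<exists>z\<in>V. H z \<noteq> 0"
    and "z \<in> W \<Longrightarrow> z \<in> \<Omega> \<Longrightarrow> H z * \<phi> z = G z"
  using assms unfolding quotient_on_def by simp_all

lemma quotient_on_subset:
  assumes "quotient_on \<Omega> \<phi> W G H" "open W'" "W' \<subseteq> W"
  shows "quotient_on \<Omega> \<phi> W' G H"
  unfolding quotient_on_def
proof (intro conjI ballI allI impI)
  show "\<exists>z\<in>V. H z \<noteq> 0" if "open V \<and> V \<noteq> {} \<and> V \<subseteq> W'" for V
    using that assms(3) by (intro quotient_onD(4)[OF assms(1)]) auto
qed (use assms quotient_onD[OF assms(1)] in auto)

lemma local_quotientE:
  assumes "local_quotient \<Omega> \<phi> p" "open U" "p \<in> U"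
  obtains W G H where "quotient_on \<Omega> \<phi> W G H" "convex W" "p \<in> W" "W \<subseteq> U"
proof -
  obtain W G H where W: "quotient_on \<Omega> \<phi> W G H" "p \<in> W"
    using assms(1) unfolding local_quotient_def by blast
  have "open (W \<inter> U)" "p \<in> W \<inter> U"
    using quotient_onD(1)[OF W(1)] W(2) assms(2,3) by auto
  then obtain e where e: "e > 0" "ball p e \<subseteq> W \<inter> U"
    by (rule openE)
  then have "quotient_on \<Omega> \<phi> (ball p e) G H"
    by (intro quotient_on_subset[OF W(1)]) auto
  then show ?thesis
    using that[of "ball p e" G H] e by auto
qed

lemma local_quotient_const [intro]: "local_quotient \<Omega> (\<lambda>_. c) p"
proof -
  have "quotient_on \<Omega> (\<lambda>_. c) UNIV (\<lambda>_. c) (\<lambda>_. 1)"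
    by (auto simp: quotient_on_def holomorphic_at_const)
  then show ?thesis
    unfolding local_quotient_def by blast
qed

lemma local_quotient_combine:
  assumes "local_quotient \<Omega> \<phi> p" "local_quotient \<Omega> \<psi> p"
  shows "local_quotient \<Omega> (\<lambda>z. \<phi> z + \<psi> z) p" and "local_quotient \<Omega> (\<lambda>z. \<phi> z * \<psi> z) p"
proof -
  obtain W1 G1 H1 where 1: "quotient_on \<Omega> \<phi> W1 G1 H1" "p \<in> W1"
    using assms(1) unfolding local_quotient_def by blast
  obtain W G H where 2: "quotient_on \<Omega> \<psi> W G H" "p \<in> W" "W \<subseteq> W1"
    using local_quotientE[OF assms(2) quotient_onD(1)[OF 1(1)] 1(2)] by metis
  note D1 = quotient_onD[OF 1(1)] and D = quotient_onD[OF 2(1)]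
  \<comment> \<open>Both denominators must be nonzero at one point: pass to the open part of
    \<open>V\<close> where \<open>H1\<close> is nonzero and look for a point with \<open>H\<close>
    nonzero there.\<close>
  have nz: "\<exists>z\<in>V. H1 z * H z \<noteq> 0" if V: "open V" "V \<noteq> {}" "V \<subseteq> W" for V
  proof -
    have "open {z \<in> V. H1 z \<noteq> 0}"
      using V D1(3) 2(3) by (intro open_nonzero_set) (auto intro!: holomorphic_at_imp_continuous)
    moreover have "{z \<in> V. H1 z \<noteq> 0} \<noteq> {}"
      using D1(4)[of V] V 2(3) by auto
    ultimately show ?thesis
      using D(4)[of "{z \<in> V. H1 z \<noteq> 0}"] V by auto
  qed
  have hol: "holomorphic_at G1 z" "holomorphic_at H1 z" "holomorphic_at G z" "holomorphic_at H z"
    if "z \<in> W" for z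
    using D1 D 2(3) that by auto
  have eq: "G1 z = H1 z * \<phi> z" "G z = H z * \<psi> z" if "z \<in> W" "z \<in> \<Omega>" for z
    using D1(5) D(5) 2(3) that by auto
  have "quotient_on \<Omega> (\<lambda>z. \<phi> z + \<psi> z) W (\<lambda>z. G1 z * H z + G z * H1 z) (\<lambda>z. H1 z * H z)"
    unfolding quotient_on_def
    by (intro conjI ballI holomorphic_at_add holomorphic_at_mult hol D(1)) (use nz in \<open>auto simp: eq algebra_simps\<close>)
  then show "local_quotient \<Omega> (\<lambda>z. \<phi> z + \<psi> z) p"
    using 2(2) unfolding local_quotient_def by blast
  have "quotient_on \<Omega> (\<lambda>z. \<phi> z * \<psi> z) W (\<lambda>z. G1 z * G z) (\<lambda>z. H1 z * H z)"
    unfolding quotient_on_def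
    by (intro conjI ballI holomorphic_at_add holomorphic_at_mult hol D(1)) (use nz in \<open>auto simp: eq algebra_simps\<close>)
  then show "local_quotient \<Omega> (\<lambda>z. \<phi> z * \<psi> z) p"
    using 2(2) unfolding local_quotient_def by blast
qed

lemma meromorphic_fun_const: "open_dense \<Omega> \<Longrightarrow> meromorphic_fun \<Omega> (\<lambda>_. c)"
  by (auto simp: meromorphic_fun_def holomorphic_at_const)

lemma meromorphic_fun_add:
  "meromorphic_fun \<Omega> \<phi> \<Longrightarrow> meromorphic_fun \<Omega> \<psi> \<Longrightarrow> meromorphic_fun \<Omega> (\<lambda>z. \<phi> z + \<psi> z)"
  unfolding meromorphic_fun_def by (intro conjI) (auto intro: holomorphic_at_add local_quotient_combine(1))

lemma meromorphic_fun_mult: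
  "meromorphic_fun \<Omega> \<phi> \<Longrightarrow> meromorphic_fun \<Omega> \<psi> \<Longrightarrow> meromorphic_fun \<Omega> (\<lambda>z. \<phi> z * \<psi> z)"
  unfolding meromorphic_fun_def by (intro conjI) (auto intro: holomorphic_at_mult local_quotient_combine(2))

lemma meromorphic_fun_diff:
  assumes "meromorphic_fun \<Omega> \<phi>" "meromorphic_fun \<Omega> \<psi>"
  shows "meromorphic_fun \<Omega> (\<lambda>z. \<phi> z - \<psi> z)"
proof -
  have "meromorphic_fun \<Omega> (\<lambda>z. \<phi> z + (- 1) * \<psi> z)"
    using assms by (intro meromorphic_fun_add meromorphic_fun_mult meromorphic_fun_const)
      (auto simp: meromorphic_fun_def)
  then show ?thesis
    by simp
qed

lemma meromorphic_fun_sum: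
  assumes "open_dense \<Omega>" "\<And>i. i \<in> I \<Longrightarrow> meromorphic_fun \<Omega> (\<phi> i)"
  shows "meromorphic_fun \<Omega> (\<lambda>z. \<Sum>i\<in>I. \<phi> i z)"
  using assms(2)
  by (induction I rule: infinite_finite_induct)
     (simp_all add: meromorphic_fun_const[OF assms(1)] meromorphic_fun_add)

lemma meromorphic_fun_power:
  assumes "meromorphic_fun \<Omega> \<phi>"
  shows "meromorphic_fun \<Omega> (\<lambda>z. \<phi> z ^ k)"
proof (induction k)
  case 0
  then show ?case
    using meromorphic_fun_const[of \<Omega> 1] assms by (simp add: meromorphic_fun_def)
next
  case (Suc k)
  then show ?case
    using meromorphic_fun_mult[OF assms] by simp
qed

lemma meromorphic_fun_prod:
  assumes "open_dense \<Omega>" "\<And>i. i \<in> I \<Longrightarrow> meromorphic_fun \<Omega> (\<phi> i)"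
  shows "meromorphic_fun \<Omega> (\<lambda>z. \<Prod>i\<in>I. \<phi> i z)"
  using assms(2)
  by (induction I rule: infinite_finite_induct)
     (simp_all add: meromorphic_fun_const[OF assms(1)] meromorphic_fun_mult)

lemma meromorphic_fun_subset:
  assumes "meromorphic_fun \<Omega> \<phi>" "open_dense \<Omega>'" "\<Omega>' \<subseteq> \<Omega>"
  shows "meromorphic_fun \<Omega>' \<phi>"
proof -
  have "quotient_on \<Omega>' \<phi> W G H" if "quotient_on \<Omega> \<phi> W G H" for W G H
    using that assms(3) by (auto simp: quotient_on_def)
  then show ?thesis
    using assms unfolding meromorphic_fun_def local_quotient_def by (auto simp: subset_iff) metis
qed

lemma meromorphic_fun_compose_affine:
  fixes L :: "complex ^ 'n \<Rightarrow> complex ^ 'n"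
  assumes \<phi>: "meromorphic_fun \<Omega> \<phi>"
    and L: "bounded_linear L" "\<And>c v. L (c *s v) = c *s L v" "bij L"
  shows "meromorphic_fun {x. L x + b \<in> \<Omega>} (\<lambda>x. \<phi> (L x + b))"
proof -
  define T where "T = (\<lambda>x. L x + b)"
  obtain L' where L': "linear L'" "\<And>x. L (L' x) = x" "\<And>x. L' (L x) = x"
    using linear_injective_isomorphism[OF bounded_linear.linear[OF L(1)] bij_is_inj[OF L(3)]] that by auto
  define S where "S = (\<lambda>y. L' (y - b))"
  have cont: "continuous_on A T" "continuous_on A S" for A
    using L(1) L'(1)
    by (auto simp: T_def S_def linear_conv_bounded_linear
        intro!: continuous_intros bounded_linear.continuous_on[of L] bounded_linear.continuous_on[of L'])
  have TS: "T (S y) = y" "S (T x) = x" for x y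
    by (simp_all add: T_def S_def L')
  have hom: "homeomorphism UNIV UNIV T S"
    using cont surjI[of T S, OF TS(1)] surjI[of S T, OF TS(2)] TS by (simp add: homeomorphism_def)
  have hol: "holomorphic_at (\<lambda>x. g (T x)) z" if "holomorphic_at g (T z)" for g z
    using holomorphic_at_compose_affine[OF that[unfolded T_def] L(1,2)] by (simp add: T_def)
  have "local_quotient {x. T x \<in> \<Omega>} (\<lambda>x. \<phi> (T x)) p" for p
  proof -
    have "local_quotient \<Omega> \<phi> (T p)"
      using \<phi> by (simp add: meromorphic_fun_def)
    then obtain W G H where W: "quotient_on \<Omega> \<phi> W G H" "T p \<in> W"
      unfolding local_quotient_def by blast
    note D = quotient_onD[OF W(1)]
    have "\<exists>z\<in>V. H (T z) \<noteq> 0" if V: "open V" "V \<noteq> {}" "V \<subseteq> {x. T x \<in> W}" for V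
    proof -
      have "open {y. S y \<in> V}"
        using V open_vimage[OF _ cont(2), of V] by (simp add: vimage_def)
      moreover have "T x \<in> {y. S y \<in> V} \<longleftrightarrow> x \<in> V" for x
        by (simp add: TS)
      then have "{y. S y \<in> V} \<noteq> {}"
        using V(2) by blast
      moreover have "{y. S y \<in> V} \<subseteq> W"
        using V(3) TS(1) by (metis (mono_tags, lifting) mem_Collect_eq subset_iff)
      ultimately obtain y where "S y \<in> V" "H y \<noteq> 0"
        using D(4)[of "{y. S y \<in> V}"] by blast
      then show ?thesis
        using TS(1) by metis
    qed
    moreover have "open {x. T x \<in> W}"
      using open_vimage[OF D(1) cont(1)] by (simp add: vimage_def)
    ultimately have "quotient_on {x. T x \<in> \<Omega>} (\<lambda>x. \<phi> (T x)) {x. T x \<in> W} (\<lambda>x. G (T x)) (\<lambda>x. H (T x))"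
      using D hol unfolding quotient_on_def by auto
    then show ?thesis
      using W(2) unfolding local_quotient_def by blast
  qed
  then show ?thesis
    using \<phi> hol open_dense_vimage[OF hom] unfolding meromorphic_fun_def T_def by auto
qed

text \<open>An open dense \<open>\<Omega>\<close> may be disconnected, so the argument runs in the
  whole space: numerators and denominators are defined off \<open>\<Omega>\<close> too and carry the
  vanishing across the points where \<open>\<phi>\<close> is undefined.\<close>

theorem meromorphic_fun_eq_zero:
  assumes \<phi>: "meromorphic_fun \<Omega> \<phi>" and X: "open X" "X \<noteq> {}" "X \<subseteq> \<Omega>" "\<And>z. z \<in> X \<Longrightarrow> \<phi> z = 0"
    and z: "z \<in> \<Omega>"
  shows "\<phi> z = 0"
proof -
  \<comment> \<open>Points off \<open>\<Omega>\<close> are put into \<open>S\<close>, so that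
    \<open>interior S\<close> can be open and closed in the whole connected space.\<close>
  define S where "S = {x. x \<in> \<Omega> \<longrightarrow> \<phi> x = 0}"
  define Z where "Z = interior S"
  have "closed Z"
    unfolding closure_subset_eq[symmetric]
  proof
    fix p assume p: "p \<in> closure Z"
    have "local_quotient \<Omega> \<phi> p"
      using \<phi> by (simp add: meromorphic_fun_def)
    then obtain W G H where W: "quotient_on \<Omega> \<phi> W G H" "convex W" "p \<in> W"
      using local_quotientE[of \<Omega> \<phi> p UNIV] by auto
    note D = quotient_onD[OF W(1)]
    have "Z \<inter> W \<noteq> {}"
      using p W(3) open_Int_closure_eq_empty[OF D(1), of Z] by auto
    then have "open (Z \<inter> W \<inter> \<Omega>)" "Z \<inter> W \<inter> \<Omega> \<noteq> {}"
      using \<phi> D(1) open_Int[OF open_Int[OF open_interior D(1)], of \<Omega> S] open_Int[OF open_interior D(1)]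
      unfolding meromorphic_fun_def open_dense_def Z_def by auto
    moreover have "G z = 0" if "z \<in> Z \<inter> W \<inter> \<Omega>" for z
      using that D(5)[of z] interior_subset[of S] unfolding Z_def S_def by auto
    ultimately have G: "G z = 0" if "z \<in> W" for z
      using holomorphic_zero_on_convex[OF D(1) W(2) D(2), of "Z \<inter> W \<inter> \<Omega>"] that by auto
    \<comment> \<open>From \<open>H z * \<phi> z = 0\<close> the claim follows where
      \<open>H\<close> is nonzero. Such points are dense, and continuity does the rest.\<close>
    have "\<phi> z = 0" if "z \<in> W \<inter> \<Omega>" for z
    proof (rule open_dense_eqI[of "W \<inter> \<Omega>" \<phi> "\<lambda>_. 0"])
      show "open (W \<inter> \<Omega>)"
        using D(1) \<phi> by (auto simp: meromorphic_fun_def open_dense_def)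
      fix V assume "open V" "V \<noteq> {}" "V \<subseteq> W \<inter> \<Omega>"
      then show "\<exists>z\<in>V. \<phi> z = 0"
        using D(4)[of V] D(5) G by (metis Int_iff mult_eq_0_iff subset_iff)
    qed (use that meromorphic_fun_continuous[OF \<phi>] in auto)
    then have "W \<subseteq> S"
      by (auto simp: S_def)
    then show "p \<in> Z"
      using D(1) W(3) by (auto simp: Z_def interior_def)
  qed
  moreover have "open Z"
    by (simp add: Z_def)
  moreover have "X \<subseteq> Z"
    unfolding Z_def using X by (intro interior_maximal) (auto simp: S_def)
  ultimately have "Z = UNIV"
    using X(2) connected_UNIV clopen[of Z] by auto
  then show ?thesis
    using z interior_subset[of S] unfolding Z_def S_def by auto
qed

lemma meromorphic_fun_nonzero_open_dense:
  assumes \<phi>: "meromorphic_fun \<Omega> \<phi>" and "z0 \<in> \<Omega>" "\<phi> z0 \<noteq> 0"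
  shows "open_dense {z \<in> \<Omega>. \<phi> z \<noteq> 0}"
  unfolding open_dense_def
proof (intro conjI allI impI)
  have \<Omega>: "open_dense \<Omega>"
    using \<phi> by (simp add: meromorphic_fun_def)
  then show "open {z \<in> \<Omega>. \<phi> z \<noteq> 0}"
    using meromorphic_fun_continuous[OF \<phi>] by (intro open_nonzero_set) (auto simp: open_dense_def)
  fix V :: "(complex ^ 'a) set" assume V: "open V \<and> V \<noteq> {}"
  then have "open (V \<inter> \<Omega>)" "V \<inter> \<Omega> \<noteq> {}"
    using \<Omega> by (auto simp: open_dense_def)
  then show "V \<inter> {z \<in> \<Omega>. \<phi> z \<noteq> 0} \<noteq> {}"
    using meromorphic_fun_eq_zero[OF \<phi>, of "V \<inter> \<Omega>" z0] assms by auto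
qed

text \<open>For \<open>K = \<real>\<close> the set \<open>X\<close> is only open in the totally real subspace \<open>\<real>\<^sup>n\<close>.\<close>

theorem meromorphic_fun_eq_zero_on_vecs:
  fixes \<phi> :: "complex ^ 'n \<Rightarrow> complex"
  assumes \<phi>: "meromorphic_fun \<Omega> \<phi>" and K: "K = \<real> \<or> K = UNIV"
    and X: "open_in_vecs K X" "X \<noteq> {}" "X \<subseteq> \<Omega>" "\<And>z. z \<in> X \<Longrightarrow> \<phi> z = 0"
    and z: "z \<in> \<Omega>"
  shows "\<phi> z = 0"
proof -
  obtain x where x: "x \<in> X"
    using X(2) by blast
  obtain T where T: "open T" "X = vecs K \<inter> T"
    using X(1) by (auto simp: openin_open)
  have "open (T \<inter> \<Omega>)" "x \<in> T \<inter> \<Omega>"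
    using T x X \<phi> by (auto simp: meromorphic_fun_def open_dense_def)
  then obtain r where r: "r > 0" "ball x r \<subseteq> T \<inter> \<Omega>"
    by (meson openE)
  have "\<phi> w = 0" if w: "w \<in> ball x r" for w
  proof (cases "K = UNIV")
    case True
    then show ?thesis
      using w r T X(4) by auto
  next
    case False
    then have "K = \<real>"
      using K by simp
    then show ?thesis
      using \<phi> r T x w X(4)
      by (intro holomorphic_zero_on_real_ball[of x r \<phi> w]) (auto simp: meromorphic_fun_def)
  qed
  then show ?thesis
    using meromorphic_fun_eq_zero[OF \<phi>, of "ball x r"] r z by auto
qed

section \<open>Periods\<close>

text \<open>The codomain is arbitrary, so that the notion covers vector-valued maps as well as their
  components.\<close>

definition fun_periods :: "(complex ^ 'n) set \<Rightarrow> (complex ^ 'n \<Rightarrow> 'a) \<Rightarrow> (complex ^ 'n) set" where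
  "fun_periods \<Omega> \<phi> = {a. \<forall>u. u \<in> \<Omega> \<and> u + a \<in> \<Omega> \<longrightarrow> \<phi> u = \<phi> (u + a)}"

lemma open_dense_translate:
  fixes \<Omega> :: "(complex ^ 'n) set"
  assumes "open_dense \<Omega>"
  shows "open_dense {x. x + a \<in> \<Omega>}"
proof (rule open_dense_vimage[OF _ assms])
  show "homeomorphism UNIV UNIV (\<lambda>x. x + a) (\<lambda>x. x - a)"
    by (auto simp: homeomorphism_def image_iff intro!: continuous_intros exI[of _ "_ - a"] exI[of _ "_ + a"])
qed

lemma meromorphic_fun_translate:
  "meromorphic_fun \<Omega> \<phi> \<Longrightarrow> meromorphic_fun {x. x + a \<in> \<Omega>} (\<lambda>x. \<phi> (x + a))"
  using meromorphic_fun_compose_affine[of \<Omega> \<phi> "\<lambda>x. x" a] by (simp add: bounded_linear_ident bij_id[unfolded id_def])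

lemma fun_periods_zero: "0 \<in> fun_periods \<Omega> \<phi>"
  by (simp add: fun_periods_def)

lemma fun_periods_uminus: "a \<in> fun_periods \<Omega> \<phi> \<Longrightarrow> - a \<in> fun_periods \<Omega> \<phi>"
  unfolding fun_periods_def by (auto dest: spec[of _ "_ - a"])

text \<open>The intermediate point \<open>u + a\<close> may lie off \<open>\<Omega>\<close>. It lies
  in \<open>\<Omega>\<close> for a dense set of \<open>u\<close>, and continuity gives the equality
  for the others.\<close>

lemma fun_periods_add:
  fixes \<phi> :: "complex ^ 'n \<Rightarrow> complex"
  assumes \<phi>: "meromorphic_fun \<Omega> \<phi>" and ab: "a \<in> fun_periods \<Omega> \<phi>" "b \<in> fun_periods \<Omega> \<phi>"
  shows "a + b \<in> fun_periods \<Omega> \<phi>"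
proof -
  have \<Omega>: "open_dense \<Omega>"
    using \<phi> by (simp add: meromorphic_fun_def)
  define W where "W = \<Omega> \<inter> {u. u + (a + b) \<in> \<Omega>}"
  have "\<phi> u = \<phi> (u + (a + b))" if u: "u \<in> W" for u
  proof (rule open_dense_eqI[of W \<phi> "\<lambda>u. \<phi> (u + (a + b))"])
    show "open W"
      using open_dense_Int[OF \<Omega> open_dense_translate[OF \<Omega>]] by (simp add: W_def open_dense_def)
    show "isCont \<phi> z" "isCont (\<lambda>u. \<phi> (u + (a + b))) z" if "z \<in> W" for z
      using that meromorphic_fun_continuous[OF \<phi>]
        meromorphic_fun_continuous[OF meromorphic_fun_translate[OF \<phi>, of "a + b"]] by (auto simp: W_def)
    fix V :: "(complex ^ 'n) set" assume V: "open V" "V \<noteq> {}" "V \<subseteq> W"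
    then obtain z where z: "z \<in> V" "z + a \<in> \<Omega>"
      using open_dense_translate[OF \<Omega>, of a] unfolding open_dense_def by blast
    then have "z \<in> \<Omega>" "z + a + b \<in> \<Omega>"
      using V(3) by (auto simp: W_def algebra_simps)
    then have "\<phi> z = \<phi> (z + a)" "\<phi> (z + a) = \<phi> (z + a + b)"
      using z(2) ab unfolding fun_periods_def by blast+
    then show "\<exists>z\<in>V. \<phi> z = \<phi> (z + (a + b))"
      using z(1) by (auto simp: add.assoc)
  qed (use u in simp)
  then show ?thesis
    by (auto simp: fun_periods_def W_def)
qed

lemma fun_periods_multiple:
  fixes \<phi> :: "complex ^ 'n \<Rightarrow> complex"
  assumes "meromorphic_fun \<Omega> \<phi>" "a \<in> fun_periods \<Omega> \<phi>"
  shows "real k *\<^sub>R a \<in> fun_periods \<Omega> \<phi>"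
proof (induction k)
  case 0
  then show ?case
    by (simp add: fun_periods_zero)
next
  case (Suc k)
  have "real (Suc k) *\<^sub>R a = a + real k *\<^sub>R a"
    by (simp add: algebra_simps)
  then show ?case
    using fun_periods_add[OF assms Suc] by simp
qed

text \<open>
  The functions \<open>\<phi>(x + j\<lambda>)\<close> are roots of one polynomial of degree at most \<open>d\<close> over the field of
  meromorphic functions, so two of the first \<open>d + 1\<close> of them coincide.
\<close>

lemma fun_periods_algebraic:
  fixes c :: "nat \<Rightarrow> complex ^ 'n \<Rightarrow> complex"
  assumes c: "\<And>k. k \<le> d \<Longrightarrow> meromorphic_fun \<Omega> (c k)"
    and per: "\<And>k. k \<le> d \<Longrightarrow> a \<in> fun_periods \<Omega> (c k)"
    and \<phi>: "meromorphic_fun \<Omega>' \<phi>"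
    and rel: "\<And>x. x \<in> \<Omega> \<Longrightarrow> x \<in> \<Omega>' \<Longrightarrow> (\<Sum>k\<le>d. c k x * \<phi> x ^ k) = 0"
    and nz: "k0 \<le> d" "x0 \<in> \<Omega>" "c k0 x0 \<noteq> 0"
  shows "real (fact d) *\<^sub>R a \<in> fun_periods \<Omega>' \<phi>"
proof -
  define T where "T = (\<lambda>(j::nat) x. x + real j *\<^sub>R a)"
  have "\<exists>i j. i < j \<and> j \<le> d \<and> real (j - i) *\<^sub>R a \<in> fun_periods \<Omega>' \<phi>"
  proof (rule ccontr)
    assume neg: "\<not> ?thesis"
    define I where "I = {(i, j). i < j \<and> j \<le> d}"
    have "I \<subseteq> {..d} \<times> {..d}"
      by (auto simp: I_def)
    then have finI: "finite I"
      by (rule finite_subset) simp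
    \<comment> \<open>If no two translates coincide, each pair of them differs on an open dense
      set.\<close>
    define D where "D = (\<lambda>(i, j). {x. T i x \<in> \<Omega>' \<and> T j x \<in> \<Omega>' \<and> \<phi> (T i x) \<noteq> \<phi> (T j x)})"
    have \<Omega>: "open_dense \<Omega>" "open_dense \<Omega>'"
      using c[of 0] \<phi> by (auto simp: meromorphic_fun_def)
    have "open_dense (D p)" if "p \<in> I" for p
    proof -
      obtain i j where p: "p = (i, j)" "i < j" "j \<le> d"
        using \<open>p \<in> I\<close> by (auto simp: I_def)
      define W where "W = {x. T i x \<in> \<Omega>'} \<inter> {x. T j x \<in> \<Omega>'}"
      have W: "open_dense W"
        unfolding W_def T_def by (intro open_dense_Int open_dense_translate \<Omega>)
      have mer: "meromorphic_fun W (\<lambda>x. \<phi> (T i x) - \<phi> (T j x))"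
        using W unfolding T_def W_def
        by (intro meromorphic_fun_diff meromorphic_fun_subset[OF meromorphic_fun_translate[OF \<phi>]]) auto
      have "real (j - i) *\<^sub>R a \<notin> fun_periods \<Omega>' \<phi>"
        using neg p by blast
      then obtain u where u: "u \<in> \<Omega>'" "u + real (j - i) *\<^sub>R a \<in> \<Omega>'" "\<phi> u \<noteq> \<phi> (u + real (j - i) *\<^sub>R a)"
        unfolding fun_periods_def by blast
      \<comment> \<open>Shifting back by \<open>i\<close> copies of \<open>a\<close> turns the
        failure of the period at \<open>u\<close> into a difference between the translates with
        indices \<open>i\<close> and \<open>j\<close>.\<close>
      define v where "v = u - real i *\<^sub>R a"
      have "T i v = u" "T j v = u + real (j - i) *\<^sub>R a"
        using p(2) by (auto simp: T_def v_def of_nat_diff algebra_simps)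
      then have "open_dense {x \<in> W. \<phi> (T i x) - \<phi> (T j x) \<noteq> 0}"
        using u by (intro meromorphic_fun_nonzero_open_dense[OF mer, of v]) (auto simp: W_def)
      also have "{x \<in> W. \<phi> (T i x) - \<phi> (T j x) \<noteq> 0} = D p"
        by (auto simp: D_def W_def p)
      finally show ?thesis .
    qed
    moreover have "open_dense {x \<in> \<Omega>. c k0 x \<noteq> 0}"
      using meromorphic_fun_nonzero_open_dense[OF c] nz by blast
    moreover have "open_dense {x. T j x \<in> \<Omega>}" "open_dense {x. T j x \<in> \<Omega>'}" for j
      unfolding T_def by (intro open_dense_translate \<Omega>)+
    \<comment> \<open>At a point generic in this sense the polynomial \<open>p\<close> below is
      nonzero of degree at most \<open>d\<close>, yet it has the \<open>d + 1\<close> distinct roots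
      \<open>\<phi> (T j x)\<close>.\<close>
    ultimately have "open_dense ((\<Inter>p\<in>I. D p) \<inter> {x \<in> \<Omega>. c k0 x \<noteq> 0} \<inter>
        (\<Inter>j\<in>{..d}. {x. T j x \<in> \<Omega>} \<inter> {x. T j x \<in> \<Omega>'}))"
      using finI by (intro open_dense_Int open_dense_INT) auto
    then obtain x where x: "\<And>p. p \<in> I \<Longrightarrow> x \<in> D p" "x \<in> \<Omega>" "c k0 x \<noteq> 0"
      "\<And>j. j \<le> d \<Longrightarrow> T j x \<in> \<Omega> \<and> T j x \<in> \<Omega>'"
      unfolding open_dense_def by (auto dest!: spec[of _ UNIV])
    define p where "p = (\<Sum>k\<le>d. monom (c k x) k)"
    have "coeff p k0 = c k0 x"
      using nz(1) by (simp add: p_def coeff_sum if_distrib cong: if_cong)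
    then have "p \<noteq> 0"
      using x(3) by auto
    have "degree p \<le> d"
      unfolding p_def by (intro degree_sum_le) (auto intro: order_trans[OF degree_monom_le])
    have inj: "inj_on (\<lambda>j. \<phi> (T j x)) {..d}"
    proof (rule linorder_inj_onI)
      fix i j assume "i < j" "i \<in> {..d}" "j \<in> {..d}"
      then show "\<phi> (T i x) \<noteq> \<phi> (T j x)"
        using x(1)[of "(i, j)"] by (auto simp: I_def D_def)
    qed auto
    have "poly p (\<phi> (T j x)) = 0" if "j \<le> d" for j
    proof -
      have "c k (T j x) = c k x" if "k \<le> d" for k
        using fun_periods_multiple[OF c[OF that] per[OF that], of j] x(2) x(4)[OF \<open>j \<le> d\<close>]
        unfolding fun_periods_def T_def by auto
      then have "poly p (\<phi> (T j x)) = (\<Sum>k\<le>d. c k (T j x) * \<phi> (T j x) ^ k)"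
        by (simp add: p_def poly_sum poly_monom)
      then show ?thesis
        using rel x(4)[OF that] by simp
    qed
    then have "(\<lambda>j. \<phi> (T j x)) ` {..d} \<subseteq> {w. poly p w = 0}"
      by auto
    then have "card ((\<lambda>j. \<phi> (T j x)) ` {..d}) \<le> card {w. poly p w = 0}"
      using poly_roots_finite[OF \<open>p \<noteq> 0\<close>] by (rule card_mono[rotated])
    also have "\<dots> \<le> d"
      using card_poly_roots_bound[OF \<open>p \<noteq> 0\<close>] \<open>degree p \<le> d\<close> by simp
    finally show False
      by (simp add: card_image[OF inj])
  qed
  then obtain i j where ij: "i < j" "j \<le> d" "real (j - i) *\<^sub>R a \<in> fun_periods \<Omega>' \<phi>"
    by blast
  \<comment> \<open>The pair found depends on \<open>a\<close>, but \<open>j - i\<close> always lies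
    between 1 and \<open>d\<close>; passing to \<open>fact d\<close> removes the dependence.\<close>
  have "j - i dvd fact d"
    using ij by (intro dvd_fact) auto
  then obtain m where "fact d = (j - i) * m"
    by (auto elim: dvdE)
  then have "real (fact d) *\<^sub>R a = real m *\<^sub>R real (j - i) *\<^sub>R a"
    by (metis mult.commute of_nat_mult scaleR_scaleR)
  then show ?thesis
    using fun_periods_multiple[OF \<phi> ij(3)] by metis
qed

section \<open>Algebraic dependence\<close>

text \<open>Gaussian elimination without division, so that it works over the integers as well as
  over the complex numbers; both cases occur below.\<close>

lemma homogeneous_system_nontrivial:
  fixes m :: "'s \<Rightarrow> 't \<Rightarrow> 'a::idom"
  assumes "finite T" "finite S" "card T < card S"
  shows "\<exists>q. (\<exists>s\<in>S. q s \<noteq> 0) \<and> (\<forall>t\<in>T. (\<Sum>s\<in>S. q s * m s t) = 0)"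
  using assms
proof (induction T arbitrary: S m rule: finite_induct)
  case empty
  then obtain s where "s \<in> S"
    by fastforce
  then show ?case
    by (intro exI[of _ "\<lambda>_. 1"]) auto
next
  case (insert t T)
  show ?case
  proof (cases "\<forall>s\<in>S. m s t = 0")
    case True
    have "card T < card S"
      using insert.prems insert.hyps by simp
    from insert.IH[OF insert.prems(1) this]
    obtain q where "\<exists>s\<in>S. q s \<noteq> 0" "\<forall>t\<in>T. (\<Sum>s\<in>S. q s * m s t) = 0"
      by blast
    moreover have "(\<Sum>s\<in>S. q s * m s t) = 0"
      using True by (intro sum.neutral) simp
    ultimately show ?thesis
      by blast
  next
    case False
    then obtain p where p: "p \<in> S" "m p t \<noteq> 0"
      by blast
    \<comment> \<open>The equation \<open>t\<close> eliminates the unknown \<open>p\<close> from the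
      others, cross-multiplied by the pivot \<open>m p t\<close>.\<close>
    define m' where "m' = (\<lambda>s u. m p t * m s u - m s t * m p u)"
    have "card T < card (S - {p})"
      using insert.prems insert.hyps p by simp
    from insert.IH[OF finite_Diff[OF insert.prems(1)] this, of m']
    obtain q where q: "\<exists>s\<in>S - {p}. q s \<noteq> 0" "\<forall>u\<in>T. (\<Sum>s\<in>S - {p}. q s * m' s u) = 0"
      by blast
    \<comment> \<open>Back substitution: the other unknowns are scaled by the pivot, so that the
      value at \<open>p\<close> needs no denominator.\<close>
    define r where "r = (\<lambda>s. if s = p then - (\<Sum>s\<in>S - {p}. q s * m s t) else m p t * q s)"
    have sum_r: "(\<Sum>s\<in>S. r s * m s u) = (\<Sum>s\<in>S - {p}. q s * m' s u)" for u
    proof -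
      have "(\<Sum>s\<in>S. r s * m s u) = r p * m p u + (\<Sum>s\<in>S - {p}. r s * m s u)"
        using p(1) insert.prems(1) by (simp add: sum.remove)
      also have "(\<Sum>s\<in>S - {p}. r s * m s u) = (\<Sum>s\<in>S - {p}. m p t * q s * m s u)"
        by (rule sum.cong) (auto simp: r_def)
      also have "r p * m p u + (\<Sum>s\<in>S - {p}. m p t * q s * m s u) =
          (\<Sum>s\<in>S - {p}. m p t * q s * m s u - q s * m s t * m p u)"
        by (simp add: r_def sum_subtractf sum_distrib_right)
      also have "\<dots> = (\<Sum>s\<in>S - {p}. q s * m' s u)"
        by (rule sum.cong) (auto simp: m'_def algebra_simps)
      finally show ?thesis .
    qed
    have "(\<Sum>s\<in>S. r s * m s u) = 0" if "u \<in> insert t T" for u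
    proof (cases "u = t")
      case True
      have "(\<Sum>s\<in>S - {p}. q s * m' s t) = 0"
        by (intro sum.neutral) (simp add: m'_def)
      then show ?thesis
        unfolding sum_r True .
    next
      case False
      then show ?thesis
        using that q(2) unfolding sum_r by blast
    qed
    moreover obtain s where "s \<in> S - {p}" "q s \<noteq> 0"
      using q(1) by blast
    then have "s \<in> S \<and> r s \<noteq> 0"
      using p(2) by (simp add: r_def)
    ultimately show ?thesis
      by blast
  qed
qed

section \<open>Polynomials with a bound on the degree in each variable\<close>

definition exps :: "nat \<Rightarrow> ('n::finite \<Rightarrow> nat) set" where
  "exps e = PiE UNIV (\<lambda>_. {..e})"

text \<open>The degree is bounded in each variable separately, so that there are exactly
  \<open>(e + 1) ^ CARD('n)\<close> coefficients and the dimension count becomes a comparison of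
  powers.\<close>

definition box_poly :: "nat \<Rightarrow> (('n::finite \<Rightarrow> nat) \<Rightarrow> complex) \<Rightarrow> ('n \<Rightarrow> complex) \<Rightarrow> complex" where
  "box_poly e q z = (\<Sum>\<gamma>\<in>exps e. q \<gamma> * (\<Prod>i\<in>UNIV. z i ^ \<gamma> i))"

lemma in_exps_iff: "\<gamma> \<in> exps e \<longleftrightarrow> (\<forall>i. \<gamma> i \<le> e)"
  by (auto simp: exps_def PiE_iff)

lemma finite_exps [simp]: "finite (exps e)"
  unfolding exps_def by (rule finite_PiE) auto

lemma card_exps: "card (exps e :: ('n::finite \<Rightarrow> nat) set) = (e + 1) ^ CARD('n)"
  by (simp add: exps_def card_PiE)

text \<open>As a polynomial in the variable \<open>j\<close> the sum has infinitely many roots, so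
  its coefficients vanish, and these are polynomials in one variable less. The index set
  \<open>I\<close> is general for the sake of this induction.\<close>

lemma PiE_poly_eq_zero:
  fixes q :: "('n \<Rightarrow> nat) \<Rightarrow> complex"
  assumes "finite I" "\<And>i. i \<in> I \<Longrightarrow> infinite (S i)"
    and "\<And>z. (\<And>i. i \<in> I \<Longrightarrow> z i \<in> S i) \<Longrightarrow>
      (\<Sum>\<gamma>\<in>PiE I (\<lambda>_. {..e}). q \<gamma> * (\<Prod>i\<in>I. z i ^ \<gamma> i)) = 0"
  shows "\<forall>\<gamma>\<in>PiE I (\<lambda>_. {..e}). q \<gamma> = 0"
  using assms
proof (induction I arbitrary: q rule: finite_induct)
  case empty
  then show ?case
    by simp
next
  case (insert j I)
  have *: "(\<Sum>\<gamma>\<in>PiE I (\<lambda>_. {..e}). q (\<gamma>(j := k)) * (\<Prod>i\<in>I. z i ^ \<gamma> i)) = 0"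
    if z: "\<And>i. i \<in> I \<Longrightarrow> z i \<in> S i" and k: "k \<le> e" for z k
  proof -
    define c where "c = (\<lambda>k. \<Sum>\<gamma>\<in>PiE I (\<lambda>_. {..e}). q (\<gamma>(j := k)) * (\<Prod>i\<in>I. z i ^ \<gamma> i))"
    have "(\<Sum>k\<le>e. c k * w ^ k) = 0" if w: "w \<in> S j" for w
    proof -
      define z' where "z' = z(j := w)"
      have "(\<Sum>\<gamma>\<in>PiE (insert j I) (\<lambda>_. {..e}). q \<gamma> * (\<Prod>i\<in>insert j I. z' i ^ \<gamma> i)) =
          (\<Sum>(k, \<gamma>)\<in>{..e} \<times> PiE I (\<lambda>_. {..e}). q (\<gamma>(j := k)) * (\<Prod>i\<in>insert j I. z' i ^ (\<gamma>(j := k)) i))"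
        unfolding PiE_insert_eq
        using inj_combinator[OF insert.hyps(2), of "\<lambda>_. {..e}"]
        by (subst sum.reindex) (auto simp: case_prod_unfold intro!: sum.cong)
      also have "\<dots> = (\<Sum>(k, \<gamma>)\<in>{..e} \<times> PiE I (\<lambda>_. {..e}). q (\<gamma>(j := k)) * (\<Prod>i\<in>I. z i ^ \<gamma> i) * w ^ k)"
      proof (intro sum.cong refl, clarify)
        fix k \<gamma>
        have "(\<Prod>i\<in>I. z' i ^ (\<gamma>(j := k)) i) = (\<Prod>i\<in>I. z i ^ \<gamma> i)"
          using insert.hyps(2) by (intro prod.cong) (auto simp: z'_def)
        then show "q (\<gamma>(j := k)) * (\<Prod>i\<in>insert j I. z' i ^ (\<gamma>(j := k)) i) =
            q (\<gamma>(j := k)) * (\<Prod>i\<in>I. z i ^ \<gamma> i) * w ^ k"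
          using insert.hyps by (simp add: z'_def mult_ac)
      qed
      also have "\<dots> = (\<Sum>k\<le>e. c k * w ^ k)"
        unfolding c_def sum_distrib_right by (rule sum.cartesian_product[symmetric])
      finally have "(\<Sum>k\<le>e. c k * w ^ k) =
          (\<Sum>\<gamma>\<in>PiE (insert j I) (\<lambda>_. {..e}). q \<gamma> * (\<Prod>i\<in>insert j I. z' i ^ \<gamma> i))"
        by simp
      also have "\<dots> = 0"
        using z w by (intro insert.prems(2)) (auto simp: z'_def)
      finally show ?thesis .
    qed
    then have "S j \<subseteq> {w. (\<Sum>k\<le>e. c k * w ^ k) = 0}"
      by blast
    then have "infinite {w. (\<Sum>k\<le>e. c k * w ^ k) = 0}"
      using insert.prems(1)[of j] infinite_super by blast
    then have "c k = 0"
      using polyfun_finite_roots[of c e] k by blast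
    then show ?thesis
      by (simp add: c_def)
  qed
  have IH: "\<forall>\<gamma>\<in>PiE I (\<lambda>_. {..e}). q (\<gamma>(j := k)) = 0" if "k \<le> e" for k
  proof (rule insert.IH)
    show "infinite (S i)" if "i \<in> I" for i
      using insert.prems(1) that by simp
  qed (rule *[OF _ that])
  show ?case
    unfolding PiE_insert_eq using IH by auto
qed

text \<open>A nonempty open subset of \<open>vecs K\<close> contains a product of infinite sets.
  Real intervals attached to the coordinates of one of its points serve for both choices of
  \<open>K\<close>.\<close>

lemma box_poly_nonzero:
  fixes q :: "('n::finite \<Rightarrow> nat) \<Rightarrow> complex"
  assumes K: "K = \<real> \<or> K = UNIV" and T: "open_in_vecs K T" "T \<noteq> {}"
    and q: "\<gamma> \<in> exps e" "q \<gamma> \<noteq> 0"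
  shows "\<exists>z\<in>T. box_poly e q (($) z) \<noteq> 0"
proof (rule ccontr)
  assume neg: "\<not> ?thesis"
  obtain p where p: "p \<in> T"
    using T by blast
  obtain W where W: "open W" "T = vecs K \<inter> W"
    using T(1) by (auto simp: openin_open)
  obtain r where r: "r > 0" "ball p r \<subseteq> W"
    using W p by (auto elim: openE)
  \<comment> \<open>The norm is at most the sum of the norms of the coordinates, so moving each of
    them by less than \<open>\<rho>\<close> stays within distance \<open>r\<close>.\<close>
  define \<rho> where "\<rho> = r / real CARD('n)"
  have \<rho>: "\<rho> > 0"
    using r by (simp add: \<rho>_def)
  define S where "S = (\<lambda>i. (\<lambda>t. p $ i + complex_of_real t) ` {0<..<\<rho>})"
  have "infinite (S i)" for i
  proof -
    have "inj_on (\<lambda>t. p $ i + complex_of_real t) {0<..<\<rho>}"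
      by (auto simp: inj_on_def)
    then show ?thesis
      using \<rho> infinite_Ioo[of 0 \<rho>] finite_imageD unfolding S_def by blast
  qed
  moreover have "box_poly e q z = 0" if z: "\<And>i. z i \<in> S i" for z
  proof -
    define v where "v = (\<chi> i. z i)"
    have "\<exists>t. 0 < t \<and> t < \<rho> \<and> v $ i = p $ i + complex_of_real t" for i
      using z[of i] by (auto simp: S_def v_def)
    then obtain t where t: "\<And>i. 0 < t i" "\<And>i. t i < \<rho>" "\<And>i. v $ i = p $ i + complex_of_real (t i)"
      by metis
    have "norm (v - p) \<le> (\<Sum>i\<in>UNIV. norm ((v - p) $ i))"
      unfolding norm_vec_def by (rule L2_set_le_sum) simp
    also have "\<dots> < (\<Sum>i\<in>(UNIV :: 'n set). \<rho>)"
      using t(1,2) by (intro sum_strict_mono) (auto simp: t(3) abs_of_pos)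
    also have "\<dots> = r"
      by (simp add: \<rho>_def)
    finally have "v \<in> W"
      using r(2) by (auto simp: dist_norm norm_minus_commute)
    moreover have "v \<in> vecs K"
      using p W(2) K t(3) by (auto simp: vecs_def)
    ultimately have "box_poly e q (($) v) = 0"
      using neg W(2) by blast
    moreover have "($) v = z"
      by (auto simp: v_def)
    ultimately show ?thesis
      by simp
  qed
  ultimately have "\<forall>\<gamma>\<in>exps e. q \<gamma> = 0"
    using PiE_poly_eq_zero[where I = UNIV and S = S and e = e and q = q]
    unfolding box_poly_def exps_def by simp
  then show False
    using q by blast
qed

text \<open>A set of functions rather than of formal polynomials: the reduction below can use
  closure under sums and products without naming coefficients, and these are chosen only where the
  linear system is set up.\<close>

definition polys :: "nat \<Rightarrow> (('n::finite \<Rightarrow> complex) \<Rightarrow> complex) set" where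
  "polys e = range (box_poly e)"

lemma box_poly_in_polys: "box_poly e q \<in> polys e"
  by (simp add: polys_def)

lemma polys_add: "f \<in> polys e \<Longrightarrow> g \<in> polys e \<Longrightarrow> (\<lambda>z. f z + g z) \<in> polys e"
proof -
  assume "f \<in> polys e" "g \<in> polys e"
  then obtain p q where "f = box_poly e p" "g = box_poly e q"
    by (auto simp: polys_def)
  then have "(\<lambda>z. f z + g z) = box_poly e (\<lambda>\<gamma>. p \<gamma> + q \<gamma>)"
    by (auto simp: box_poly_def sum.distrib algebra_simps)
  then show ?thesis
    by (simp add: polys_def)
qed

lemma polys_scale: "f \<in> polys e \<Longrightarrow> (\<lambda>z. c * f z) \<in> polys e"
proof -
  assume "f \<in> polys e"
  then obtain p where "f = box_poly e p"
    by (auto simp: polys_def)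
  then have "(\<lambda>z. c * f z) = box_poly e (\<lambda>\<gamma>. c * p \<gamma>)"
    by (auto simp: box_poly_def sum_distrib_left algebra_simps)
  then show ?thesis
    by (simp add: polys_def)
qed

lemma polys_monomial:
  assumes "\<gamma> \<in> exps e"
  shows "(\<lambda>z. \<Prod>i\<in>UNIV. z i ^ \<gamma> i) \<in> polys e"
proof -
  define q where "q = (\<lambda>\<delta>. if \<delta> = \<gamma> then 1 else 0 :: complex)"
  have "box_poly e q z = (\<Prod>i\<in>UNIV. z i ^ \<gamma> i)" for z
  proof -
    have "box_poly e q z = (\<Sum>\<delta>\<in>exps e. if \<delta> = \<gamma> then (\<Prod>i\<in>UNIV. z i ^ \<gamma> i) else 0)"
      unfolding box_poly_def by (rule sum.cong) (simp_all add: q_def)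
    also have "\<dots> = (\<Prod>i\<in>UNIV. z i ^ \<gamma> i)"
      using assms by (simp add: sum.delta)
    finally show ?thesis .
  qed
  then have "box_poly e q = (\<lambda>z. \<Prod>i\<in>UNIV. z i ^ \<gamma> i)"
    by (rule ext)
  from box_poly_in_polys[of e q, unfolded this] show ?thesis .
qed

lemma polys_const: "(\<lambda>_. c) \<in> polys e"
  using polys_scale[OF polys_monomial[of "\<lambda>_. 0" e], of c] by (simp add: in_exps_iff)

lemma polys_sum:
  assumes "\<And>i. i \<in> I \<Longrightarrow> f i \<in> polys e"
  shows "(\<lambda>z. \<Sum>i\<in>I. f i z) \<in> polys e"
  using assms
proof (induction I rule: infinite_finite_induct)
  case (insert i I)
  have "f i \<in> polys e" "(\<lambda>z. \<Sum>i\<in>I. f i z) \<in> polys e"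
    using insert by simp_all
  from polys_add[OF this] show ?case
    using insert.hyps by simp
qed (simp_all add: polys_const)

lemma polys_diff: "f \<in> polys e \<Longrightarrow> g \<in> polys e \<Longrightarrow> (\<lambda>z. f z - g z) \<in> polys e"
  using polys_add[of f e "\<lambda>z. - 1 * g z"] polys_scale[of g e "- 1"] by simp

lemma polys_mult:
  assumes "f \<in> polys e" "g \<in> polys e'"
  shows "(\<lambda>z. f z * g z) \<in> polys (e + e')"
proof -
  obtain p q where pq: "f = box_poly e p" "g = box_poly e' q"
    using assms by (auto simp: polys_def)
  have "(\<lambda>z. f z * g z) = (\<lambda>z. \<Sum>\<gamma>\<in>exps e. \<Sum>\<delta>\<in>exps e'. (p \<gamma> * q \<delta>) * (\<Prod>i\<in>UNIV. z i ^ (\<gamma> i + \<delta> i)))"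
    unfolding pq box_poly_def sum_product by (simp add: power_add prod.distrib mult_ac)
  also have "\<dots> \<in> polys (e + e')"
    by (intro polys_sum polys_scale polys_monomial) (auto simp: in_exps_iff intro: add_mono)
  finally show ?thesis .
qed

lemma polys_mono:
  assumes "f \<in> polys e" "e \<le> e'"
  shows "f \<in> polys e'"
  using polys_mult[OF assms(1) polys_const[of 1 "e' - e"]] assms(2) by simp

lemma polys_power:
  assumes "f \<in> polys e"
  shows "(\<lambda>z. f z ^ k) \<in> polys (k * e)"
proof (induction k)
  case (Suc k)
  show ?case
    using polys_mult[OF assms Suc] by simp
qed (simp add: polys_const)

lemma polys_prod:
  assumes "finite I" "\<And>i. i \<in> I \<Longrightarrow> f i \<in> polys e"
  shows "(\<lambda>z. \<Prod>i\<in>I. f i z) \<in> polys (card I * e)"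
  using assms
proof (induction I rule: finite_induct)
  case (insert i I)
  have "f i \<in> polys e" "(\<lambda>z. \<Prod>i\<in>I. f i z) \<in> polys (card I * e)"
    using insert by simp_all
  from polys_mult[OF this] show ?case
    using insert.hyps by simp
qed (simp add: polys_const)

text \<open>Any nonzero coefficient counts, even one with \<open>k = 0\<close>, since the dimension
  count in \<open>algebraic_exchange\<close> yields a nontrivial relation without control over the
  variables that occur in it.\<close>

definition algebraic_on ::
  "'x set \<Rightarrow> ('x \<Rightarrow> 'n::finite \<Rightarrow> complex) \<Rightarrow> ('x \<Rightarrow> complex) \<Rightarrow> bool" where
  "algebraic_on X z y \<longleftrightarrow>
     (\<exists>d e q. (\<exists>k\<le>d. \<exists>\<gamma>\<in>exps e. q k \<gamma> \<noteq> 0) \<and>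
        (\<forall>x\<in>X. (\<Sum>k\<le>d. box_poly e (q k) (z x) * y x ^ k) = 0))"

text \<open>Cutting the sum at the largest \<open>k\<close> with a nonzero coefficient polynomial
  makes that coefficient available as a denominator.\<close>

lemma algebraic_on_leading:
  assumes "algebraic_on X z y"
  obtains d e q where "\<exists>\<gamma>\<in>exps e. q d \<gamma> \<noteq> 0"
    "\<And>x. x \<in> X \<Longrightarrow> (\<Sum>k\<le>d. box_poly e (q k) (z x) * y x ^ k) = 0"
proof -
  obtain d e q where q: "\<exists>k\<le>d. \<exists>\<gamma>\<in>exps e. q k \<gamma> \<noteq> 0"
    "\<And>x. x \<in> X \<Longrightarrow> (\<Sum>k\<le>d. box_poly e (q k) (z x) * y x ^ k) = 0"
    using assms unfolding algebraic_on_def by blast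
  define P where "P = (\<lambda>k. k \<le> d \<and> (\<exists>\<gamma>\<in>exps e. q k \<gamma> \<noteq> 0))"
  define d' where "d' = Greatest P"
  have "Ex P" and bound: "\<forall>k. P k \<longrightarrow> k \<le> d"
    using q(1) unfolding P_def by blast+
  then have "P d'" and max: "\<And>k. P k \<Longrightarrow> k \<le> d'"
    unfolding d'_def using GreatestI_ex_nat[of P d] Greatest_le_nat[of P _ d] by blast+
  then have "d' \<le> d" and nz: "\<exists>\<gamma>\<in>exps e. q d' \<gamma> \<noteq> 0"
    unfolding P_def by blast+
  have "(\<Sum>k\<le>d'. box_poly e (q k) (z x) * y x ^ k) = 0" if "x \<in> X" for x
  proof -
    have "(\<Sum>k\<le>d. box_poly e (q k) (z x) * y x ^ k) = (\<Sum>k\<le>d'. box_poly e (q k) (z x) * y x ^ k)"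
    proof (intro sum.mono_neutral_right ballI)
      fix k assume "k \<in> {..d} - {..d'}"
      then have "\<not> P k" "k \<le> d"
        using max by auto
      then show "box_poly e (q k) (z x) * y x ^ k = 0"
        by (simp add: P_def box_poly_def)
    qed (use \<open>d' \<le> d\<close> in auto)
    then show ?thesis
      using q(2)[OF that] by simp
  qed
  with nz show ?thesis
    by (rule that)
qed

text \<open>One step of pseudo-division: multiplying a remainder by \<open>Y\<close> creates a
  single term of degree \<open>Suc d\<close>, which the relation \<open>CY\<close> replaces once
  everything is multiplied by the leading coefficient.\<close>

lemma shift_power_sum:
  fixes R C :: "nat \<Rightarrow> complex"
  assumes CY: "C (Suc d) * Y ^ Suc d = - (\<Sum>k<Suc d. C k * Y ^ k)"
  shows "C (Suc d) * Y * (\<Sum>k<Suc d. R k * Y ^ k) =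
    (\<Sum>k<Suc d. (C (Suc d) * (case k of 0 \<Rightarrow> 0 | Suc j \<Rightarrow> R j) - R d * C k) * Y ^ k)"
proof -
  have shift: "(\<Sum>k<d. R k * Y ^ Suc k) = (\<Sum>k<Suc d. (case k of 0 \<Rightarrow> 0 | Suc j \<Rightarrow> R j) * Y ^ k)"
    unfolding sum.lessThan_Suc_shift by simp
  have "C (Suc d) * Y * (\<Sum>k<Suc d. R k * Y ^ k) =
      C (Suc d) * (\<Sum>k<d. R k * Y ^ Suc k) + R d * (C (Suc d) * Y ^ Suc d)"
    unfolding sum.lessThan_Suc by (simp add: distrib_left sum_distrib_left mult_ac)
  moreover have "(\<Sum>k<Suc d. (C (Suc d) * (case k of 0 \<Rightarrow> 0 | Suc j \<Rightarrow> R j) - R d * C k) * Y ^ k) =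
      C (Suc d) * (\<Sum>k<Suc d. (case k of 0 \<Rightarrow> 0 | Suc j \<Rightarrow> R j) * Y ^ k) - R d * (\<Sum>k<Suc d. C k * Y ^ k)"
    by (simp only: left_diff_distrib sum_subtractf sum_distrib_left mult.assoc)
  ultimately show ?thesis
    unfolding shift CY by (simp only: mult_minus_right add_uminus_conv_diff)
qed

text \<open>Iterated pseudo-division. Each step costs one factor \<open>c d\<close> and raises the
  degree of the coefficients in \<open>z\<close> by \<open>e\<close>, hence a bound linear in
  \<open>m\<close>, on which the dimension count rests.\<close>

lemma reduce_power:
  fixes z :: "'x \<Rightarrow> 'n::finite \<Rightarrow> complex"
  assumes d: "0 < d" and c: "\<And>k. k \<le> d \<Longrightarrow> c k \<in> polys e"
    and rel: "\<And>x. x \<in> X \<Longrightarrow> (\<Sum>k\<le>d. c k (z x) * y x ^ k) = 0"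
  shows "\<exists>r. (\<forall>k<d. r k \<in> polys (m * e)) \<and>
    (\<forall>x\<in>X. c d (z x) ^ m * y x ^ m = (\<Sum>k<d. r k (z x) * y x ^ k))"
proof (induction m)
  case 0
  have "(\<Sum>k<d. (if k = 0 then 1 else 0) * y x ^ k) = 1" for x
  proof -
    have "(\<Sum>k<d. (if k = 0 then 1 else 0) * y x ^ k) = (\<Sum>k<d. if k = 0 then 1 else 0)"
      by (rule sum.cong) auto
    then show ?thesis
      using d by simp
  qed
  then show ?case
    by (intro exI[of _ "\<lambda>k _. if k = 0 then 1 else 0"]) (auto simp: polys_const)
next
  case (Suc m)
  then obtain r where r: "\<And>k. k < d \<Longrightarrow> r k \<in> polys (m * e)"
    "\<And>x. x \<in> X \<Longrightarrow> c d (z x) ^ m * y x ^ m = (\<Sum>k<d. r k (z x) * y x ^ k)"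
    by blast
  obtain d' where d': "d = Suc d'"
    using d by (cases d) auto
  define s where "s = (\<lambda>k w. c d w * (case k of 0 \<Rightarrow> 0 | Suc j \<Rightarrow> r j w) - r d' w * c k w)"
  have "s k \<in> polys (Suc m * e)" if "k < d" for k
  proof -
    have R: "(\<lambda>w. case k of 0 \<Rightarrow> 0 | Suc j \<Rightarrow> r j w) \<in> polys (m * e)"
      using that r(1) by (cases k) (simp_all add: polys_const)
    have "r d' \<in> polys (m * e)" "c d \<in> polys e" "c k \<in> polys e"
      using that d' c r(1) by simp_all
    then show ?thesis
      using polys_diff[OF polys_mult[OF _ R, of "c d" e, unfolded add.commute[of e]] polys_mult[of "r d'" "m * e" "c k" e]]
      unfolding s_def by (simp add: add.commute)
  qed
  moreover have "c d (z x) ^ Suc m * y x ^ Suc m = (\<Sum>k<d. s k (z x) * y x ^ k)" if "x \<in> X" for x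
  proof -
    have "c d (z x) * y x ^ d = - (\<Sum>k<d. c k (z x) * y x ^ k)"
      using rel[OF that] by (simp add: lessThan_Suc_atMost[symmetric] add_eq_0_iff)
    note shift_power_sum[where C = "\<lambda>k. c k (z x)" and Y = "y x" and d = d' and R = "\<lambda>k. r k (z x)", folded d', OF this]
    moreover have "c d (z x) ^ Suc m * y x ^ Suc m = c d (z x) * y x * (c d (z x) ^ m * y x ^ m)"
      by simp
    ultimately show ?thesis
      unfolding s_def r(2)[OF that] by simp
  qed
  ultimately show ?case
    by (intro exI[of _ s]) simp
qed

text \<open>
  Dimension count: up to the factor \<open>\<Prod>\<^sub>i (A i)\<^sup>M\<close> clearing denominators, the \<open>(M + 1)\<^sup>n\<^sup>+\<^sup>1\<close> monomials
  of degree at most \<open>M\<close> in each of \<open>y\<^sub>1, \<dots>, y\<^sub>n, z\<^sub>j\<close> lie in a space of dimension \<open>O(M\<^sup>n)\<close>.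
\<close>

lemma algebraic_exchange:
  fixes z y :: "'x \<Rightarrow> 'n::finite \<Rightarrow> complex"
  assumes alg: "\<And>i. algebraic_on X z (\<lambda>x. y x i)"
  obtains e :: "'n \<Rightarrow> nat" and A where "\<And>i. \<exists>\<gamma>\<in>exps (e i). A i \<gamma> \<noteq> 0"
    "algebraic_on {x \<in> X. \<forall>i. box_poly (e i) (A i) (z x) \<noteq> 0} y (\<lambda>x. z x j)"
proof -
  define Q where "Q = (\<lambda>i d e q. (\<exists>\<gamma>\<in>exps e. q d \<gamma> \<noteq> 0) \<and>
      (\<forall>x\<in>X. (\<Sum>k\<le>d. box_poly e (q k) (z x) * y x i ^ k) = 0))"
  have "\<exists>d e q. Q i d e q" for i
  proof (rule algebraic_on_leading[OF alg[of i]])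
    fix d e q
    assume "\<exists>\<gamma>\<in>exps e. q d \<gamma> \<noteq> 0" "\<And>x. x \<in> X \<Longrightarrow> (\<Sum>k\<le>d. box_poly e (q k) (z x) * y x i ^ k) = 0"
    then have "Q i d e q"
      by (simp add: Q_def)
    then show ?thesis
      by blast
  qed
  then obtain d e q where Q: "\<And>i. Q i (d i) (e i) (q i)"
    by metis
  have q: "\<exists>\<gamma>\<in>exps (e i). q i (d i) \<gamma> \<noteq> 0" for i
    using Q[of i] by (simp add: Q_def)
  have rel: "(\<Sum>k\<le>d i. box_poly (e i) (q i k) (z x) * y x i ^ k) = 0" if "x \<in> X" for i x
    using Q[of i] that by (simp add: Q_def)
  define a where "a = (\<lambda>i. box_poly (e i) (q i (d i)))"
  define X' where "X' = {x \<in> X. \<forall>i. a i (z x) \<noteq> 0}"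
  have "algebraic_on X' y (\<lambda>x. z x j)"
  proof (cases "\<exists>i. d i = 0")
    case True
    then obtain i where "d i = 0"
      by blast
    \<comment> \<open>A relation of degree 0 in \<open>y\<close> says that its only coefficient
      vanishes on \<open>X\<close>. Nothing is left of \<open>X'\<close>, and any nonzero polynomial
      will do.\<close>
    then have "a i (z x) = 0" if "x \<in> X" for x
      using rel[OF that, of i] by (simp add: a_def)
    then have "X' = {}"
      by (auto simp: X'_def)
    then show ?thesis
      unfolding algebraic_on_def
      by (intro exI[of _ 0] exI[of _ "\<lambda>_ _. 1"]) (auto simp: in_exps_iff)
  next
    case False
    define N where "N = CARD('n)"
    define E where "E = Max (range e)"
    have E: "e i \<le> E" for i
      by (simp add: E_def)
    define D where "D = (\<Prod>i\<in>UNIV. d i)"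
    \<comment> \<open>Chosen so that the number of equations, at most
      \<open>((N * E + 1) * (M + 1)) ^ N * D\<close>, equals at most \<open>(M + 1) ^ N * M\<close>
      and stays below the number \<open>(M + 1) ^ (N + 1)\<close> of unknowns.\<close>
    define M where "M = (N * E + 1) ^ N * D"
    \<comment> \<open>The degree in \<open>z\<close> of a reduced monomial: \<open>M * E\<close>
      from each of the \<open>N\<close> reduced powers and \<open>M\<close> from the power of the
      component \<open>j\<close> of \<open>z\<close>.\<close>
    define E' where "E' = (N * E + 1) * M"
    have coeffs: "box_poly (e i) (q i k) \<in> polys E" for i k
      using polys_mono[OF box_poly_in_polys E] .
    \<comment> \<open>The exponent of \<open>a i\<close> is \<open>M\<close> rather than the current
      \<open>m\<close>, so that one factor \<open>P\<close> clears all monomials and their linear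
      combinations can be formed.\<close>
    define r_spec where "r_spec = (\<lambda>i m r. (\<forall>k<d i. r k \<in> polys (M * E)) \<and>
        (\<forall>x\<in>X. a i (z x) ^ M * y x i ^ m = (\<Sum>k<d i. r k (z x) * y x i ^ k)))"
    have ex_r: "\<exists>r. m \<le> M \<longrightarrow> r_spec i m r" for i m
    proof (cases "m \<le> M")
      case m: True
      have "0 < d i"
        using False by simp
      have "\<exists>r. (\<forall>k<d i. r k \<in> polys (m * E)) \<and>
          (\<forall>x\<in>X. a i (z x) ^ m * y x i ^ m = (\<Sum>k<d i. r k (z x) * y x i ^ k))"
        unfolding a_def
        by (rule reduce_power[where c = "\<lambda>k. box_poly (e i) (q i k)", OF \<open>0 < d i\<close>]) (auto intro: coeffs rel)
      then obtain r where r': "\<forall>k<d i. r k \<in> polys (m * E)"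
        "\<forall>x\<in>X. a i (z x) ^ m * y x i ^ m = (\<Sum>k<d i. r k (z x) * y x i ^ k)"
        by (elim exE conjE)
      have r: "r k \<in> polys (m * E)" if "k < d i" for k
        using r'(1) that by simp
      have r2: "a i (z x) ^ m * y x i ^ m = (\<Sum>k<d i. r k (z x) * y x i ^ k)" if "x \<in> X" for x
        using r'(2) that by simp
      define s where "s = (\<lambda>k w. a i w ^ (M - m) * r k w)"
      have "s k \<in> polys (M * E)" if "k < d i" for k
      proof -
        have "(\<lambda>w. a i w ^ (M - m)) \<in> polys ((M - m) * E)"
          unfolding a_def by (rule polys_power[OF coeffs])
        from polys_mult[OF this r[OF that]] show ?thesis
          using m by (simp add: s_def distrib_right[symmetric])
      qed
      moreover have "a i (z x) ^ M * y x i ^ m = (\<Sum>k<d i. s k (z x) * y x i ^ k)" if "x \<in> X" for x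
      proof -
        have "a i (z x) ^ M * y x i ^ m = a i (z x) ^ (M - m) * (a i (z x) ^ m * y x i ^ m)"
          using m by (simp add: mult.assoc[symmetric] power_add[symmetric])
        then show ?thesis
          unfolding r2[OF that] by (simp add: s_def sum_distrib_left mult.assoc)
      qed
      ultimately have "r_spec i m s"
        by (simp add: r_spec_def)
      then show ?thesis
        by blast
    qed simp
    define r where "r = (\<lambda>i m. SOME r. m \<le> M \<longrightarrow> r_spec i m r)"
    have r': "r_spec i m (r i m)" if "m \<le> M" for i m
      using someI_ex[OF ex_r[of m i]] that by (simp add: r_def)
    have r: "r i m k \<in> polys (M * E)" if "m \<le> M" "k < d i" for i m k
      using r'[OF that(1)] that(2) by (simp add: r_spec_def)
    have red: "a i (z x) ^ M * y x i ^ m = (\<Sum>k<d i. r i m k (z x) * y x i ^ k)"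
      if "m \<le> M" "x \<in> X" for i m x
      using r'[OF that(1)] that(2) by (simp add: r_spec_def)
    \<comment> \<open>The exponents of \<open>y\<close> that survive the reduction. \<open>S\<close>
      indexes the monomials before the reduction, and a pair in \<open>T\<close> selects one
      coefficient, with respect to \<open>z\<close> and \<open>y\<close>, of a reduced
      monomial.\<close>
    define \<Delta> where "\<Delta> = PiE UNIV (\<lambda>i. {..<d i})"
    define S where "S = (exps M :: ('n \<Rightarrow> nat) set) \<times> {..M}"
    define T where "T = (exps E' :: ('n \<Rightarrow> nat) set) \<times> \<Delta>"
    define R where "R = (\<lambda>(\<alpha>, \<beta>) \<delta> w. (\<Prod>i\<in>UNIV. r i (\<alpha> i) (\<delta> i) w) * w j ^ \<beta>)"
    have fin: "finite \<Delta>"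
      unfolding \<Delta>_def by (rule finite_PiE) auto
    have R: "R s \<delta> \<in> polys E'" if "s \<in> S" "\<delta> \<in> \<Delta>" for s \<delta>
    proof -
      obtain \<alpha> \<beta> where s: "s = (\<alpha>, \<beta>)" "\<And>i. \<alpha> i \<le> M" "\<beta> \<le> M"
        using \<open>s \<in> S\<close> by (auto simp: S_def in_exps_iff)
      have "r i (\<alpha> i) (\<delta> i) \<in> polys (M * E)" for i
        using s that(2) by (intro r) (auto simp: \<Delta>_def PiE_iff)
      then have "(\<lambda>w. \<Prod>i\<in>UNIV. r i (\<alpha> i) (\<delta> i) w) \<in> polys (N * (M * E))"
        unfolding N_def by (intro polys_prod) auto
      moreover have "(\<lambda>w. w j ^ \<beta>) \<in> polys M"
      proof -
        have "(\<Prod>i\<in>UNIV. w i ^ (if i = j then \<beta> else 0)) = w j ^ \<beta>" for w :: "'n \<Rightarrow> complex"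
          by (simp add: if_distrib prod.delta cong: if_cong)
        then show ?thesis
          using polys_monomial[of "\<lambda>i. if i = j then \<beta> else 0" M] s(3) by (simp add: in_exps_iff)
      qed
      ultimately have "R s \<delta> \<in> polys (N * (M * E) + M)"
        unfolding R_def s(1) prod.case by (rule polys_mult)
      then show ?thesis
        by (simp add: E'_def algebra_simps)
    qed
    then have "\<exists>p. s \<in> S \<longrightarrow> \<delta> \<in> \<Delta> \<longrightarrow> R s \<delta> = box_poly E' p" for s \<delta>
      unfolding polys_def by blast
    then obtain p where p: "\<And>s \<delta>. s \<in> S \<Longrightarrow> \<delta> \<in> \<Delta> \<Longrightarrow> R s \<delta> = box_poly E' (p s \<delta>)"
      by metis
    have "card T < card S"
    proof -
      have "card T = (E' + 1) ^ N * D"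
        by (simp add: T_def card_cartesian_product card_exps \<Delta>_def card_PiE D_def N_def)
      also have "\<dots> \<le> ((N * E + 1) * (M + 1)) ^ N * D"
        by (intro mult_right_mono power_mono) (auto simp: E'_def)
      also have "\<dots> = (M + 1) ^ N * ((N * E + 1) ^ N * D)"
        by (simp only: power_mult_distrib mult_ac)
      also have "\<dots> = (M + 1) ^ N * M"
        by (simp only: M_def)
      also have "\<dots> < (M + 1) ^ N * (M + 1)"
        by simp
      also have "\<dots> = card S"
        by (simp add: S_def card_cartesian_product card_exps N_def)
      finally show ?thesis .
    qed
    moreover have "finite S" "finite T"
      using fin by (simp_all add: S_def T_def)
    ultimately have "\<exists>c. (\<exists>s\<in>S. c s \<noteq> 0) \<and> (\<forall>t\<in>T. (\<Sum>s\<in>S. c s * p s (snd t) (fst t)) = 0)"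
      by (intro homogeneous_system_nontrivial)
    then obtain c where c: "\<exists>s\<in>S. c s \<noteq> 0" "\<forall>t\<in>T. (\<Sum>s\<in>S. c s * p s (snd t) (fst t)) = 0"
      by (elim exE conjE)
    have R0: "(\<Sum>s\<in>S. c s * R s \<delta> w) = 0" if "\<delta> \<in> \<Delta>" for \<delta> w
    proof -
      have "(\<Sum>s\<in>S. c s * R s \<delta> w) = (\<Sum>s\<in>S. \<Sum>\<gamma>\<in>exps E'. c s * p s \<delta> \<gamma> * (\<Prod>i\<in>UNIV. w i ^ \<gamma> i))"
        using p that by (intro sum.cong) (simp_all add: box_poly_def sum_distrib_left mult.assoc)
      also have "\<dots> = (\<Sum>\<gamma>\<in>exps E'. \<Sum>s\<in>S. c s * p s \<delta> \<gamma> * (\<Prod>i\<in>UNIV. w i ^ \<gamma> i))"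
        by (rule sum.swap)
      also have "\<dots> = 0"
      proof (rule sum.neutral, rule ballI)
        fix \<gamma> :: "'n \<Rightarrow> nat" assume "\<gamma> \<in> exps E'"
        then have "(\<Sum>s\<in>S. c s * p s \<delta> \<gamma>) = 0"
          using c(2)[rule_format, of "(\<gamma>, \<delta>)"] that by (simp add: T_def)
        then show "(\<Sum>s\<in>S. c s * p s \<delta> \<gamma> * (\<Prod>i\<in>UNIV. w i ^ \<gamma> i)) = 0"
          by (simp add: sum_distrib_right[symmetric])
      qed
      finally show ?thesis .
    qed
    have main: "(\<Sum>(\<alpha>, \<beta>)\<in>S. c (\<alpha>, \<beta>) * (\<Prod>i\<in>UNIV. y x i ^ \<alpha> i) * z x j ^ \<beta>) = 0" if x: "x \<in> X'" for x
    proof -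
      have "x \<in> X"
        using x by (simp add: X'_def)
      define P where "P = (\<Prod>i\<in>UNIV. a i (z x) ^ M)"
      have "P \<noteq> 0"
        using x by (simp add: P_def X'_def)
      have expand: "P * ((\<Prod>i\<in>UNIV. y x i ^ \<alpha> i) * z x j ^ \<beta>) =
          (\<Sum>\<delta>\<in>\<Delta>. R (\<alpha>, \<beta>) \<delta> (z x) * (\<Prod>i\<in>UNIV. y x i ^ \<delta> i))" if "(\<alpha>, \<beta>) \<in> S" for \<alpha> \<beta>
      proof -
        have "P * (\<Prod>i\<in>UNIV. y x i ^ \<alpha> i) = (\<Prod>i\<in>UNIV. \<Sum>k<d i. r i (\<alpha> i) k (z x) * y x i ^ k)"
          unfolding P_def prod.distrib[symmetric]
          using that \<open>x \<in> X\<close> by (intro prod.cong refl red) (auto simp: S_def in_exps_iff)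
        also have "\<dots> = (\<Sum>\<delta>\<in>\<Delta>. \<Prod>i\<in>UNIV. r i (\<alpha> i) (\<delta> i) (z x) * y x i ^ \<delta> i)"
          unfolding \<Delta>_def by (rule prod_sum_PiE) auto
        finally have "P * (\<Prod>i\<in>UNIV. y x i ^ \<alpha> i) * z x j ^ \<beta> =
            (\<Sum>\<delta>\<in>\<Delta>. (\<Prod>i\<in>UNIV. r i (\<alpha> i) (\<delta> i) (z x) * y x i ^ \<delta> i) * z x j ^ \<beta>)"
          by (simp only: sum_distrib_right)
        then show ?thesis
          by (simp add: R_def prod.distrib mult_ac)
      qed
      have "P * (\<Sum>(\<alpha>, \<beta>)\<in>S. c (\<alpha>, \<beta>) * (\<Prod>i\<in>UNIV. y x i ^ \<alpha> i) * z x j ^ \<beta>) =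
          (\<Sum>(\<alpha>, \<beta>)\<in>S. c (\<alpha>, \<beta>) * (P * ((\<Prod>i\<in>UNIV. y x i ^ \<alpha> i) * z x j ^ \<beta>)))"
        unfolding sum_distrib_left by (rule sum.cong) (auto simp: mult_ac)
      also have "\<dots> = (\<Sum>s\<in>S. \<Sum>\<delta>\<in>\<Delta>. c s * R s \<delta> (z x) * (\<Prod>i\<in>UNIV. y x i ^ \<delta> i))"
        by (rule sum.cong) (auto simp: expand sum_distrib_left mult.assoc)
      also have "\<dots> = (\<Sum>\<delta>\<in>\<Delta>. \<Sum>s\<in>S. c s * R s \<delta> (z x) * (\<Prod>i\<in>UNIV. y x i ^ \<delta> i))"
        by (rule sum.swap)
      also have "\<dots> = 0"
        by (rule sum.neutral) (simp add: R0 sum_distrib_right[symmetric])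
      finally show ?thesis
        using \<open>P \<noteq> 0\<close> by simp
    qed
    show ?thesis
      unfolding algebraic_on_def
    proof (rule exI[of _ M], rule exI[of _ M], rule exI[of _ "\<lambda>k \<gamma>. c (\<gamma>, k)"], intro conjI ballI)
      show "\<exists>k\<le>M. \<exists>\<gamma>\<in>exps M. c (\<gamma>, k) \<noteq> 0"
        using c(1) by (auto simp: S_def)
      fix x assume "x \<in> X'"
      have "(\<Sum>k\<le>M. box_poly M (\<lambda>\<gamma>. c (\<gamma>, k)) (y x) * z x j ^ k) =
          (\<Sum>k\<le>M. \<Sum>\<alpha>\<in>exps M. c (\<alpha>, k) * (\<Prod>i\<in>UNIV. y x i ^ \<alpha> i) * z x j ^ k)"
        by (simp add: box_poly_def sum_distrib_right)
      also have "\<dots> = (\<Sum>\<alpha>\<in>exps M. \<Sum>k\<le>M. c (\<alpha>, k) * (\<Prod>i\<in>UNIV. y x i ^ \<alpha> i) * z x j ^ k)"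
        by (rule sum.swap)
      also have "\<dots> = (\<Sum>(\<alpha>, k)\<in>S. c (\<alpha>, k) * (\<Prod>i\<in>UNIV. y x i ^ \<alpha> i) * z x j ^ k)"
        unfolding S_def by (rule sum.cartesian_product)
      finally show "(\<Sum>k\<le>M. box_poly M (\<lambda>\<gamma>. c (\<gamma>, k)) (y x) * z x j ^ k) = 0"
        using main[OF \<open>x \<in> X'\<close>] by simp
    qed
  qed
  then show ?thesis
    using q unfolding X'_def a_def by (intro that[of e "\<lambda>i. q i (d i)"])
qed

text \<open>Translates the polynomials of \<open>nash_map\<close> into \<open>box_poly\<close>,
  grouped by powers of the variable \<open>None\<close>. The second conclusion keeps the nonzero
  coefficients visible after the regrouping.\<close>

lemma mpoly_eval_case_option:
  fixes P :: "('n::finite option \<Rightarrow>\<^sub>0 nat) \<Rightarrow>\<^sub>0 complex"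
  obtains d e q where "\<And>z y. mpoly_eval (\<lambda>c. c) P (case_option y z) = (\<Sum>k\<le>d. box_poly e (q k) z * y ^ k)"
    "\<And>\<alpha>. \<alpha> \<in> Poly_Mapping.keys P \<Longrightarrow>
      Poly_Mapping.lookup \<alpha> None \<le> d \<and> (\<lambda>i. Poly_Mapping.lookup \<alpha> (Some i)) \<in> exps e \<and>
      q (Poly_Mapping.lookup \<alpha> None) (\<lambda>i. Poly_Mapping.lookup \<alpha> (Some i)) \<noteq> 0"
proof -
  \<comment> \<open>A crude bound: the sum of all exponents of all monomials dominates each single
    exponent.\<close>
  define d where "d = (\<Sum>\<alpha>\<in>Poly_Mapping.keys P. \<Sum>i\<in>UNIV. Poly_Mapping.lookup \<alpha> i)"
  have d: "Poly_Mapping.lookup \<alpha> i \<le> d" if "\<alpha> \<in> Poly_Mapping.keys P" for \<alpha> i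
  proof -
    have "Poly_Mapping.lookup \<alpha> i \<le> (\<Sum>i\<in>UNIV. Poly_Mapping.lookup \<alpha> i)"
      by (rule member_le_sum) auto
    also have "\<dots> \<le> d"
      unfolding d_def using that by (intro member_le_sum) auto
    finally show ?thesis .
  qed
  define pm where "pm = (\<lambda>(k, \<gamma> :: 'n \<Rightarrow> nat). Abs_poly_mapping (case_option k \<gamma>))"
  have lookup_pm: "Poly_Mapping.lookup (pm (k, \<gamma>)) = case_option k \<gamma>" for k \<gamma>
    by (simp add: pm_def lookup_Abs_poly_mapping)
  have pm_eta: "pm (Poly_Mapping.lookup \<alpha> None, \<lambda>i. Poly_Mapping.lookup \<alpha> (Some i)) = \<alpha>" for \<alpha>
    by (rule poly_mapping_eqI) (simp add: lookup_pm split: option.split)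
  have inj: "inj_on pm A" for A
  proof (rule inj_onI, clarify)
    fix k \<gamma> k' \<gamma>' assume "pm (k, \<gamma>) = pm (k', \<gamma>')"
    then have "case_option k \<gamma> = case_option k' \<gamma>'"
      by (metis lookup_pm)
    then show "k = k' \<and> \<gamma> = \<gamma>'"
      by (metis (no_types) ext option.simps(4,5))
  qed
  define q where "q = (\<lambda>k \<gamma>. Poly_Mapping.lookup P (pm (k, \<gamma>)))"
  define J where "J = {..d} \<times> (exps d :: ('n \<Rightarrow> nat) set)"
  have "Poly_Mapping.keys P \<subseteq> pm ` J"
  proof
    fix \<alpha> assume "\<alpha> \<in> Poly_Mapping.keys P"
    then have "(Poly_Mapping.lookup \<alpha> None, \<lambda>i. Poly_Mapping.lookup \<alpha> (Some i)) \<in> J"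
      using d by (simp add: J_def in_exps_iff)
    then show "\<alpha> \<in> pm ` J"
      by (metis pm_eta image_eqI)
  qed
  then have "mpoly_eval (\<lambda>c. c) P (case_option y z) = (\<Sum>k\<le>d. box_poly d (q k) z * y ^ k)" for y z
  proof -
    have "mpoly_eval (\<lambda>c. c) P (case_option y z) =
        (\<Sum>\<alpha>\<in>pm ` J. Poly_Mapping.lookup P \<alpha> * mono_eval (case_option y z) \<alpha>)"
      unfolding mpoly_eval_def using \<open>Poly_Mapping.keys P \<subseteq> pm ` J\<close>
      by (intro sum.mono_neutral_left) (auto simp: J_def in_keys_iff)
    also have "\<dots> = (\<Sum>s\<in>J. Poly_Mapping.lookup P (pm s) * mono_eval (case_option y z) (pm s))"
      by (rule sum.reindex_cong[OF inj refl refl])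
    also have "\<dots> = (\<Sum>(k, \<gamma>)\<in>J. q k \<gamma> * (\<Prod>i\<in>UNIV. z i ^ \<gamma> i) * y ^ k)"
    proof (rule sum.cong, rule refl, clarify)
      fix k \<gamma>
      have "mono_eval (case_option y z) (pm (k, \<gamma>)) = y ^ k * (\<Prod>i\<in>UNIV. z i ^ \<gamma> i)"
        unfolding mono_eval_def lookup_pm UNIV_option_conv
        by (subst prod.insert) (auto simp: prod.reindex)
      then show "Poly_Mapping.lookup P (pm (k, \<gamma>)) * mono_eval (case_option y z) (pm (k, \<gamma>)) =
          q k \<gamma> * (\<Prod>i\<in>UNIV. z i ^ \<gamma> i) * y ^ k"
        by (simp add: q_def mult_ac)
    qed
    also have "\<dots> = (\<Sum>k\<le>d. \<Sum>\<gamma>\<in>exps d. q k \<gamma> * (\<Prod>i\<in>UNIV. z i ^ \<gamma> i) * y ^ k)"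
      unfolding J_def by (rule sum.cartesian_product[symmetric])
    finally show ?thesis
      by (simp add: box_poly_def sum_distrib_right)
  qed
  moreover have "Poly_Mapping.lookup \<alpha> None \<le> d \<and> (\<lambda>i. Poly_Mapping.lookup \<alpha> (Some i)) \<in> exps d \<and>
      q (Poly_Mapping.lookup \<alpha> None) (\<lambda>i. Poly_Mapping.lookup \<alpha> (Some i)) \<noteq> 0"
    if "\<alpha> \<in> Poly_Mapping.keys P" for \<alpha>
    using d[OF that] that by (simp add: q_def pm_eta in_exps_iff in_keys_iff)
  ultimately show ?thesis
    by (rule that)
qed

section \<open>Ranks of subgroups\<close>

lemma module_int_scale: "module (\<lambda>(k::int) (x::'a::real_vector). of_int k *\<^sub>R x)"
  by unfold_locales (simp_all add: scaleR_add_right scaleR_add_left)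

interpretation Z: module "\<lambda>(k::int) (x::'a::real_vector). of_int k *\<^sub>R x"
  by (rule module_int_scale)

abbreviation subgroup_add :: "'a::ab_group_add set \<Rightarrow> bool" where
  "subgroup_add S \<equiv> 0 \<in> S \<and> (\<forall>x\<in>S. \<forall>y\<in>S. x + y \<in> S) \<and> (\<forall>x\<in>S. - x \<in> S)"

lemma subgroup_add_int_scale:
  fixes S :: "'a::real_vector set"
  assumes S: "subgroup_add S" and x: "x \<in> S"
  shows "of_int k *\<^sub>R x \<in> S"
proof -
  have nat: "real n *\<^sub>R x \<in> S" for n
    using S x by (induction n) (auto simp: scaleR_add_left)
  show ?thesis
  proof (cases "k \<ge> 0")
    case True
    then show ?thesis
      using nat[of "nat k"] by simp
  next
    case False
    then have "of_int k *\<^sub>R x = - (real (nat (- k)) *\<^sub>R x)"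
      by simp
    then show ?thesis
      using nat[of "nat (- k)"] S by simp
  qed
qed

lemma Z_subspace_iff: "Z.subspace S \<longleftrightarrow> subgroup_add (S :: 'a::real_vector set)"
proof
  assume S: "Z.subspace S"
  then have "- x \<in> S" if "x \<in> S" for x
    using Z.subspace_scale[OF S that, of "- 1"] by simp
  with S show "subgroup_add S"
    by (auto simp: Z.subspace_def)
next
  assume "subgroup_add S"
  then show "Z.subspace S"
    using subgroup_add_int_scale[of S] by (auto simp: Z.subspace_def)
qed

lemma Z_independent_iff:
  assumes "finite B"
  shows "Z.independent B \<longleftrightarrow>
    (\<forall>u. (\<Sum>v\<in>B. real_of_int (u v) *\<^sub>R v) = 0 \<longrightarrow> (\<forall>v\<in>B. u v = 0))"
  using Z.dependent_finite[OF assms] by blast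

lemma Z_independent_insert:
  assumes "finite B" "b \<notin> B"
  shows "Z.independent (insert b B) \<longleftrightarrow>
    Z.independent B \<and> (\<forall>k. real_of_int k *\<^sub>R b \<in> Z.span B \<longrightarrow> k = 0)"
proof
  assume ind: "Z.independent (insert b B)"
  have "k = 0" if k: "real_of_int k *\<^sub>R b \<in> Z.span B" for k
  proof -
    obtain u where u: "real_of_int k *\<^sub>R b = (\<Sum>v\<in>B. real_of_int (u v) *\<^sub>R v)"
      using k Z.span_finite[OF assms(1)] by auto
    define w where "w = (\<lambda>v. if v = b then - k else u v)"
    have "(\<Sum>v\<in>B. real_of_int (w v) *\<^sub>R v) = (\<Sum>v\<in>B. real_of_int (u v) *\<^sub>R v)"
      using assms(2) by (intro sum.cong) (auto simp: w_def)
    then have "(\<Sum>v\<in>insert b B. real_of_int (w v) *\<^sub>R v) = 0"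
      using assms u by (simp add: w_def)
    then have "w b = 0"
      using ind assms(1) Z_independent_iff[of "insert b B"] by blast
    then show ?thesis
      by (simp add: w_def)
  qed
  then show "Z.independent B \<and> (\<forall>k. real_of_int k *\<^sub>R b \<in> Z.span B \<longrightarrow> k = 0)"
    using Z.independent_mono[OF ind, of B] by blast
next
  assume B: "Z.independent B \<and> (\<forall>k. real_of_int k *\<^sub>R b \<in> Z.span B \<longrightarrow> k = 0)"
  have "\<forall>v\<in>insert b B. u v = 0" if u: "(\<Sum>v\<in>insert b B. real_of_int (u v) *\<^sub>R v) = 0" for u
  proof -
    have "real_of_int (u b) *\<^sub>R b + (\<Sum>v\<in>B. real_of_int (u v) *\<^sub>R v) = 0"
      using u assms by simp
    then have eq: "real_of_int (- u b) *\<^sub>R b = (\<Sum>v\<in>B. real_of_int (u v) *\<^sub>R v)"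
      by (simp add: add_eq_0_iff)
    also have "\<dots> \<in> Z.span B"
      by (intro Z.span_sum Z.span_scale Z.span_base)
    finally have "- u b = 0"
      using B by blast
    then have "(\<Sum>v\<in>B. real_of_int (u v) *\<^sub>R v) = 0"
      using eq by simp
    then show ?thesis
      using \<open>- u b = 0\<close> B Z_independent_iff[OF assms(1)] by auto
  qed
  then show "Z.independent (insert b B)"
    using assms(1) by (simp add: Z_independent_iff)
qed

text \<open>Expressing \<open>C\<close> through \<open>B\<close> gives an integer matrix. If
  \<open>C\<close> were larger, the homogeneous system would have a nontrivial integer solution,
  which is a relation in \<open>C\<close>.\<close>

lemma Z_independent_card_le:
  fixes B C :: "'a::real_vector set"
  assumes "finite B" "finite C" "Z.independent C" "C \<subseteq> Z.span B"
  shows "card C \<le> card B"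
proof (rule ccontr)
  assume "\<not> ?thesis"
  then have less: "card B < card C"
    by simp
  have "\<exists>u. v \<in> C \<longrightarrow> v = (\<Sum>b\<in>B. real_of_int (u b) *\<^sub>R b)" for v
    using assms(4) Z.span_finite[OF assms(1)] by auto
  then obtain m where m: "\<And>v. v \<in> C \<Longrightarrow> v = (\<Sum>b\<in>B. real_of_int (m v b) *\<^sub>R b)"
    by metis
  obtain q where q: "\<exists>v\<in>C. q v \<noteq> 0" "\<forall>b\<in>B. (\<Sum>v\<in>C. q v * m v b) = 0"
    using homogeneous_system_nontrivial[OF assms(1,2) less, of m] by (elim exE conjE)
  have "(\<Sum>v\<in>C. real_of_int (q v) *\<^sub>R v) =
      (\<Sum>v\<in>C. \<Sum>b\<in>B. real_of_int (q v * m v b) *\<^sub>R b)"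
  proof (rule sum.cong)
    fix v assume "v \<in> C"
    have "real_of_int (q v) *\<^sub>R v = real_of_int (q v) *\<^sub>R (\<Sum>b\<in>B. real_of_int (m v b) *\<^sub>R b)"
      using m[OF \<open>v \<in> C\<close>] by simp
    then show "real_of_int (q v) *\<^sub>R v = (\<Sum>b\<in>B. real_of_int (q v * m v b) *\<^sub>R b)"
      by (simp add: scaleR_sum_right)
  qed simp
  also have "\<dots> = (\<Sum>b\<in>B. \<Sum>v\<in>C. real_of_int (q v * m v b) *\<^sub>R b)"
    by (rule sum.swap)
  also have "\<dots> = 0"
  proof (rule sum.neutral, rule ballI)
    fix b assume "b \<in> B"
    then have "real_of_int (\<Sum>v\<in>C. q v * m v b) = 0"
      using q(2) by simp
    then show "(\<Sum>v\<in>C. real_of_int (q v * m v b) *\<^sub>R b) = 0"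
      by (simp only: of_int_sum scaleR_sum_left[symmetric] scaleR_zero_left)
  qed
  finally show False
    using q(1) assms(2,3) Z_independent_iff by blast
qed

section \<open>Subgroups of free abelian groups of finite rank\<close>

lemma int_subgroup_generator:
  fixes I :: "int set"
  assumes I: "subgroup_add I"
  obtains d where "I = range (\<lambda>k. k * d)"
proof (cases "I = {0}")
  case True
  then show ?thesis
    using that[of 0] by auto
next
  case False
  then obtain k where k: "k \<in> I" "k \<noteq> 0"
    using I by blast
  have mult: "j * d \<in> I" if "d \<in> I" for j d
  proof -
    have nat: "int n * d \<in> I" for n
      using I that by (induction n) (auto simp: distrib_right)
    show ?thesis
      using nat[of "nat j"] nat[of "nat (- j)"] I by (cases "j \<ge> 0") force+
  qed
  define P where "P = (\<lambda>n::nat. 0 < n \<and> int n \<in> I)"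
  have "\<bar>k\<bar> \<in> I"
    using k I by (auto simp: abs_if)
  then have "P (nat \<bar>k\<bar>)"
    using k by (simp add: P_def)
  then have L: "P (Least P)" and min: "\<And>n. P n \<Longrightarrow> Least P \<le> n"
    by (auto intro: LeastI Least_le)
  define d where "d = int (Least P)"
  have d: "d > 0" "d \<in> I"
    using L by (auto simp: P_def d_def)
  have "x \<in> range (\<lambda>k. k * d)" if "x \<in> I" for x
  proof -
    have "x + - (x div d * d) \<in> I"
      using I mult[OF d(2)] that by blast
    also have "x + - (x div d * d) = x mod d"
      by (simp add: minus_div_mult_eq_mod)
    finally have r: "x mod d \<in> I" .
    have "x mod d = 0"
    proof (rule ccontr)
      assume "x mod d \<noteq> 0"
      then have "0 < x mod d"
        using pos_mod_sign[OF d(1), of x] by linarith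
      then have "P (nat (x mod d))"
        using r by (simp add: P_def)
      then have "d \<le> x mod d"
        using min[of "nat (x mod d)"] \<open>0 < x mod d\<close> by (simp add: d_def le_nat_iff)
      then show False
        using pos_mod_bound[OF d(1), of x] d(1) by simp
    qed
    then have "x = x div d * d"
      by (metis add.right_neutral div_mult_mod_eq)
    then show ?thesis
      by blast
  qed
  then have "I = range (\<lambda>k. k * d)"
    using mult[OF d(2)] by blast
  then show ?thesis
    by (rule that)
qed

text \<open>The coordinates at \<open>b\<close> that occur in \<open>S\<close> form a subgroup of
  the integers, generated by some \<open>d\<close>. An element \<open>s0\<close> of \<open>S\<close>
  with coordinate \<open>d\<close> extends a basis of the part of \<open>S\<close> in the span of
  \<open>B\<close> to a basis of \<open>S\<close>; for \<open>d = 0\<close> that part is already all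
  of \<open>S\<close>.\<close>

lemma Z_span_subgroup_basis:
  fixes B S :: "'a::real_vector set"
  assumes "finite B" "Z.independent B" "subgroup_add S" "S \<subseteq> Z.span B"
  shows "\<exists>C. finite C \<and> card C \<le> card B \<and> Z.independent C \<and> Z.span C = S"
  using assms
proof (induction B arbitrary: S rule: finite_induct)
  case empty
  then have "S = {0}"
    by auto
  then show ?case
    by (intro exI[of _ "{}"]) (simp add: Z.independent_empty)
next
  case (insert b B)
  have indB: "Z.independent B" and b: "\<And>k. real_of_int k *\<^sub>R b \<in> Z.span B \<Longrightarrow> k = 0"
    using insert.prems(1) Z_independent_insert[OF insert.hyps(1,2)] by blast+
  have S: "Z.subspace S"
    using insert.prems(2) by (simp add: Z_subspace_iff)
  define S' where "S' = S \<inter> Z.span B"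
  have S'sub: "Z.subspace S'"
    unfolding S'_def using S Z.subspace_span by (rule Z.subspace_inter)
  obtain C where C: "finite C" "card C \<le> card B" "Z.independent C" "Z.span C = S'"
    using insert.IH[OF indB, of S'] S'sub by (auto simp: Z_subspace_iff S'_def)
  define I where "I = {k. \<exists>s\<in>S. s - real_of_int k *\<^sub>R b \<in> Z.span B}"
  have "subgroup_add I"
  proof (intro conjI ballI)
    show "0 \<in> I"
      using Z.subspace_0[OF S] Z.span_zero by (auto simp: I_def)
    fix j assume "j \<in> I"
    then obtain s where s: "s \<in> S" "s - real_of_int j *\<^sub>R b \<in> Z.span B"
      by (auto simp: I_def)
    then have "- s - real_of_int (- j) *\<^sub>R b \<in> Z.span B"
      using Z.span_neg[OF s(2)] by simp
    then show "- j \<in> I"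
      using insert.prems(2) s(1) unfolding I_def by blast
    fix k assume "k \<in> I"
    then obtain t where t: "t \<in> S" "t - real_of_int k *\<^sub>R b \<in> Z.span B"
      by (auto simp: I_def)
    have "s + t - real_of_int (j + k) *\<^sub>R b \<in> Z.span B"
      using Z.span_add[OF s(2) t(2)] by (simp add: algebra_simps)
    then show "j + k \<in> I"
      using insert.prems(2) s(1) t(1) unfolding I_def by blast
  qed
  then obtain d where d: "I = range (\<lambda>k. k * d)"
    by (rule int_subgroup_generator)
  have coeff: "\<exists>k. s - real_of_int (k * d) *\<^sub>R b \<in> Z.span B" if s: "s \<in> S" for s
  proof -
    obtain j where "s - real_of_int j *\<^sub>R b \<in> Z.span B"
      using s insert.prems(3) Z.span_breakdown_eq[of s b B] by auto
    then have "j \<in> I"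
      using s by (auto simp: I_def)
    then obtain k where "j = k * d"
      using d by blast
    then show ?thesis
      using \<open>s - real_of_int j *\<^sub>R b \<in> Z.span B\<close> by blast
  qed
  show ?case
  proof (cases "d = 0")
    case True
    then have "S' = S"
      using coeff by (auto simp: S'_def)
    then show ?thesis
      using C insert.hyps by (intro exI[of _ C]) auto
  next
    case False
    have "1 * d \<in> I"
      unfolding d by blast
    then obtain s0 where s0: "s0 \<in> S" "s0 - real_of_int d *\<^sub>R b \<in> Z.span B"
      by (auto simp: I_def)
    have free: "k = 0" if "real_of_int k *\<^sub>R s0 \<in> Z.span C" for k
    proof -
      have "real_of_int k *\<^sub>R s0 - real_of_int k *\<^sub>R (s0 - real_of_int d *\<^sub>R b) \<in> Z.span B"
        using that C(4) Z.span_diff[OF _ Z.span_scale[OF s0(2)]] by (auto simp: S'_def)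
      then have "real_of_int (k * d) *\<^sub>R b \<in> Z.span B"
        by (simp add: algebra_simps)
      then show ?thesis
        using b False by fastforce
    qed
    have "s0 \<notin> C"
      using free[of 1] Z.span_base[of s0 C] by auto
    then have "Z.independent (insert s0 C)"
      using Z_independent_insert[OF C(1)] C(3) free by blast
    moreover have "Z.span (insert s0 C) = S"
    proof
      show "Z.span (insert s0 C) \<subseteq> S"
        using s0(1) C(4) Z.span_superset[of C] by (intro Z.span_minimal S) (auto simp: S'_def)
      show "S \<subseteq> Z.span (insert s0 C)"
      proof
        fix s assume s: "s \<in> S"
        obtain k where k: "s - real_of_int (k * d) *\<^sub>R b \<in> Z.span B"
          using coeff[OF s] by blast
        have "(s - real_of_int (k * d) *\<^sub>R b) - real_of_int k *\<^sub>R (s0 - real_of_int d *\<^sub>R b) \<in> Z.span B"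
          by (intro Z.span_diff k Z.span_scale s0(2))
        then have "s - real_of_int k *\<^sub>R s0 \<in> Z.span B"
          by (simp add: algebra_simps)
        moreover have "s - real_of_int k *\<^sub>R s0 \<in> S"
          by (intro Z.subspace_diff[OF S s] Z.subspace_scale[OF S] s0(1))
        ultimately have "s - real_of_int k *\<^sub>R s0 \<in> Z.span C"
          by (simp add: C(4) S'_def)
        then show "s \<in> Z.span (insert s0 C)"
          by (auto simp: Z.span_breakdown_eq)
      qed
    qed
    ultimately show ?thesis
      using C(1,2) insert.hyps \<open>s0 \<notin> C\<close> by (intro exI[of _ "insert s0 C"]) auto
  qed
qed

text \<open>The predicate under the definite description in \<open>zrank\<close>, split off so that
  it can be compared for two groups.\<close>

definition has_rank :: "'a::real_vector set \<Rightarrow> nat \<Rightarrow> bool" where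
  "has_rank \<Lambda> r \<longleftrightarrow> (\<exists>B. finite B \<and> card B = r \<and> Z.independent B \<and> Z.span B = \<Lambda>)"

lemma zrank_eq: "zrank \<Lambda> = (THE r. has_rank \<Lambda> r)"
  by (simp add: zrank_def has_rank_def)

lemma has_rank_unique:
  assumes "has_rank \<Lambda> r" "has_rank \<Lambda> s"
  shows "r = s"
proof -
  obtain B C where "finite B" "card B = r" "Z.independent B" "Z.span B = \<Lambda>"
    "finite C" "card C = s" "Z.independent C" "Z.span C = \<Lambda>"
    using assms unfolding has_rank_def by blast
  then show ?thesis
    using Z_independent_card_le[of B C] Z_independent_card_le[of C B]
      Z.span_superset[of B] Z.span_superset[of C] by simp
qed

text \<open>The image of \<open>M\<close> under \<open>\<phi>\<close> is a subgroup of
  \<open>L\<close>, so it has a basis of at most \<open>r\<close> elements, and injectivity pulls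
  this basis back to \<open>M\<close>.\<close>

lemma has_rank_subgroup:
  fixes L M :: "'a::real_vector set"
  assumes "has_rank L r" "subgroup_add M" "linear \<phi>" "inj \<phi>" "\<phi> ` M \<subseteq> L"
  shows "\<exists>s\<le>r. has_rank M s"
proof -
  interpret hom: module_hom "\<lambda>(k::int) (x::'a). of_int k *\<^sub>R x" "\<lambda>(k::int) (x::'a). of_int k *\<^sub>R x" \<phi>
    by unfold_locales (simp_all add: linear_add[OF assms(3)] linear_scale[OF assms(3)])
  obtain B where B: "finite B" "card B = r" "Z.independent B" "Z.span B = L"
    using assms(1) unfolding has_rank_def by blast
  have "subgroup_add (\<phi> ` M)"
    using assms(2) hom.subspace_image[of M] by (simp add: Z_subspace_iff)
  moreover have "\<phi> ` M \<subseteq> Z.span B"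
    using assms(5) B(4) by simp
  ultimately have "\<exists>C. finite C \<and> card C \<le> card B \<and> Z.independent C \<and> Z.span C = \<phi> ` M"
    by (rule Z_span_subgroup_basis[OF B(1,3)])
  then obtain C where C: "finite C" "card C \<le> card B" "Z.independent C" "Z.span C = \<phi> ` M"
    by (elim exE conjE)
  have inj: "inj_on \<phi> A" for A
    using assms(4) by (rule inj_on_subset) simp
  define D where "D = \<phi> -` C"
  have "C \<subseteq> range \<phi>"
    using C(4) Z.span_superset[of C] by blast
  then have D: "C = \<phi> ` D"
    by (auto simp: D_def)
  have finD: "finite D"
    unfolding D_def using C(1) inj by (rule finite_vimageI)
  have cardD: "card D = card C"
    unfolding D by (rule card_image[OF inj, symmetric])
  have indD: "Z.independent D"
    unfolding Z_independent_iff[OF finD]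
  proof (intro allI impI ballI)
    fix u v assume u: "(\<Sum>v\<in>D. real_of_int (u v) *\<^sub>R v) = 0" and v: "v \<in> D"
    have "(\<Sum>w\<in>C. real_of_int (u (inv_into UNIV \<phi> w)) *\<^sub>R w) = (\<Sum>v\<in>D. real_of_int (u v) *\<^sub>R \<phi> v)"
      unfolding D using inj assms(4) by (simp add: sum.reindex)
    also have "\<dots> = \<phi> (\<Sum>v\<in>D. real_of_int (u v) *\<^sub>R v)"
      by (simp add: linear_sum[OF assms(3)] linear_scale[OF assms(3)])
    also have "\<dots> = 0"
      using u linear_0[OF assms(3)] by simp
    finally have "\<forall>w\<in>C. u (inv_into UNIV \<phi> w) = 0"
      by (rule C(3)[unfolded Z_independent_iff[OF C(1)], THEN spec, THEN mp])
    then show "u v = 0"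
      using v assms(4) by (auto simp: D)
  qed
  have "\<phi> ` Z.span D = \<phi> ` M"
    using C(4) unfolding D hom.span_image .
  then have "Z.span D = M"
    using assms(4) by (simp add: inj_image_eq_iff)
  then have "has_rank M (card D)"
    using finD indD unfolding has_rank_def by blast
  then show ?thesis
    using C(2) B(2) cardD by auto
qed

text \<open>The two \<open>has_rank\<close> predicates are shown to be equivalent, so the definite
  descriptions agree, also for groups without a finite basis.\<close>

theorem zrank_eqI:
  fixes L M :: "(complex ^ 'n) set"
  assumes "subgroup_add L" "subgroup_add M"
    and "linear \<phi>" "inj \<phi>" "\<phi> ` L \<subseteq> M" and "linear \<psi>" "inj \<psi>" "\<psi> ` M \<subseteq> L"
  shows "zrank L = zrank M"
proof -
  have "has_rank L r \<longleftrightarrow> has_rank M r" for r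
  proof
    assume r: "has_rank L r"
    \<comment> \<open>Passing to the other group and back gives \<open>t \<le> s \<le> r\<close>,
      and uniqueness of the rank forces \<open>t = r\<close>.\<close>
    obtain s where s: "s \<le> r" "has_rank M s"
      using has_rank_subgroup[OF r assms(2,6-8)] by blast
    obtain t where t: "t \<le> s" "has_rank L t"
      using has_rank_subgroup[OF s(2) assms(1,3-5)] by blast
    then show "has_rank M r"
      using has_rank_unique[OF r t(2)] s t by simp
  next
    assume r: "has_rank M r"
    obtain s where s: "s \<le> r" "has_rank L s"
      using has_rank_subgroup[OF r assms(1,3-5)] by blast
    obtain t where t: "t \<le> s" "has_rank M t"
      using has_rank_subgroup[OF s(2) assms(2,6-8)] by blast
    then show "has_rank L r"
      using has_rank_unique[OF r t(2)] s t by simp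
  qed
  then show ?thesis
    by (simp add: zrank_eq)
qed

section \<open>Meromorphic maps\<close>

text \<open>By \<open>step\<close> the interior of \<open>S\<close> is closed relative to the
  connected set \<open>W\<close>. The principle is isolated because it serves both zeros of
  holomorphic functions and analytic subsets.\<close>

lemma closure_interior_induct:
  assumes W: "open W" "connected W" and V: "open V" "V \<noteq> {}" "V \<subseteq> W" "V \<subseteq> S"
    and step: "\<And>p. p \<in> W \<Longrightarrow> p \<in> closure (interior S) \<Longrightarrow> p \<in> interior S"
  shows "W \<subseteq> S"
proof -
  define Z where "Z = W \<inter> interior S"
  have "openin (top_of_set W) Z"
    by (simp add: Z_def openin_open_Int)
  moreover have "Z = W \<inter> closure (interior S)"
    using step closure_subset[of "interior S"] by (auto simp: Z_def)
  then have "closedin (top_of_set W) Z"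
    by (simp add: closedin_closed_Int)
  moreover have "V \<subseteq> Z"
    using V interior_maximal[of V S] by (auto simp: Z_def)
  ultimately have "Z = W"
    using W(2) V(2) unfolding connected_clopen by blast
  then show ?thesis
    using interior_subset[of S] by (auto simp: Z_def)
qed

lemma holomorphic_zero_on_connected:
  fixes W :: "(complex ^ 'n) set"
  assumes W: "open W" "connected W" "\<And>z. z \<in> W \<Longrightarrow> holomorphic_at f z"
    and V: "open V" "V \<noteq> {}" "V \<subseteq> W" "\<And>z. z \<in> V \<Longrightarrow> f z = 0" and q: "q \<in> W"
  shows "f q = 0"
proof -
  have "W \<subseteq> {z. f z = 0}"
  proof (rule closure_interior_induct[OF W(1,2) V(1-3)])
    fix p assume p: "p \<in> W" "p \<in> closure (interior {z. f z = 0})"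
    obtain e where e: "e > 0" "ball p e \<subseteq> W"
      using W(1) p(1) by (rule openE)
    define Z where "Z = interior {z. f z = 0} \<inter> ball p e"
    have "p \<in> ball p e \<inter> closure (interior {z. f z = 0})"
      using p(2) e(1) by simp
    then have "ball p e \<inter> closure (interior {z. f z = 0}) \<noteq> {}"
      by blast
    then have "Z \<noteq> {}"
      unfolding open_Int_closure_eq_empty[OF open_ball] by (simp add: Z_def Int_commute)
    moreover have "f z = 0" if "z \<in> Z" for z
      using that interior_subset[of "{z. f z = 0}"] by (auto simp: Z_def)
    moreover have "open Z" "Z \<subseteq> ball p e"
      by (auto simp: Z_def)
    moreover have "holomorphic_at f z" if "z \<in> ball p e" for z
      using e(2) that by (intro W(3)) blast
    ultimately have "f z = 0" if "z \<in> ball p e" for z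
      using holomorphic_zero_on_convex[OF open_ball convex_ball, of p e f Z] that by simp
    then have "ball p e \<subseteq> interior {z. f z = 0}"
      by (intro interior_maximal) auto
    then show "p \<in> interior {z. f z = 0}"
      using e(1) by auto
  qed (use V in auto)
  then show ?thesis
    using q by auto
qed

text \<open>If \<open>A\<close> contained a nonempty open set, then around each point in the closure
  of its interior the local equations would vanish on an open set, hence on a whole ball, and
  \<open>A\<close> would be the whole space.\<close>

lemma open_dense_compl_analytic_subset:
  fixes A :: "(complex ^ 'n) set"
  assumes A: "analytic_subset A" "A \<noteq> UNIV"
  shows "open_dense (- A)"
proof -
  have nbhd: "\<exists>e F. e > 0 \<and> (\<forall>h\<in>F. \<forall>z\<in>ball p e. holomorphic_at h z) \<and>
      (\<forall>z\<in>ball p e. z \<in> A \<longleftrightarrow> (\<forall>h\<in>F. h z = 0))" for p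
  proof -
    from A(1)[unfolded analytic_subset_def, THEN spec, of p]
    obtain W F where W: "open W" "p \<in> W" "\<forall>h\<in>F. \<forall>z\<in>W. analytic_at UNIV h z"
      "A \<inter> W = {z\<in>W. \<forall>h\<in>F. h z = 0}"
      by (elim exE conjE)
    obtain e where e: "e > 0" "ball p e \<subseteq> W"
      using W(1,2) by (rule openE)
    show ?thesis
    proof (intro exI conjI ballI)
      show "z \<in> A \<longleftrightarrow> (\<forall>h\<in>F. h z = 0)" if "z \<in> ball p e" for z
        using W(4) e(2) that by blast
      show "holomorphic_at h z" if "h \<in> F" "z \<in> ball p e" for h z
        using W(3) e(2) that by (intro analytic_at_imp_holomorphic_at) auto
    qed (rule e)
  qed
  have "open (- A)"
    unfolding open_subopen[of "- A"]
  proof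
    fix p assume "p \<in> - A"
    obtain e F where e: "e > 0" "\<forall>h\<in>F. \<forall>z\<in>ball p e. holomorphic_at h z"
      "\<forall>z\<in>ball p e. z \<in> A \<longleftrightarrow> (\<forall>h\<in>F. h z = 0)"
      using nbhd[of p] by (elim exE conjE)
    then obtain h where h: "h \<in> F" "h p \<noteq> 0"
      using \<open>p \<in> - A\<close> by auto
    have "open {z \<in> ball p e. h z \<noteq> 0}"
      using e(2) h(1) by (intro open_nonzero_set) (auto intro: holomorphic_at_imp_continuous)
    moreover have "{z \<in> ball p e. h z \<noteq> 0} \<subseteq> - A"
      using e(3) h(1) by auto
    ultimately show "\<exists>T. open T \<and> p \<in> T \<and> T \<subseteq> - A"
      using e(1) h(2) by (intro exI[of _ "{z \<in> ball p e. h z \<noteq> 0}"]) auto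
  qed
  moreover have "V \<inter> - A \<noteq> {}" if V: "open V" "V \<noteq> {}" for V
  proof
    assume "V \<inter> - A = {}"
    then have "V \<subseteq> A"
      by blast
    have "UNIV \<subseteq> A"
    proof (rule closure_interior_induct[OF open_UNIV connected_UNIV V subset_UNIV \<open>V \<subseteq> A\<close>])
      fix p assume p: "p \<in> closure (interior A)"
      obtain e F where e: "e > 0" "\<forall>h\<in>F. \<forall>z\<in>ball p e. holomorphic_at h z"
        "\<forall>z\<in>ball p e. z \<in> A \<longleftrightarrow> (\<forall>h\<in>F. h z = 0)"
        using nbhd[of p] by (elim exE conjE)
      define Z where "Z = interior A \<inter> ball p e"
      have "p \<in> ball p e \<inter> closure (interior A)"
        using p e(1) by simp
      then have "ball p e \<inter> closure (interior A) \<noteq> {}"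
        by blast
      then have "Z \<noteq> {}"
        unfolding open_Int_closure_eq_empty[OF open_ball] by (simp add: Z_def Int_commute)
      moreover have "open Z" "Z \<subseteq> A" "Z \<subseteq> ball p e"
        using interior_subset[of A] by (auto simp: Z_def)
      ultimately have Z: "Z \<noteq> {}" "open Z" "Z \<subseteq> A" "Z \<subseteq> ball p e"
        by auto
      have "h z = 0" if h: "h \<in> F" and z: "z \<in> ball p e" for h z
      proof (rule holomorphic_zero_on_convex[OF open_ball convex_ball _ Z(2,1,4) _ z])
        show "holomorphic_at h w" if "w \<in> ball p e" for w
          using e(2) h that by blast
        show "h w = 0" if "w \<in> Z" for w
          using e(3) h that Z(3,4) by auto
      qed
      then have "ball p e \<subseteq> A"
        using e(3) by auto
      then have "ball p e \<subseteq> interior A"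
        by (intro interior_maximal) auto
      then show "p \<in> interior A"
        using e(1) by auto
    qed
    then show False
      using A(2) by auto
  qed
  ultimately show ?thesis
    unfolding open_dense_def by blast
qed

lemma meromorphic_map_component:
  fixes f :: "complex ^ 'n \<Rightarrow> complex ^ 'm"
  assumes f: "meromorphic_map f"
  shows "meromorphic_fun (regular f) (\<lambda>z. f z $ i)"
  unfolding meromorphic_fun_def
proof (intro conjI ballI allI)
  show "open_dense (regular f)"
    using f open_dense_compl_analytic_subset[of "- regular f"] by (simp add: meromorphic_map_def)
  show "holomorphic_at (\<lambda>z. f z $ i) z" if "z \<in> regular f" for z
    using that by (intro analytic_at_imp_holomorphic_at) (simp add: regular_def)
  fix p
  from f[unfolded meromorphic_map_def, THEN conjunct2, THEN conjunct2, THEN spec, THEN spec, of p i]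
  obtain W G H where W: "open W" "connected W" "p \<in> W"
    "\<forall>z\<in>W. analytic_at UNIV G z \<and> analytic_at UNIV H z" "\<exists>z\<in>W. H z \<noteq> 0"
    "\<forall>z\<in>W \<inter> regular f. H z * f z $ i = G z"
    by (elim exE conjE)
  have hol: "holomorphic_at G z" "holomorphic_at H z" if "z \<in> W" for z
    using W(4) that by (auto intro: analytic_at_imp_holomorphic_at)
  \<comment> \<open>The definition provides only a denominator that is not identically zero on a
    connected set; the identity theorem upgrades this to every nonempty open subset.\<close>
  have "\<exists>z\<in>V. H z \<noteq> 0" if V: "open V" "V \<noteq> {}" "V \<subseteq> W" for V
  proof (rule ccontr)
    assume "\<not> ?thesis"
    then have zero: "\<forall>w\<in>V. H w = 0"
      by blast
    have "H z = 0" if z: "z \<in> W" for z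
    proof (rule holomorphic_zero_on_connected[OF W(1,2) hol(2) V _ z])
      show "H w = 0" if "w \<in> V" for w
        using zero that by blast
    qed
    then show False
      using W(5) by blast
  qed
  then have "quotient_on (regular f) (\<lambda>z. f z $ i) W G H"
    using W hol unfolding quotient_on_def by auto
  then show "local_quotient (regular f) (\<lambda>z. f z $ i) p"
    using W(3) unfolding local_quotient_def by blast
qed

section \<open>Linearity of isomorphisms\<close>

text \<open>Cauchy's functional equation: additivity settles the rational multiples, and continuity
  extends this to the closure of \<open>\<rat>\<close>.\<close>

lemma additive_scaleR:
  fixes h :: "'a::real_normed_vector \<Rightarrow> 'b::real_normed_vector"
  assumes V: "subspace V" and cont: "continuous_on V h"
    and add: "\<And>x y. x \<in> V \<Longrightarrow> y \<in> V \<Longrightarrow> h (x + y) = h x + h y"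
    and x: "x \<in> V"
  shows "h (t *\<^sub>R x) = t *\<^sub>R h x"
proof -
  have h0: "h 0 = 0"
    using add[of 0 0] subspace_0[OF V] by simp
  have neg: "h (- y) = - h y" if "y \<in> V" for y
    using add[of y "- y"] that subspace_neg[OF V that] h0 by (simp add: add_eq_0_iff)
  have nat: "h (real n *\<^sub>R y) = real n *\<^sub>R h y" if "y \<in> V" for n y
  proof (induction n)
    case (Suc n)
    have "h (y + real n *\<^sub>R y) = h y + h (real n *\<^sub>R y)"
      using that subspace_scale[OF V that] by (rule add)
    with Suc show ?case
      by (simp add: scaleR_add_left)
  qed (simp add: h0)
  define S where "S = {t. h (t *\<^sub>R x) = t *\<^sub>R h x}"
  have rat: "r \<in> S" if r: "r \<in> \<rat>" "r \<ge> 0" for r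
  proof -
    obtain m n :: nat where mn: "n \<noteq> 0" "\<bar>r\<bar> = real m / real n"
      using r(1) by (rule Rats_abs_nat_div_natE)
    have "real n *\<^sub>R h (r *\<^sub>R x) = h (real n *\<^sub>R r *\<^sub>R x)"
      by (rule nat[symmetric]) (intro subspace_scale V x)
    also have "real n *\<^sub>R r *\<^sub>R x = real m *\<^sub>R x"
      using mn r(2) by simp
    also have "h (real m *\<^sub>R x) = real m *\<^sub>R h x"
      by (rule nat[OF x])
    also have "\<dots> = real n *\<^sub>R (r *\<^sub>R h x)"
      using mn r(2) by simp
    finally have "real n *\<^sub>R (h (r *\<^sub>R x) - r *\<^sub>R h x) = 0"
      by (simp only: scaleR_diff_right diff_self)
    then show ?thesis
      using mn(1) by (simp add: S_def)
  qed
  have "\<rat> \<subseteq> S"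
  proof
    fix r :: real assume r: "r \<in> \<rat>"
    show "r \<in> S"
    proof (cases "r \<ge> 0")
      case False
      then have "- r \<in> S"
        using r by (intro rat) auto
      then show ?thesis
        using neg[of "r *\<^sub>R x"] subspace_scale[OF V x] by (simp add: S_def)
    qed (use rat r in auto)
  qed
  moreover have "closed S"
  proof -
    have "continuous_on UNIV (\<lambda>t. h (t *\<^sub>R x))"
      by (rule continuous_on_compose2[OF cont]) (auto intro!: continuous_intros subspace_scale V x)
    then show ?thesis
      unfolding S_def by (intro closed_Collect_eq continuous_intros)
  qed
  ultimately have "closure \<rat> \<subseteq> S"
    by (rule closure_minimal)
  then show ?thesis
    by (auto simp: Rats_closure_real S_def)
qed

lemma holomorphic_at_vector:
  fixes F :: "complex ^ 'n \<Rightarrow> complex ^ 'm"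
  assumes "\<And>i. holomorphic_at (\<lambda>z. F z $ i) p"
  shows "\<exists>A. (F has_derivative A) (at p) \<and> (\<forall>c v. A (c *s v) = c *s A v)"
proof -
  obtain A where A: "\<And>i. ((\<lambda>z. F z $ i) has_derivative A i) (at p)" "\<And>i. complex_homogeneous (A i)"
    using assms unfolding holomorphic_at_def by metis
  have "((\<lambda>z. \<Sum>i\<in>UNIV. F z $ i *s axis i 1) has_derivative (\<lambda>v. \<Sum>i\<in>UNIV. A i v *s axis i 1)) (at p)"
    by (intro has_derivative_sum bounded_linear.has_derivative[OF bounded_linear_complex_scale] A)
  then have "(F has_derivative (\<lambda>v. \<Sum>i\<in>UNIV. A i v *s axis i 1)) (at p)"
    by (simp add: basis_expansion)
  moreover have "(\<Sum>i\<in>UNIV. A i (c *s v) *s axis i 1) = c *s (\<Sum>i\<in>UNIV. A i v *s (axis i 1 :: complex ^ 'm))" for c v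
    using A(2) by (simp add: complex_homogeneous_def vec.scale_sum_right)
  ultimately show ?thesis
    by blast
qed

lemma subspace_vecs: "K = \<real> \<or> K = UNIV \<Longrightarrow> subspace (vecs K)"
  by (auto simp: subspace_def vecs_def scaleR_conv_of_real[where 'a = complex])

text \<open>\<open>L\<close> is determined by the values of \<open>h\<close> at the standard basis
  vectors, which lie in \<open>vecs K\<close> in both cases. Surjectivity of \<open>h\<close> puts
  these vectors into the range of \<open>L\<close>, so \<open>L\<close> is onto and, by dimension,
  bijective.\<close>

lemma complex_linear_extension:
  fixes h :: "complex ^ 'n \<Rightarrow> complex ^ 'n"
  assumes K: "K = \<real> \<or> K = UNIV"
    and add: "\<And>x y. x \<in> vecs K \<Longrightarrow> y \<in> vecs K \<Longrightarrow> h (x + y) = h x + h y"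
    and hom: "\<And>c x. c \<in> K \<Longrightarrow> x \<in> vecs K \<Longrightarrow> h (c *s x) = c *s h x"
    and surj: "vecs K \<subseteq> h ` vecs K"
  obtains L where "linear L" "\<forall>c x. L (c *s x) = c *s L x" "bij L" "\<forall>x\<in>vecs K. L x = h x"
proof -
  define L where "L = (\<lambda>z. \<Sum>i\<in>UNIV. z $ i *s h (axis i 1))"
  have scale: "L (c *s x) = c *s L x" for c x
    by (simp add: L_def vec.scale_sum_right)
  have Ladd: "L (x + y) = L x + L y" for x y
    by (simp add: L_def sum.distrib vec.scale_left_distrib)
  have lin: "linear L"
  proof (rule linearI)
    show "L (r *\<^sub>R b) = r *\<^sub>R L b" for r b
    proof -
      have eq: "r *\<^sub>R v = complex_of_real r *s v" for v :: "complex ^ 'n"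
        by (simp only: vec_eq_iff vector_scaleR_component vector_smult_component scaleR_conv_of_real[where 'a = complex]) simp
      show ?thesis
        unfolding eq by (rule scale)
    qed
  qed (rule Ladd)
  have V: "subspace (vecs K)"
    using K by (rule subspace_vecs)
  have axis: "c *s axis i 1 \<in> vecs K" if "c \<in> K" for c i
    using that K by (auto simp: vecs_def axis_def)
  have Lh: "L x = h x" if x: "x \<in> vecs K" for x
  proof -
    have xK: "x $ i \<in> K" for i
      using x by (simp add: vecs_def)
    have "h (\<Sum>i\<in>I. x $ i *s axis i 1) = (\<Sum>i\<in>I. h (x $ i *s axis i 1))" for I :: "'n set"
    proof (induction I rule: infinite_finite_induct)
      case (insert j I)
      have "x $ j *s axis j 1 \<in> vecs K" "(\<Sum>i\<in>I. x $ i *s axis i 1) \<in> vecs K"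
        by (intro subspace_sum[OF V] axis xK)+
      with insert show ?case
        by (simp add: add)
    qed (use add[of 0 0] subspace_0[OF V] in auto)
    from this[of UNIV] have "h x = (\<Sum>i\<in>UNIV. h (x $ i *s axis i 1))"
      by (simp only: basis_expansion)
    moreover have "h (x $ i *s axis i 1) = x $ i *s h (axis i 1)" for i
      using axis[of 1 i] K by (intro hom xK) auto
    ultimately show ?thesis
      by (simp add: L_def)
  qed
  have "surj L"
  proof -
    have "\<exists>w. L w = axis i 1" for i
    proof -
      have "axis i 1 \<in> vecs K"
        using axis[of 1 i] K by auto
      then obtain x where "x \<in> vecs K" "h x = axis i 1"
        using surj by fastforce
      then show ?thesis
        using Lh[of x] by auto
    qed
    then obtain w where w: "\<And>i. L (w i) = axis i 1"
      by metis
    have "L (\<Sum>i\<in>UNIV. y $ i *s w i) = (\<Sum>i\<in>UNIV. y $ i *s axis i 1)" for y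
      by (simp add: linear_sum[OF lin] scale w)
    then have "L (\<Sum>i\<in>UNIV. y $ i *s w i) = y" for y
      by (simp only: basis_expansion)
    then show ?thesis
      by (rule surjI)
  qed
  then have "bij L"
    using linear_surjective_imp_injective[OF lin] by (simp add: bij_def)
  then show ?thesis
    using that[of L] lin scale Lh by simp
qed

section \<open>Charts\<close>

lemma analytic_map_continuous:
  fixes \<phi> :: "complex ^ 'n \<Rightarrow> complex ^ 'm"
  assumes K: "K = \<real> \<or> K = UNIV" and \<phi>: "analytic_map K T \<phi>" and T: "T \<subseteq> vecs K"
  shows "continuous_on T \<phi>"
proof -
  have "continuous (at p within T) (\<lambda>z. \<phi> z $ i)" if p: "p \<in> T" for p i
  proof -
    have "analytic_at K (\<lambda>z. \<phi> z $ i) p"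
      using \<phi> p by (simp add: analytic_map_def)
    moreover have "p \<in> vecs K"
      using p T by blast
    ultimately obtain A where "((\<lambda>z. \<phi> z $ i) has_derivative A) (at p within vecs K)"
      using analytic_at_has_derivative_within[OF _ K] by metis
    then have "continuous (at p within vecs K) (\<lambda>z. \<phi> z $ i)"
      by (rule has_derivative_continuous)
    then show ?thesis
      using T by (rule continuous_within_subset)
  qed
  then have "continuous_on T (\<lambda>z. \<chi> i. \<phi> z $ i)"
    by (intro continuous_on_vec_lambda) (simp add: continuous_on_eq_continuous_within)
  then show ?thesis
    by simp
qed

text \<open>The image of \<open>X\<close> is its preimage under the inverse map, which is
  continuous.\<close>

lemma analytic_diffeo_open_image:
  fixes \<phi> :: "complex ^ 'n \<Rightarrow> complex ^ 'n"
  assumes K: "K = \<real> \<or> K = UNIV" and \<phi>: "analytic_diffeo K U T \<phi>"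
    and X: "open_in_vecs K X" "X \<subseteq> U"
  shows "open_in_vecs K (\<phi> ` X)"
proof -
  have T: "open_in_vecs K T" "bij_betw \<phi> U T" "analytic_map K T (inv_into U \<phi>)" "open_in_vecs K U"
    using \<phi> by (auto simp: analytic_diffeo_def)
  have sub: "T \<subseteq> vecs K" "U \<subseteq> vecs K"
    using openin_imp_subset[OF T(1)] openin_imp_subset[OF T(4)] by auto
  have "continuous_on T (inv_into U \<phi>)"
    by (rule analytic_map_continuous[OF K T(3) sub(1)])
  moreover have "inv_into U \<phi> \<in> T \<rightarrow> vecs K"
    using T(3) by (auto simp: analytic_map_def)
  ultimately have "openin (top_of_set T) (T \<inter> inv_into U \<phi> -` X)"
    using X(1) by (rule continuous_openin_preimage)
  also have "T \<inter> inv_into U \<phi> -` X = \<phi> ` X"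
  proof
    show "T \<inter> inv_into U \<phi> -` X \<subseteq> \<phi> ` X"
    proof
      fix y assume "y \<in> T \<inter> inv_into U \<phi> -` X"
      then show "y \<in> \<phi> ` X"
        using bij_betw_inv_into_right[OF T(2), of y] by (metis IntE image_eqI vimageE)
    qed
    show "\<phi> ` X \<subseteq> T \<inter> inv_into U \<phi> -` X"
      using X(2) bij_betw_inv_into_left[OF T(2)] bij_betwE[OF T(2)] by (auto simp: subset_iff)
  qed
  finally show ?thesis
    using T(1) by (rule openin_trans)
qed

section \<open>Algebraic dependence and periods\<close>

lemma meromorphic_fun_box_poly:
  fixes z :: "complex ^ 'n \<Rightarrow> complex ^ 'm"
  assumes "\<And>l. meromorphic_fun \<Omega> (\<lambda>x. z x $ l)"
  shows "meromorphic_fun \<Omega> (\<lambda>x. box_poly e q (($) (z x)))"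
proof -
  have "open_dense \<Omega>"
    using assms unfolding meromorphic_fun_def by blast
  then show ?thesis
    unfolding box_poly_def
    by (intro meromorphic_fun_sum meromorphic_fun_mult meromorphic_fun_prod meromorphic_fun_power
        meromorphic_fun_const assms)
qed

lemma fun_periods_vec:
  "a \<in> fun_periods \<Omega> z \<longleftrightarrow> (\<forall>l. a \<in> fun_periods \<Omega> (\<lambda>x. z x $ l))"
  by (auto simp: fun_periods_def vec_eq_iff)

text \<open>The identity theorem extends the relation from \<open>X\<close> to the common domain.
  Openness of the image of \<open>X\<close> under \<open>z\<close> ensures that the leading
  coefficient, a nonzero polynomial in \<open>z\<close>, does not vanish identically on
  \<open>X\<close>.\<close>

lemma algebraic_transfers_periods:
  fixes z :: "complex ^ 'n \<Rightarrow> complex ^ 'n"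
  assumes K: "K = \<real> \<or> K = UNIV"
    and z: "\<And>l. meromorphic_fun \<Omega> (\<lambda>x. z x $ l)" and y: "meromorphic_fun \<Omega>' y"
    and X: "open_in_vecs K X" "X \<noteq> {}" "X \<subseteq> \<Omega>" "X \<subseteq> \<Omega>'" "open_in_vecs K (z ` X)"
    and alg: "algebraic_on X (\<lambda>x. ($) (z x)) y"
  shows "\<exists>N>0. \<forall>a\<in>fun_periods \<Omega> z. real N *\<^sub>R a \<in> fun_periods \<Omega>' y"
proof -
  obtain d e q where q: "\<exists>\<gamma>\<in>exps e. q d \<gamma> \<noteq> 0"
    and rel: "\<And>x. x \<in> X \<Longrightarrow> (\<Sum>k\<le>d. box_poly e (q k) (($) (z x)) * y x ^ k) = 0"
    by (rule algebraic_on_leading[OF alg]) metis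
  define c where "c = (\<lambda>k x. box_poly e (q k) (($) (z x)))"
  have c: "meromorphic_fun \<Omega> (c k)" for k
    unfolding c_def by (rule meromorphic_fun_box_poly[OF z])
  have \<Omega>: "open_dense (\<Omega> \<inter> \<Omega>')"
    using c[of 0] y by (intro open_dense_Int) (auto simp: meromorphic_fun_def)
  have mer: "meromorphic_fun (\<Omega> \<inter> \<Omega>') (\<lambda>x. \<Sum>k\<le>d. c k x * y x ^ k)"
    by (intro meromorphic_fun_sum meromorphic_fun_mult meromorphic_fun_power
        meromorphic_fun_subset[OF c \<Omega>] meromorphic_fun_subset[OF y \<Omega>] \<Omega>) auto
  have rel': "(\<Sum>k\<le>d. c k x * y x ^ k) = 0" if "x \<in> \<Omega>" "x \<in> \<Omega>'" for x
  proof (rule meromorphic_fun_eq_zero_on_vecs[OF mer K X(1,2)])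
    show "(\<Sum>k\<le>d. c k x * y x ^ k) = 0" if "x \<in> X" for x
      using rel[OF that] by (simp add: c_def)
  qed (use X that in auto)
  obtain \<gamma> where "\<gamma> \<in> exps e" "q d \<gamma> \<noteq> 0"
    using q by blast
  then obtain x where x: "x \<in> X" "c d x \<noteq> 0"
    using box_poly_nonzero[OF K X(5), of \<gamma> e "q d"] X(2) by (auto simp: c_def)
  have "real (fact d) *\<^sub>R a \<in> fun_periods \<Omega>' y" if a: "a \<in> fun_periods \<Omega> z" for a
  proof (rule fun_periods_algebraic[OF c _ y rel' order_refl _ x(2)])
    show "a \<in> fun_periods \<Omega> (c k)" for k
      using a by (auto simp: fun_periods_def c_def)
  qed (use x X in auto)
  then show ?thesis
    by (intro exI[of _ "fact d"]) auto
qed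

lemma algebraic_transfers_periods_vec:
  fixes z y :: "complex ^ 'n \<Rightarrow> complex ^ 'n"
  assumes K: "K = \<real> \<or> K = UNIV"
    and z: "\<And>l. meromorphic_fun \<Omega> (\<lambda>x. z x $ l)" and y: "\<And>l. meromorphic_fun \<Omega>' (\<lambda>x. y x $ l)"
    and X: "\<And>i. open_in_vecs K (X i)" "\<And>i. X i \<noteq> {}" "\<And>i. X i \<subseteq> \<Omega>" "\<And>i. X i \<subseteq> \<Omega>'"
      "\<And>i. open_in_vecs K (z ` X i)"
    and alg: "\<And>i. algebraic_on (X i) (\<lambda>x. ($) (z x)) (\<lambda>x. y x $ i)"
  shows "\<exists>N>0. \<forall>a\<in>fun_periods \<Omega> z. real N *\<^sub>R a \<in> fun_periods \<Omega>' y"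
proof -
  have "\<exists>N>0. \<forall>a\<in>fun_periods \<Omega> z. real N *\<^sub>R a \<in> fun_periods \<Omega>' (\<lambda>x. y x $ i)" for i
    by (rule algebraic_transfers_periods[OF K z y X alg])
  then obtain N where N: "\<And>i. N i > 0"
    "\<And>i a. a \<in> fun_periods \<Omega> z \<Longrightarrow> real (N i) *\<^sub>R a \<in> fun_periods \<Omega>' (\<lambda>x. y x $ i)"
    by metis
  \<comment> \<open>A common multiple of the factors found for the single components.\<close>
  define M where "M = (\<Prod>i\<in>UNIV. N i)"
  have "real M *\<^sub>R a \<in> fun_periods \<Omega>' y" if a: "a \<in> fun_periods \<Omega> z" for a
    unfolding fun_periods_vec
  proof
    fix i
    have "M = (\<Prod>j\<in>UNIV - {i}. N j) * N i"
      unfolding M_def by (subst prod.remove[of _ i]) auto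
    then have M: "real M *\<^sub>R a = real (\<Prod>j\<in>UNIV - {i}. N j) *\<^sub>R real (N i) *\<^sub>R a"
      by (simp only: of_nat_mult scaleR_scaleR)
    show "real M *\<^sub>R a \<in> fun_periods \<Omega>' (\<lambda>x. y x $ i)"
      unfolding M by (rule fun_periods_multiple[OF y N(2)[OF a]])
  qed
  moreover have "M > 0"
    using N(1) by (simp add: M_def prod_pos)
  ultimately show ?thesis
    by blast
qed

text \<open>The conditions are imposed one at a time: the part of \<open>X\<close> left so far still
  has an open image, on which the next nonzero polynomial cannot vanish identically.\<close>

lemma nonzero_locus_open_in_vecs:
  fixes z :: "complex ^ 'n \<Rightarrow> complex ^ 'n"
  assumes K: "K = \<real> \<or> K = UNIV"
    and X: "open_in_vecs K X" "X \<noteq> {}" "continuous_on X z"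
    and op: "\<And>Y. open_in_vecs K Y \<Longrightarrow> Y \<subseteq> X \<Longrightarrow> open_in_vecs K (z ` Y)"
    and A: "finite I" "\<And>i. i \<in> I \<Longrightarrow> \<exists>\<gamma>\<in>exps (e i). A i \<gamma> \<noteq> 0"
  shows "open_in_vecs K {x \<in> X. \<forall>i\<in>I. box_poly (e i) (A i) (($) (z x)) \<noteq> 0} \<and>
    {x \<in> X. \<forall>i\<in>I. box_poly (e i) (A i) (($) (z x)) \<noteq> 0} \<noteq> {}"
  using A
proof (induction I rule: finite_induct)
  case (insert j I)
  define Y where "Y = {x \<in> X. \<forall>i\<in>I. box_poly (e i) (A i) (($) (z x)) \<noteq> 0}"
  define b where "b = (\<lambda>x. box_poly (e j) (A j) (($) (z x)))"
  have Y: "open_in_vecs K Y" "Y \<noteq> {}" "Y \<subseteq> X"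
    using insert by (auto simp: Y_def)
  obtain \<gamma> where "\<gamma> \<in> exps (e j)" "A j \<gamma> \<noteq> 0"
    using insert.prems by blast
  then have "\<exists>w\<in>z ` Y. box_poly (e j) (A j) (($) w) \<noteq> 0"
    using Y by (intro box_poly_nonzero[OF K op]) auto
  then have "Y \<inter> b -` (- {0}) \<noteq> {}"
    by (auto simp: b_def)
  moreover have "continuous_on Y b"
    unfolding b_def box_poly_def using continuous_on_subset[OF X(3) Y(3)] by (intro continuous_intros)
  then have "openin (top_of_set Y) (Y \<inter> b -` (- {0}))"
    by (rule continuous_openin_preimage_gen) auto
  then have "open_in_vecs K (Y \<inter> b -` (- {0}))"
    using Y(1) by (rule openin_trans)
  moreover have "{x \<in> X. \<forall>i\<in>insert j I. box_poly (e i) (A i) (($) (z x)) \<noteq> 0} = Y \<inter> b -` (- {0})"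
    by (auto simp: Y_def b_def)
  ultimately show ?case
    by simp
qed (use X in simp)

text \<open>
  Algebraicity is symmetric here because \<open>y\<close> is a local diffeomorphism, so that its components are
  algebraically independent.
\<close>

lemma algebraic_periods_commensurable:
  fixes z y :: "complex ^ 'n \<Rightarrow> complex ^ 'n"
  assumes K: "K = \<real> \<or> K = UNIV"
    and z: "\<And>l. meromorphic_fun \<Omega> (\<lambda>x. z x $ l)" and y: "\<And>l. meromorphic_fun \<Omega>' (\<lambda>x. y x $ l)"
    and X: "open_in_vecs K X" "X \<noteq> {}" "X \<subseteq> \<Omega>" "X \<subseteq> \<Omega>'"
    and opz: "\<And>Y. open_in_vecs K Y \<Longrightarrow> Y \<subseteq> X \<Longrightarrow> open_in_vecs K (z ` Y)"
    and opy: "\<And>Y. open_in_vecs K Y \<Longrightarrow> Y \<subseteq> X \<Longrightarrow> open_in_vecs K (y ` Y)"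
    and alg: "\<And>i. algebraic_on X (\<lambda>x. ($) (z x)) (\<lambda>x. y x $ i)"
  shows "\<exists>N>0. \<forall>a\<in>fun_periods \<Omega> z. real N *\<^sub>R a \<in> fun_periods \<Omega>' y"
    and "\<exists>N>0. \<forall>a\<in>fun_periods \<Omega>' y. real N *\<^sub>R a \<in> fun_periods \<Omega> z"
proof -
  show "\<exists>N>0. \<forall>a\<in>fun_periods \<Omega> z. real N *\<^sub>R a \<in> fun_periods \<Omega>' y"
    by (rule algebraic_transfers_periods_vec[OF K z y, where X = "\<lambda>_. X"])
       (use X alg opz in auto)
  have "isCont (\<lambda>x. z x $ l) x" if "x \<in> X" for l x
    using that X(3) by (intro meromorphic_fun_continuous[OF z]) auto
  then have "continuous_on X (\<lambda>x. \<chi> l. z x $ l)"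
    by (intro continuous_on_vec_lambda continuous_at_imp_continuous_on) auto
  then have cont: "continuous_on X z"
    by simp
  \<comment> \<open>The exchange holds only off the zeros of certain leading coefficients, and these
    may differ for each \<open>j\<close>. Some nonempty open set for each \<open>j\<close> is
    enough, because every relation is extended globally afterwards.\<close>
  have ex: "\<exists>Y. open_in_vecs K Y \<and> Y \<noteq> {} \<and> Y \<subseteq> X \<and> algebraic_on Y (\<lambda>x. ($) (y x)) (\<lambda>x. z x $ j)" for j
  proof (rule algebraic_exchange[of X "\<lambda>x. ($) (z x)" "\<lambda>x. ($) (y x)" j])
    show "algebraic_on X (\<lambda>x. ($) (z x)) (\<lambda>x. y x $ i)" for i
      by (rule alg)
    fix e :: "'n \<Rightarrow> nat" and A :: "'n \<Rightarrow> ('n \<Rightarrow> nat) \<Rightarrow> complex"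
    assume A: "\<And>i. \<exists>\<gamma>\<in>exps (e i). A i \<gamma> \<noteq> 0"
      and Y: "algebraic_on {x \<in> X. \<forall>i. box_poly (e i) (A i) (($) (z x)) \<noteq> 0} (\<lambda>x. ($) (y x)) (\<lambda>x. z x $ j)"
    show ?thesis
      using nonzero_locus_open_in_vecs[OF K X(1,2) cont opz, of UNIV e A] A Y
      by (intro exI[of _ "{x \<in> X. \<forall>i. box_poly (e i) (A i) (($) (z x)) \<noteq> 0}"]) auto
  qed
  obtain Y where Y: "\<And>j. open_in_vecs K (Y j)" "\<And>j. Y j \<noteq> {}" "\<And>j. Y j \<subseteq> X"
    "\<And>j. algebraic_on (Y j) (\<lambda>x. ($) (y x)) (\<lambda>x. z x $ j)"
    using ex by metis
  show "\<exists>N>0. \<forall>a\<in>fun_periods \<Omega>' y. real N *\<^sub>R a \<in> fun_periods \<Omega> z"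
  proof (rule algebraic_transfers_periods_vec[OF K y z Y(1,2) _ _ _ Y(4)])
    show "Y i \<subseteq> \<Omega>'" "Y i \<subseteq> \<Omega>" for i
      using Y(3)[of i] X(3,4) by auto
    show "open_in_vecs K (y ` Y i)" for i
      by (rule opy[OF Y(1,3)])
  qed
qed

section \<open>Isomorphisms of translation groups\<close>

text \<open>Additivity and continuity alone give only real linearity, as complex conjugation shows.
  Near 0, however, \<open>h\<close> is the composition of \<open>\<phi>\<close>, its chart
  expression \<open>H\<close> and the inverse chart \<open>\<eta>\<close>, all with complex linear
  derivatives, and a linear map is its own derivative.\<close>

lemma isomorphism_complex_homogeneous:
  fixes h f g :: "complex ^ 'n \<Rightarrow> complex ^ 'n"
  assumes h: "linear h"
    and f: "condition_star_at UNIV f a U" "V \<subseteq> U" "open V" "0 \<in> V"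
    and g: "condition_star_at UNIV g b U'" "V' \<subseteq> U'" "open V'" "0 \<in> V'"
    and an: "\<And>i. analytic_at UNIV (\<lambda>z. g (h (inv_into V (\<lambda>x. f (x + a)) z) + b) $ i) (f a)"
  shows "h (c *s v) = c *s h v"
proof -
  define \<phi> \<psi> where "\<phi> = (\<lambda>x. f (x + a))" and "\<psi> = (\<lambda>x. g (x + b))"
  define H where "H = (\<lambda>z. \<psi> (h (inv_into V \<phi> z)))"
  define \<eta> where "\<eta> = inv_into U' \<psi>"
  obtain T where "analytic_diffeo UNIV U T \<phi>"
    using f(1) by (auto simp: condition_star_at_def \<phi>_def)
  then have "inj_on \<phi> U"
    by (simp add: analytic_diffeo_def bij_betw_def)
  then have inj\<phi>: "inj_on \<phi> V"
    using f(2) by (rule inj_on_subset)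
  obtain T' where T': "analytic_diffeo UNIV U' T' \<psi>"
    using g(1) by (auto simp: condition_star_at_def \<psi>_def)
  then have \<psi>: "bij_betw \<psi> U' T'" "analytic_map UNIV T' \<eta>"
    by (auto simp: analytic_diffeo_def \<eta>_def)
  have h0: "h 0 = 0"
    using linear_0[OF h] .
  have "0 + a \<in> regular f"
    using f by (auto simp: condition_star_at_def image_subset_iff add.commute)
  then have "holomorphic_at (\<lambda>x. f x $ i) (id 0 + a)" for i
    by (simp add: regular_def analytic_at_imp_holomorphic_at)
  then have "holomorphic_at (\<lambda>x. \<phi> x $ i) 0" for i
    unfolding \<phi>_def
    using holomorphic_at_compose_affine[of "\<lambda>x. f x $ i" "\<lambda>x. x" 0 a] by (simp add: bounded_linear_ident)
  from holomorphic_at_vector[of \<phi>, OF this] obtain A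
    where A: "(\<phi> has_derivative A) (at 0)" "\<forall>c v. A (c *s v) = c *s A v"
    by (elim exE conjE)
  have "holomorphic_at (\<lambda>z. H z $ i) (\<phi> 0)" for i
    using an[of i] by (intro analytic_at_imp_holomorphic_at) (simp add: H_def \<phi>_def \<psi>_def)
  from holomorphic_at_vector[of H, OF this] obtain B
    where B: "(H has_derivative B) (at (\<phi> 0))" "\<forall>c v. B (c *s v) = c *s B v"
    by (elim exE conjE)
  have H\<phi>: "H (\<phi> x) = \<psi> (h x)" if "x \<in> V" for x
    using inv_into_f_f[OF inj\<phi> that] by (simp add: H_def)
  have "\<psi> 0 \<in> T'"
    using bij_betwE[OF \<psi>(1)] g by auto
  then have "holomorphic_at (\<lambda>z. \<eta> z $ i) (\<psi> 0)" for i
    using \<psi>(2) by (intro analytic_at_imp_holomorphic_at) (simp add: analytic_map_def)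
  from holomorphic_at_vector[of \<eta>, OF this] obtain C
    where C: "(\<eta> has_derivative C) (at (\<psi> 0))" "\<forall>c v. C (c *s v) = c *s C v"
    by (elim exE conjE)
  have "\<psi> 0 = H (\<phi> 0)"
    using H\<phi>[OF f(4)] h0 by simp
  then have C': "(\<eta> has_derivative C) (at (H (\<phi> 0)))"
    using C(1) by simp
  have "((\<lambda>x. H (\<phi> x)) has_derivative (\<lambda>v. B (A v))) (at 0)"
    by (rule has_derivative_compose[where g = H, OF A(1) B(1)])
  then have deriv: "((\<lambda>x. \<eta> (H (\<phi> x))) has_derivative (\<lambda>v. C (B (A v)))) (at 0)"
    using C' by (rule has_derivative_compose[where g = \<eta> and f = "\<lambda>x. H (\<phi> x)"])
  have "continuous_on UNIV h"
    using h by (simp add: linear_conv_bounded_linear linear_continuous_on)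
  then have op: "open (V \<inter> h -` V')"
    using f(3) g(3) by (intro open_Int open_vimage)
  have mem: "0 \<in> V \<inter> h -` V'"
    using f(4) g(4) h0 by simp
  have eq: "\<eta> (H (\<phi> x)) = h x" if "x \<in> V \<inter> h -` V'" for x
    using that H\<phi>[of x] g(2) bij_betw_inv_into_left[OF \<psi>(1), of "h x"] by (auto simp: \<eta>_def)
  have "(h has_derivative (\<lambda>v. C (B (A v)))) (at 0)"
    by (rule has_derivative_transform_within_open[OF deriv op mem eq])
  moreover have "(h has_derivative h) (at 0)"
    using h by (intro bounded_linear_imp_has_derivative) (simp add: linear_conv_bounded_linear)
  ultimately have "(\<lambda>v. C (B (A v))) = h"
    by (rule has_derivative_unique)
  then have h_eq: "C (B (A w)) = h w" for w
    by (simp add: fun_eq_iff)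
  show ?thesis
    unfolding h_eq[symmetric] by (simp add: A(2) B(2) C(2))
qed

lemma openin_linear_image_vecs:
  fixes L :: "complex ^ 'n \<Rightarrow> complex ^ 'n"
  assumes "linear L" "bij L" "L ` vecs K = vecs K" "open_in_vecs K X"
  shows "open_in_vecs K (L ` X)"
proof -
  obtain T where T: "open T" "X = vecs K \<inter> T"
    using assms(4) by (auto simp: openin_open)
  have "open (L ` T)"
    using open_surjective_linear_image[OF T(1) assms(1)] assms(2) by (simp add: bij_def)
  moreover have "L ` X = vecs K \<inter> L ` T"
    unfolding T(2) image_Int[OF bij_is_inj[OF assms(2)]] assms(3) ..
  ultimately show ?thesis
    by (auto simp: openin_open)
qed

lemma openin_translate_vecs:
  fixes X :: "(complex ^ 'n) set"
  assumes K: "K = \<real> \<or> K = UNIV" and "p \<in> vecs K" "open_in_vecs K X"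
  shows "open_in_vecs K ((\<lambda>x. x - p) ` X)"
proof -
  obtain T where T: "open T" "X = vecs K \<inter> T"
    using assms(3) by (auto simp: openin_open)
  have V: "subspace (vecs K)"
    by (rule subspace_vecs[OF K])
  have "(\<lambda>x. x - p) ` X = vecs K \<inter> (\<lambda>x. x - p) ` T"
  proof
    show "(\<lambda>x. x - p) ` X \<subseteq> vecs K \<inter> (\<lambda>x. x - p) ` T"
      using T(2) subspace_diff[OF V _ assms(2)] by auto
    show "vecs K \<inter> (\<lambda>x. x - p) ` T \<subseteq> (\<lambda>x. x - p) ` X"
    proof
      fix y assume "y \<in> vecs K \<inter> (\<lambda>x. x - p) ` T"
      then obtain t where t: "t \<in> T" "y = t - p" "y \<in> vecs K"
        by blast
      then have "t \<in> X"
        using T(2) subspace_add[OF V t(3) assms(2)] by simp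
      then show "y \<in> (\<lambda>x. x - p) ` X"
        using t(2) by blast
    qed
  qed
  moreover have "open ((\<lambda>x. x - p) ` T)"
    by (rule open_translation_subtract[OF T(1)])
  ultimately show ?thesis
    by (auto simp: openin_open)
qed

lemma algebraic_on_mpoly:
  fixes P :: "('n::finite option \<Rightarrow>\<^sub>0 nat) \<Rightarrow>\<^sub>0 complex"
  assumes "Poly_Mapping.keys P \<noteq> {}"
    and "\<And>x. x \<in> X \<Longrightarrow> mpoly_eval (\<lambda>c. c) P (case_option (y x) (z x)) = 0"
  shows "algebraic_on X z y"
proof (rule mpoly_eval_case_option[of P])
  fix d e q
  assume eval: "\<And>z y. mpoly_eval (\<lambda>c. c) P (case_option y z) = (\<Sum>k\<le>d. box_poly e (q k) z * y ^ k)"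
    and keys: "\<And>\<alpha>. \<alpha> \<in> Poly_Mapping.keys P \<Longrightarrow>
      Poly_Mapping.lookup \<alpha> None \<le> d \<and> (\<lambda>i. Poly_Mapping.lookup \<alpha> (Some i)) \<in> exps e \<and>
      q (Poly_Mapping.lookup \<alpha> None) (\<lambda>i. Poly_Mapping.lookup \<alpha> (Some i)) \<noteq> 0"
  obtain \<alpha> where "\<alpha> \<in> Poly_Mapping.keys P"
    using assms(1) by blast
  then have "\<exists>k\<le>d. \<exists>\<gamma>\<in>exps e. q k \<gamma> \<noteq> 0"
    using keys by blast
  moreover have "\<forall>x\<in>X. (\<Sum>k\<le>d. box_poly e (q k) (z x) * y x ^ k) = 0"
    using assms(2) by (simp add: eval)
  ultimately show ?thesis
    unfolding algebraic_on_def by blast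
qed

text \<open>The isomorphism is read at the neutral element in the target chart around 0. The locally
  Nash condition provides only some source chart, centred at an unknown \<open>p\<close>; this is
  the origin of the shift \<open>x - p\<close>.\<close>

lemma nash_isomorphism_relation:
  fixes f g :: "complex ^ 'n \<Rightarrow> complex ^ 'n"
  assumes K: "K = \<real> \<or> K = UNIV"
    and f: "condition_star_at K f a U" "V \<subseteq> U" "open_in_vecs K V" "0 \<in> V"
    and g: "condition_star_at K g b U'" "V' \<subseteq> U'" "open_in_vecs K V'" "0 \<in> V'"
    and iso: "nash_isomorphic K (translation_group K f a V) (translation_group K g b V')"
  obtains L p X where "linear L" "\<forall>c x. L (c *s x) = c *s L x" "bij L" "L ` vecs K = vecs K"
    "p \<in> vecs K" "open_in_vecs K X" "X \<noteq> {}" "(\<lambda>x. x - p) ` X \<subseteq> V" "L ` X \<subseteq> V'"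
    "\<forall>i. algebraic_on X (\<lambda>x. ($) (f (x - p + a))) (\<lambda>x. g (L x + b) $ i)"
proof -
  let ?F = "translation_group K f a V" and ?G = "translation_group K g b V'"
  from iso[unfolded nash_isomorphic_def]
  obtain h where h: "h \<in> iso ?F ?G"
    "analytic_manifold_diffeo K (topol ?F) (atlas ?F) (topol ?G) (atlas ?G) h"
    "locally_nash_map K (topol ?F) (atlas ?F) (topol ?G) (atlas ?G) h"
    by (elim exE conjE)
  have V: "subspace (vecs K :: (complex ^ 'n) set)"
    by (rule subspace_vecs[OF K])
  have chart_f: "((+) p ` V, \<lambda>x. f (x - p + a)) \<in> atlas ?F" if "p \<in> vecs K" for p
    using that by (auto simp: translation_group_def)
  have chart_g: "((+) p ` V', \<lambda>x. g (x - p + b)) \<in> atlas ?G" if "p \<in> vecs K" for p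
    using that by (auto simp: translation_group_def)
  have zero: "0 \<in> (vecs K :: (complex ^ 'n) set)"
    by (rule subspace_0[OF V])
  have add: "h (x + y) = h x + h y" if "x \<in> vecs K" "y \<in> vecs K" for x y
    using h(1) that by (auto simp: iso_def hom_def translation_group_def)
  have bij: "bij_betw h (vecs K) (vecs K)"
    using h(1) by (auto simp: iso_def translation_group_def)
  have cont: "continuous_on (vecs K) h"
    using h(3) by (auto simp: locally_nash_map_def translation_group_def)
  have h0: "h 0 = 0"
    using add[OF zero zero] by simp
  have real: "h (t *\<^sub>R x) = t *\<^sub>R h x" if "x \<in> vecs K" for t x
    by (rule additive_scaleR[OF V cont add that])
  \<comment> \<open>For \<open>K = \<real>\<close> this is real homogeneity again; for
    \<open>K = UNIV\<close> the analyticity of \<open>h\<close> in the charts around 0 has to be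
    brought in.\<close>
  have hom: "h (c *s x) = c *s h x" if c: "c \<in> K" and x: "x \<in> vecs K" for c x
  proof (cases "K = UNIV")
    case True
    have "linear h"
      using add real True by (intro linearI) auto
    moreover have "analytic_at UNIV (\<lambda>z. g (h (inv_into V (\<lambda>x. f (x + a)) z) + b) $ i) (f a)" for i
    proof -
      have "analytic_manifold_map K (topol ?F) (atlas ?F) (topol ?G) (atlas ?G) h"
        using h(2) by (simp add: analytic_manifold_diffeo_def)
      from this[unfolded analytic_manifold_map_def, THEN conjunct2, THEN bspec, OF chart_f[OF zero]]
      have "\<forall>(V', \<psi>)\<in>atlas ?G. \<forall>q\<in>V. h q \<in> V' \<longrightarrow>
          (\<forall>i. analytic_at K (\<lambda>z. \<psi> (h (inv_into V (\<lambda>x. f (x + a)) z)) $ i) (f (q + a)))"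
        by simp
      from this[THEN bspec, OF chart_g[OF zero]]
      have "\<forall>q\<in>V. h q \<in> V' \<longrightarrow>
          (\<forall>i. analytic_at K (\<lambda>z. g (h (inv_into V (\<lambda>x. f (x + a)) z) + b) $ i) (f (q + a)))"
        by simp
      from this[THEN bspec, OF f(4)] show ?thesis
        using g(4) h0 True by simp
    qed
    ultimately show ?thesis
      using f g unfolding True
      by (intro isomorphism_complex_homogeneous[of h f a U V g b U' V']) (auto simp: True)
  next
    case False
    then obtain t where "c = complex_of_real t"
      using K c by (auto elim: Reals_cases)
    then have "c *s v = t *\<^sub>R v" for v :: "complex ^ 'n"
      by (simp only: vec_eq_iff vector_scaleR_component vector_smult_component
          scaleR_conv_of_real[where 'a = complex]) simp
    then show ?thesis
      using real[OF x] by simp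
  qed
  have surj: "vecs K \<subseteq> h ` vecs K"
    using bij by (simp add: bij_betw_def)
  obtain L where L: "linear L" "\<forall>c x. L (c *s x) = c *s L x" "bij L" and Lh: "\<forall>x\<in>vecs K. L x = h x"
    by (rule complex_linear_extension[where h = h, OF K add hom surj])
  have Lvecs: "L ` vecs K = vecs K"
    using Lh bij_betw_imp_surj_on[OF bij] by (simp cong: image_cong)
  have "\<forall>(V', \<psi>)\<in>atlas ?G. h 0 \<in> V' \<longrightarrow>
      (\<exists>(U', \<phi>)\<in>atlas ?F. \<exists>U. openin (topol ?F) U \<and> U \<subseteq> U' \<and> 0 \<in> U \<and> h ` U \<subseteq> V' \<and>
         nash_map K (\<phi> ` U) (\<lambda>z. \<psi> (h (inv_into U' \<phi> z))))"
    using h(3) zero unfolding locally_nash_map_def by (simp add: translation_group_def)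
  from this[THEN bspec, OF chart_g[OF zero]]
  have "\<exists>(W, \<phi>)\<in>atlas ?F. \<exists>X. openin (topol ?F) X \<and> X \<subseteq> W \<and> 0 \<in> X \<and> h ` X \<subseteq> V' \<and>
      nash_map K (\<phi> ` X) (\<lambda>z. g (h (inv_into W \<phi> z) + b))"
    using g(4) by (simp add: h0)
  then obtain p X where p: "p \<in> vecs K"
    and X: "open_in_vecs K X" "X \<subseteq> (+) p ` V" "0 \<in> X" "h ` X \<subseteq> V'"
      "nash_map K ((\<lambda>x. f (x - p + a)) ` X) (\<lambda>z. g (h (inv_into ((+) p ` V) (\<lambda>x. f (x - p + a)) z) + b))"
    by (auto simp: translation_group_def)
  define \<phi> where "\<phi> = (\<lambda>x. f (x - p + a))"
  have XK: "X \<subseteq> vecs K"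
    using openin_imp_subset[OF X(1)] .
  have XV: "(\<lambda>x. x - p) ` X \<subseteq> V"
    using X(2) by auto
  obtain T where "analytic_diffeo K U T (\<lambda>u. f (u + a))"
    using f(1) by (auto simp: condition_star_at_def)
  then have "inj_on (\<lambda>u. f (u + a)) V"
    using f(2) by (auto simp: analytic_diffeo_def bij_betw_def intro: inj_on_subset)
  then have "inj_on \<phi> ((+) p ` V)"
    by (auto simp: inj_on_def \<phi>_def)
  then have inv: "inv_into ((+) p ` V) \<phi> (\<phi> x) = x" if "x \<in> X" for x
    using that X(2) by (intro inv_into_f_f) auto
  have alg: "algebraic_on X (\<lambda>x. ($) (f (x - p + a))) (\<lambda>x. g (L x + b) $ i)" for i
  proof -
    from X(5)[unfolded nash_map_def, THEN conjunct2, THEN conjunct2, THEN conjunct2, THEN spec, of i]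
    obtain P :: "('n option \<Rightarrow>\<^sub>0 nat) \<Rightarrow>\<^sub>0 complex"
      where P: "\<exists>\<alpha>\<in>Poly_Mapping.keys P. Poly_Mapping.lookup \<alpha> None > 0"
        "\<forall>u\<in>\<phi> ` X. mpoly_eval (\<lambda>c. c) P (case_option (g (h (inv_into ((+) p ` V) \<phi> u) + b) $ i) (($) u)) = 0"
      unfolding \<phi>_def by (elim exE conjE)
    show ?thesis
    proof (rule algebraic_on_mpoly[of P])
      show "Poly_Mapping.keys P \<noteq> {}"
        using P(1) by blast
      show "mpoly_eval (\<lambda>c. c) P (case_option (g (L x + b) $ i) (($) (f (x - p + a)))) = 0" if x: "x \<in> X" for x
      proof -
        have "L x = h x"
          using x XK Lh by blast
        then show ?thesis
          using P(2)[THEN bspec, OF imageI[OF x]] inv[OF x] by (simp add: \<phi>_def)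
      qed
    qed
  qed
  have "L ` X \<subseteq> V'"
    using X(4) XK Lh by (auto simp: subset_iff)
  moreover have "X \<noteq> {}"
    using X(3) by blast
  ultimately show ?thesis
    using that[of L p X] L Lvecs p X(1) XV alg by simp
qed

lemma subgroup_add_periods:
  assumes "meromorphic_map f"
  shows "subgroup_add (periods f)"
proof -
  have eq: "a \<in> periods f \<longleftrightarrow> (\<forall>i. a \<in> fun_periods (regular f) (\<lambda>x. f x $ i))" for a
    by (auto simp: periods_def fun_periods_def vec_eq_iff)
  show ?thesis
  proof (intro conjI ballI)
    show "0 \<in> periods f"
      unfolding eq by (simp add: fun_periods_zero)
    fix a assume a: "a \<in> periods f"
    then show "- a \<in> periods f"
      unfolding eq by (simp add: fun_periods_uminus)
    fix b assume "b \<in> periods f"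
    with a show "a + b \<in> periods f"
      unfolding eq by (simp add: fun_periods_add[OF meromorphic_map_component[OF assms]])
  qed
qed

theorem proposition5p8:
  fixes K :: "complex set"
    and f g :: "complex ^ 'n::finite \<Rightarrow> complex ^ 'n"
    and F G :: "(complex ^ 'n, 'n) manifold_group"
  assumes "K = \<real> \<or> K = UNIV"
    and "K_meromorphic K f" and "admits_AAT K (germ f)" and "condition_star K f"
    and "K_meromorphic K g" and "admits_AAT K (germ g)" and "condition_star K g"
    and "is_translation_group K f F" and "is_translation_group K g G"
    and "nash_isomorphic K F G"
  shows "zrank (periods f) = zrank (periods g)"
proof -
  note K = assms(1)
  have mer: "meromorphic_map f" "meromorphic_map g"
    using assms(2,5) by (simp_all add: K_meromorphic_def)
  obtain a U V where f: "condition_star_at K f a U" "V \<subseteq> U" "open_in_vecs K V" "0 \<in> V"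
    and F: "F = translation_group K f a V"
    using assms(8) by (auto simp: is_translation_group_def)
  obtain b U' V' where g: "condition_star_at K g b U'" "V' \<subseteq> U'" "open_in_vecs K V'" "0 \<in> V'"
    and G: "G = translation_group K g b V'"
    using assms(9) by (auto simp: is_translation_group_def)
  obtain L p X where L: "linear L" "\<forall>c x. L (c *s x) = c *s L x" "bij L" "L ` vecs K = vecs K"
    and X: "p \<in> vecs K" "open_in_vecs K X" "X \<noteq> {}" "(\<lambda>x. x - p) ` X \<subseteq> V" "L ` X \<subseteq> V'"
    and alg: "\<forall>i. algebraic_on X (\<lambda>x. ($) (f (x - p + a))) (\<lambda>x. g (L x + b) $ i)"
    by (rule nash_isomorphism_relation[OF K f g assms(10)[unfolded F G]])
  define z y where "z = (\<lambda>x. f (x - p + a))" and "y = (\<lambda>x. g (L x + b))"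
  \<comment> \<open>The regular sets pulled back along the affine maps that occur in
    \<open>z\<close> and \<open>y\<close>.\<close>
  define \<Omega> \<Omega>' where "\<Omega> = {x. x + (a - p) \<in> regular f}" and "\<Omega>' = {x. L x + b \<in> regular g}"
  have z_eq: "z = (\<lambda>x. f (x + (a - p)))"
    by (auto simp: z_def algebra_simps)
  have z: "meromorphic_fun \<Omega> (\<lambda>x. z x $ l)" for l
    unfolding z_eq \<Omega>_def by (rule meromorphic_fun_translate[OF meromorphic_map_component[OF mer(1)]])
  have y: "meromorphic_fun \<Omega>' (\<lambda>x. y x $ l)" for l
    unfolding y_def \<Omega>'_def
    using L by (intro meromorphic_fun_compose_affine[OF meromorphic_map_component[OF mer(2)]])
      (auto simp: linear_conv_bounded_linear)
  have regf: "u + a \<in> regular f" if "u \<in> V" for u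
    using f(1,2) that by (auto simp: condition_star_at_def image_subset_iff add.commute)
  have regg: "u + b \<in> regular g" if "u \<in> V'" for u
    using g(1,2) that by (auto simp: condition_star_at_def image_subset_iff add.commute)
  have "X \<subseteq> \<Omega>"
    using X(4) regf by (force simp: \<Omega>_def algebra_simps)
  moreover have "X \<subseteq> \<Omega>'"
    using X(5) regg by (auto simp: \<Omega>'_def)
  moreover obtain T where T: "analytic_diffeo K U T (\<lambda>u. f (u + a))"
    using f(1) by (auto simp: condition_star_at_def)
  have "open_in_vecs K (z ` Y)" if Y: "open_in_vecs K Y" "Y \<subseteq> X" for Y
  proof -
    have "open_in_vecs K ((\<lambda>u. f (u + a)) ` (\<lambda>x. x - p) ` Y)"
      using X(4) Y(2) f(2)
      by (intro analytic_diffeo_open_image[OF K T] openin_translate_vecs[OF K X(1) Y(1)]) auto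
    then show ?thesis
      by (simp add: image_image z_def)
  qed
  moreover obtain T' where T': "analytic_diffeo K U' T' (\<lambda>u. g (u + b))"
    using g(1) by (auto simp: condition_star_at_def)
  have "open_in_vecs K (y ` Y)" if Y: "open_in_vecs K Y" "Y \<subseteq> X" for Y
  proof -
    have "open_in_vecs K ((\<lambda>u. g (u + b)) ` L ` Y)"
      using X(5) Y(2) g(2)
      by (intro analytic_diffeo_open_image[OF K T'] openin_linear_image_vecs[OF L(1,3,4) Y(1)]) auto
    then show ?thesis
      by (simp add: image_image y_def)
  qed
  moreover have "algebraic_on X (\<lambda>x. ($) (z x)) (\<lambda>x. y x $ i)" for i
    using alg by (simp add: z_def y_def)
  ultimately have comm: "\<exists>N>0. \<forall>c\<in>fun_periods \<Omega> z. real N *\<^sub>R c \<in> fun_periods \<Omega>' y"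
    "\<exists>N>0. \<forall>c\<in>fun_periods \<Omega>' y. real N *\<^sub>R c \<in> fun_periods \<Omega> z"
    using algebraic_periods_commensurable[OF K z y X(2,3)] by simp_all
  obtain L' where L': "linear L'" "\<And>x. L' (L x) = x" "\<And>x. L (L' x) = x"
    using linear_injective_isomorphism[OF L(1) bij_is_inj[OF L(3)]] that by auto
  \<comment> \<open>A translation of the argument does not change the period group.\<close>
  have per_z: "fun_periods \<Omega> z = periods f"
  proof -
    have "(\<forall>u. u + (a - p) \<in> regular f \<and> u + c + (a - p) \<in> regular f \<longrightarrow> f (u + (a - p)) = f (u + c + (a - p))) \<longleftrightarrow>
        (\<forall>u. u \<in> regular f \<and> u + c \<in> regular f \<longrightarrow> f u = f (u + c))" (is "?l \<longleftrightarrow> ?r") for c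
    proof
      assume l: ?l
      show ?r
      proof (intro allI impI)
        fix u assume "u \<in> regular f \<and> u + c \<in> regular f"
        then show "f u = f (u + c)"
          using l[THEN spec, of "u - (a - p)"] by (simp add: algebra_simps)
      qed
    next
      assume r: ?r
      show ?l
      proof (intro allI impI)
        fix u assume "u + (a - p) \<in> regular f \<and> u + c + (a - p) \<in> regular f"
        then show "f (u + (a - p)) = f (u + c + (a - p))"
          using r[THEN spec, of "u + (a - p)"] by (simp add: algebra_simps)
      qed
    qed
    then show ?thesis
      by (simp add: fun_periods_def periods_def z_eq \<Omega>_def)
  qed
  have per_y: "c \<in> fun_periods \<Omega>' y \<longleftrightarrow> L c \<in> periods g" for c
  proof
    assume c: "c \<in> fun_periods \<Omega>' y"
    show "L c \<in> periods g"
      unfolding periods_def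
    proof (intro CollectI allI impI)
      fix u assume u: "u \<in> regular g \<and> u + L c \<in> regular g"
      have "L (L' (u - b)) + b = u" "L (L' (u - b) + c) + b = u + L c"
        by (simp_all add: L' linear_add[OF L(1)])
      then show "g u = g (u + L c)"
        using c u unfolding fun_periods_def \<Omega>'_def y_def by (metis (mono_tags, lifting) mem_Collect_eq)
    qed
  next
    assume c: "L c \<in> periods g"
    have eq: "L (u + c) + b = (L u + b) + L c" for u
      by (simp add: linear_add[OF L(1)])
    show "c \<in> fun_periods \<Omega>' y"
      unfolding fun_periods_def \<Omega>'_def y_def mem_Collect_eq eq
      using c by (simp add: periods_def)
  qed
  obtain N where N: "N > 0" "\<And>c. c \<in> periods f \<Longrightarrow> L (real N *\<^sub>R c) \<in> periods g"
    using comm(1) unfolding per_z per_y by auto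
  obtain N' where N': "N' > 0" "\<And>c. L c \<in> periods g \<Longrightarrow> real N' *\<^sub>R c \<in> periods f"
    using comm(2) unfolding per_z Ball_def per_y by auto
  \<comment> \<open>Multiplication by a positive integer is injective; composed with
    \<open>L\<close> or with its inverse \<open>L'\<close> it embeds each period group in the
    other.\<close>
  show ?thesis
  proof (rule zrank_eqI)
    show "linear (\<lambda>c. L (real N *\<^sub>R c))" "linear (\<lambda>c. real N' *\<^sub>R L' c)"
      using L(1) L'(1) by (auto intro!: linearI simp: linear_add linear_scale algebra_simps)
    show "inj (\<lambda>c. L (real N *\<^sub>R c))"
      using N(1) inj_eq[OF bij_is_inj[OF L(3)]] by (auto intro!: injI)
    show "inj (\<lambda>c. real N' *\<^sub>R L' c)"
    proof (rule injI)
      fix u v assume "real N' *\<^sub>R L' u = real N' *\<^sub>R L' v"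
      then have "L (L' u) = L (L' v)"
        using N'(1) by simp
      then show "u = v"
        by (simp only: L'(3))
    qed
    show "(\<lambda>c. L (real N *\<^sub>R c)) ` periods f \<subseteq> periods g"
      using N(2) by blast
    show "(\<lambda>c. real N' *\<^sub>R L' c) ` periods g \<subseteq> periods f"
      using N'(2) L'(3) by auto
  qed (use subgroup_add_periods mer in blast)+
qed

end
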